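(* Let $n\ge 4$ and let $G$ be a minimally 3-connected braced polygon graph with $n$ vertices. Then the following are equivalent: (a) all strictly convex braced polygons $(G,\mathbf p)$ are infinitesimally rigid (in $\mathbb{R}^2$); (b) all strictly convex braced polygons $(G,\mathbf p)$ are convexly rigid; (c) all strictly convex braced polygons $(G,\mathbf p)$ are globally rigid (in $\mathbb{R}^2$); (d) all strictly convex braced polygons $(G,\mathbf p)$ are super stable; (e) all strictly convex braced polygons $(G,\mathbf p)$ are properly stressed; (g) $G$ is a generic rigidity circuit; (h) $G$ has $n-2$ internal braces.
   Context: A braced polygon graph is a finite simple graph $G$ on vertices $1,\dots,n$ with a distinguished Hamilton cycle whose edges $\{i,i+1\}$ (indices modulo $n$) are called boundary edges; the other edges are called (internal) braces. It is minimally 3-connected if it is 3-connected (as a graph) and removing any brace makes it no longer 3-connected. A convex polygon in the plane is strictly convex if each vertex lies on a line that intersects the polygon only at this vertex. A strictly convex braced polygon $(G,\mathbf p)$ is a realisation $\mathbf p=(p_1,\dots,p_n)$, $p_i\in\mathbb{R}^2$, such that $p_1,\dots,p_n$ are, in this cyclic order, the vertices of a strictly convex polygon with edges $p_ip_{i+1}$. An infinitesimal flex of $(G,\mathbf p)$ in $\mathbb{R}^d$ is $\mathbf p'=(p'_1,\dots,p'_n)$ with $(p_i-p_j)\cdot(p'_i-p'_j)=0$ for every edge $ij$; it is trivial if it is the derivative of a smooth family of congruences of $\mathbb{R}^d$ restricted to $\mathbf p$. $(G,\mathbf p)$ is infinitesimally rigid if every infinitesimal flex is trivial. $(G,\mathbf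 p)$ and $(G,\mathbf q)$ are congruent if $\|p_i-p_j\|=\|q_i-q_j\|$ for all $i<j$. $(G,\mathbf p)$ is globally rigid in $\mathbb{R}^d$ if every $(G,\mathbf q)$ in $\mathbb{R}^d$ with the same edge lengths (i.e. $\|q_i-q_j\|=\|p_i-p_j\|$ for every edge $ij$) is congruent to $(G,\mathbf p)$. A strictly convex braced polygon $(G,\mathbf p)$ is convexly rigid if every strictly convex braced polygon $(G,\mathbf q)$ with the same edge lengths is congruent to $(G,\mathbf p)$. A stress is a function $\omega:E(G)\to\mathbb{R}$; it is an equilibrium stress of $(G,\mathbf p)$ if $\sum_j\omega_{ij}(p_i-p_j)=0$ for every vertex $i$ (with $\omega_{ij}=0$ if $ij$ is not an edge). Its stress matrix $\Omega$ is the symmetric $n\times n$ matrix with $\Omega_{ij}=-\omega_{ij}$ for each edge $ij$, $\Omega_{ij}=0$ for $i\ne j$ non-adjacent, and all row sums $0$. An equilibrium stress of a convex braced polygon is proper if it is positive on every boundary edge and negative on every brace; the polygon is properly stressed if it has a proper stress. A framework $(G,\mathbf p)$ in $\mathbb{R}^d$ is super stable if it has an equilibrium stress whose stress matrix $\Omega$ is positive semidefinite of rank $n-d-1$, and every affine transformation preserving the lengths of all edges of $(G,\mathbf p)$ is a trivial motion (congruence) of the framework. (Here $d=2$.) A graph with $n$ vertices and $m$ edges is a generic rigidity circuit if $m=2n-2$ and every subgraph on $k$ vertices with $2\le k<n$ has at most $2k-3$ edges. *)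

theory Defs
  imports "HOL-Analysis.Analysis" "Jordan_Normal_Form.DL_Rank"
begin

section \<open>Graphs\<close>

text \<open>The vertices of an \<open>n\<close>-vertex graph are \<open>0, \<dots>, n - 1\<close>. A simple graph is given
  by its set of edges, each a two-element set of vertices.\<close>

definition simple_graph :: "nat set \<Rightarrow> nat set set \<Rightarrow> bool" where
  "simple_graph V E \<longleftrightarrow> finite V \<and> (\<forall>e\<in>E. \<exists>u\<in>V. \<exists>v\<in>V. u \<noteq> v \<and> e = {u, v})"

definition subgraph :: "nat set \<Rightarrow> nat set set \<Rightarrow> nat set \<Rightarrow> nat set set \<Rightarrow> bool" where
  "subgraph W F V E \<longleftrightarrow> simple_graph W F \<and> W \<subseteq> V \<and> F \<subseteq> E"

definition connected_graph :: "nat set \<Rightarrow> nat set set \<Rightarrow> bool" where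
  "connected_graph V E \<longleftrightarrow>
    V \<noteq> {} \<and> (\<forall>u\<in>V. \<forall>v\<in>V. (u, v) \<in> {(x, y). x \<in> V \<and> y \<in> V \<and> {x, y} \<in> E}\<^sup>*)"

definition k_connected :: "nat \<Rightarrow> nat set \<Rightarrow> nat set set \<Rightarrow> bool" where
  "k_connected k V E \<longleftrightarrow>
    k < card V \<and> (\<forall>S\<subseteq>V. card S < k \<longrightarrow> connected_graph (V - S) {e \<in> E. e \<inter> S = {}})"

definition boundary_edges :: "nat \<Rightarrow> nat set set" where
  "boundary_edges n = {{i, (i + 1) mod n} | i. i < n}"

definition braced_polygon_graph :: "nat \<Rightarrow> nat set set \<Rightarrow> bool" where
  "braced_polygon_graph n E \<longleftrightarrow> 3 \<le> n \<and> simple_graph {..<n} E \<and> boundary_edges n \<subseteq> E"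

definition braces :: "nat \<Rightarrow> nat set set \<Rightarrow> nat set set" where
  "braces n E = E - boundary_edges n"

definition minimally_3_connected_braced_polygon :: "nat \<Rightarrow> nat set set \<Rightarrow> bool" where
  "minimally_3_connected_braced_polygon n E \<longleftrightarrow>
    braced_polygon_graph n E \<and> k_connected 3 {..<n} E \<and>
    (\<forall>e\<in>braces n E. \<not> k_connected 3 {..<n} (E - {e}))"

definition generic_rigidity_circuit :: "nat \<Rightarrow> nat set set \<Rightarrow> bool" where
  "generic_rigidity_circuit n E \<longleftrightarrow>
    card E + 2 = 2 * n \<and>
    (\<forall>W F. subgraph W F {..<n} E \<and> 2 \<le> card W \<and> card W < n \<longrightarrow> card F + 3 \<le> 2 * card W)"

section \<open>Frameworks\<close>

text \<open>A realisation is a function on \<^typ>\<open>nat\<close> of which only the values on \<open>{..<n}\<close> matter.\<close>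

definition same_edge_lengths ::
    "nat set set \<Rightarrow> (nat \<Rightarrow> 'a::euclidean_space) \<Rightarrow> (nat \<Rightarrow> 'a) \<Rightarrow> bool" where
  "same_edge_lengths E p q \<longleftrightarrow>
    (\<forall>i j. {i, j} \<in> E \<longrightarrow> norm (q i - q j) = norm (p i - p j))"

definition congruent_realisations ::
    "nat \<Rightarrow> (nat \<Rightarrow> 'a::euclidean_space) \<Rightarrow> (nat \<Rightarrow> 'a) \<Rightarrow> bool" where
  "congruent_realisations n p q \<longleftrightarrow> (\<forall>i<n. \<forall>j<n. i < j \<longrightarrow> norm (p i - p j) = norm (q i - q j))"

definition globally_rigid :: "nat \<Rightarrow> nat set set \<Rightarrow> (nat \<Rightarrow> 'a::euclidean_space) \<Rightarrow> bool" where
  "globally_rigid n E p \<longleftrightarrow> (\<forall>q. same_edge_lengths E p q \<longrightarrow> congruent_realisations n p q)"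

definition infinitesimal_flex ::
    "nat set set \<Rightarrow> (nat \<Rightarrow> 'a::euclidean_space) \<Rightarrow> (nat \<Rightarrow> 'a) \<Rightarrow> bool" where
  "infinitesimal_flex E p p' \<longleftrightarrow> (\<forall>i j. {i, j} \<in> E \<longrightarrow> inner (p i - p j) (p' i - p' j) = 0)"

definition smooth_curve :: "(real \<Rightarrow> 'a::real_normed_vector) \<Rightarrow> bool" where
  "smooth_curve c \<longleftrightarrow>
    (\<exists>D :: nat \<Rightarrow> real \<Rightarrow> 'a. D 0 = c \<and>
      (\<forall>k t. (D k has_vector_derivative D (Suc k) t) (at t)))"

definition congruence_map :: "('a::euclidean_space \<Rightarrow> 'a) \<Rightarrow> bool" where
  "congruence_map f \<longleftrightarrow> (\<forall>x y. norm (f x - f y) = norm (x - y))"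

text \<open>A family of congruences is a family of maps \<open>x \<mapsto> A t x + b t\<close> with \<open>A t\<close> orthogonal,
  so that its smoothness is the smoothness of all its orbits \<open>t \<mapsto> \<Phi> t x\<close>.\<close>

definition trivial_flex ::
    "nat \<Rightarrow> (nat \<Rightarrow> 'a::euclidean_space) \<Rightarrow> (nat \<Rightarrow> 'a) \<Rightarrow> bool" where
  "trivial_flex n p p' \<longleftrightarrow>
    (\<exists>\<Phi> :: real \<Rightarrow> 'a \<Rightarrow> 'a.
      (\<forall>t. congruence_map (\<Phi> t)) \<and> (\<forall>x. smooth_curve (\<lambda>t. \<Phi> t x)) \<and> \<Phi> 0 = id \<and>
      (\<forall>i<n. ((\<lambda>t. \<Phi> t (p i)) has_vector_derivative p' i) (at 0)))"

definition infinitesimally_rigid ::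
    "nat \<Rightarrow> nat set set \<Rightarrow> (nat \<Rightarrow> 'a::euclidean_space) \<Rightarrow> bool" where
  "infinitesimally_rigid n E p \<longleftrightarrow>
    (\<forall>p'. infinitesimal_flex E p p' \<longrightarrow> trivial_flex n p p')"

section \<open>Stresses\<close>

text \<open>A stress is a function on edges; \<open>stress_coeff E \<omega> i j\<close> is $\omega_{ij}$, extended by
  zero to pairs that are not edges.\<close>

definition stress_coeff :: "nat set set \<Rightarrow> (nat set \<Rightarrow> real) \<Rightarrow> nat \<Rightarrow> nat \<Rightarrow> real" where
  "stress_coeff E \<omega> i j = (if {i, j} \<in> E then \<omega> {i, j} else 0)"

definition equilibrium_stress ::
    "nat \<Rightarrow> nat set set \<Rightarrow> (nat \<Rightarrow> 'a::euclidean_space) \<Rightarrow> (nat set \<Rightarrow> real) \<Rightarrow> bool" where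
  "equilibrium_stress n E p \<omega> \<longleftrightarrow>
    (\<forall>i<n. (\<Sum>j<n. stress_coeff E \<omega> i j *\<^sub>R (p i - p j)) = 0)"

definition stress_matrix :: "nat \<Rightarrow> nat set set \<Rightarrow> (nat set \<Rightarrow> real) \<Rightarrow> real mat" where
  "stress_matrix n E \<omega> =
    mat n n (\<lambda>(i, j). if i = j then \<Sum>k\<in>{..<n} - {i}. stress_coeff E \<omega> i k
                      else - stress_coeff E \<omega> i j)"

definition positive_semidefinite :: "nat \<Rightarrow> real mat \<Rightarrow> bool" where
  "positive_semidefinite n A \<longleftrightarrow>
    A \<in> carrier_mat n n \<and> A\<^sup>T = A \<and> (\<forall>x\<in>carrier_vec n. 0 \<le> scalar_prod x (A *\<^sub>v x))"

text \<open>The rank condition is $\mathrm{rank}\,\Omega = n - d - 1$, written without the truncated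
  subtraction on \<^typ>\<open>nat\<close>.\<close>

definition super_stable :: "nat \<Rightarrow> nat set set \<Rightarrow> (nat \<Rightarrow> 'a::euclidean_space) \<Rightarrow> bool" where
  "super_stable n E p \<longleftrightarrow>
    (\<exists>\<omega>. equilibrium_stress n E p \<omega> \<and>
      positive_semidefinite n (stress_matrix n E \<omega>) \<and>
      vec_space.rank n (stress_matrix n E \<omega>) + DIM('a) + 1 = n) \<and>
    (\<forall>(A :: 'a \<Rightarrow> 'a) b. linear A \<and> same_edge_lengths E p (\<lambda>i. A (p i) + b) \<longrightarrow>
      congruent_realisations n p (\<lambda>i. A (p i) + b))"

section \<open>Strictly convex braced polygons\<close>

text \<open>The polygon is the convex hull of the points, i.e. it includes its interior.\<close>

definition strictly_convex_polygon :: "nat \<Rightarrow> (nat \<Rightarrow> real^2) \<Rightarrow> bool" where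
  "strictly_convex_polygon n p \<longleftrightarrow>
    (let P = convex hull (p ` {..<n}) in
      aff_dim P = 2 \<and>
      inj_on p {..<n} \<and>
      {x. x extreme_point_of P} = p ` {..<n} \<and>
      (\<forall>i<n. closed_segment (p i) (p ((i + 1) mod n)) edge_of P) \<and>
      (\<forall>i<n. \<exists>L. affine L \<and> aff_dim L = 1 \<and> L \<inter> P = {p i}))"

definition convexly_rigid :: "nat \<Rightarrow> nat set set \<Rightarrow> (nat \<Rightarrow> real^2) \<Rightarrow> bool" where
  "convexly_rigid n E p \<longleftrightarrow>
    (\<forall>q. strictly_convex_polygon n q \<and> same_edge_lengths E p q \<longrightarrow> congruent_realisations n p q)"

definition proper_stress ::
    "nat \<Rightarrow> nat set set \<Rightarrow> (nat \<Rightarrow> real^2) \<Rightarrow> (nat set \<Rightarrow> real) \<Rightarrow> bool" where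
  "proper_stress n E p \<omega> \<longleftrightarrow>
    equilibrium_stress n E p \<omega> \<and>
    (\<forall>e\<in>boundary_edges n. \<omega> e > 0) \<and> (\<forall>e\<in>braces n E. \<omega> e < 0)"

definition properly_stressed :: "nat \<Rightarrow> nat set set \<Rightarrow> (nat \<Rightarrow> real^2) \<Rightarrow> bool" where
  "properly_stressed n E p \<longleftrightarrow> (\<exists>\<omega>. proper_stress n E p \<omega>)"

definition all_equivalent :: "bool list \<Rightarrow> bool" where
  "all_equivalent Ps \<longleftrightarrow> (\<forall>P\<in>set Ps. \<forall>Q\<in>set Ps. P \<longleftrightarrow> Q)"

end

theory Submission
  imports Defs
begin

text \<open>The cycle of implications is (h) \<open>\<Longrightarrow>\<close> (e) \<open>\<Longrightarrow>\<close> (d) \<open>\<Longrightarrow>\<close> (c) \<open>\<Longrightarrow>\<close> (b) \<open>\<Longrightarrow>\<close> (a) \<open>\<Longrightarrow>\<close> (h), and (g) is equivalent to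
(h) separately.

Three facts carry the proof. The first is rigidity of signs: in a minimal graph every brace \<open>f\<close> is the only
brace that crosses some chord \<open>uv\<close>. An equilibrium stress that is nonpositive on the braces and vanishes on \<open>f\<close>
therefore exerts no force across the chord; the torque condition makes the two parts of the stress at \<open>u\<close>
pull along \<open>uv\<close>, convexity makes both pull inwards, and so the stress dies at \<open>u\<close> and then all
around the polygon (\<open>nonpos_stress_with_zero_brace\<close>). Hence a proper stress is the only stress up to scaling
(\<open>stress_unique\<close>), and limits of proper stresses on strictly convex polygons are again proper.

The second is that some strictly convex polygon is properly stressed, whatever the number of braces
(\<open>exists_properly_stressed\<close>). It is found as a maximiser, among weakly convex polygons whose sides have
nearly prescribed lengths, of an energy that rewards long braces and punishes wrong side lengths. At
a maximiser no side can contain a vertex in its interior, since bulging such a side outwards lengthens the braces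
that leave it; so the maximiser is strictly convex, hence a critical point, and the derivative of the energy is a proper
stress. At this polygon infinitesimal rigidity forces at least \<open>2 n - 2\<close> edges, and uniqueness of the
stress forces at most that many, which is (a) \<open>\<Longrightarrow>\<close> (h).

The third is that with \<open>2 n - 2\<close> edges every polygon has a nonzero stress for dimension reasons, so
the set of properly stressed polygons is open as well as closed, and it is nonempty. Strictly convex polygons
form a connected family: a projective map, which transports proper stresses, turns a polygon into a convex chain that
is increasing in the first coordinate, and any two such chains are joined through chains inscribed in a parabola
(\<open>proper_stress_transfer\<close>). This is (h) \<open>\<Longrightarrow>\<close> (e).

For (e) \<open>\<Longrightarrow>\<close> (d), a function on the vertices is, up to an affine function, a nonnegative combination of
"folds" along pairwise noncrossing chords, and the stress form of two such folds is a nonnegative sum over the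
braces that cross both chords (\<open>arc_function_energy_pos\<close>). For (b) \<open>\<Longrightarrow>\<close> (a), the polygons
\<open>p + t p'\<close> and \<open>p - t p'\<close> have equal edge lengths when \<open>p'\<close> is a flex. For (h) \<open>\<Longrightarrow>\<close> (g), too dense a
subgraph would carry a stress that is not a multiple of the proper one.\<close>

section \<open>Orientation and convex position\<close>

text \<open>From here on \<open>$\<close> selects a component of a point in the plane.\<close>

no_notation Matrix.vec_index (infixl "$" 100)

definition cross :: "real^2 \<Rightarrow> real^2 \<Rightarrow> real" where
  "cross x y = x$1 * y$2 - x$2 * y$1"

definition orient :: "real^2 \<Rightarrow> real^2 \<Rightarrow> real^2 \<Rightarrow> real" where
  "orient a b c = cross (b - a) (c - a)"

definition cyclic :: "nat \<Rightarrow> nat \<Rightarrow> nat \<Rightarrow> bool" where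
  "cyclic i j k \<longleftrightarrow> i < j \<and> j < k \<or> j < k \<and> k < i \<or> k < i \<and> i < j"

text \<open>The sign \<open>s\<close> treats the two orientations of a polygon alike. Positivity is required of all triples
and not just of consecutive vertices, which excludes polygons that wind around several times.\<close>

definition convex_position :: "real \<Rightarrow> nat \<Rightarrow> (nat \<Rightarrow> real^2) \<Rightarrow> bool" where
  "convex_position s n p \<longleftrightarrow> (\<forall>i j k. i < j \<and> j < k \<and> k < n \<longrightarrow> 0 < s * orient (p i) (p j) (p k))"

lemma plane_eq_iff: "x = y \<longleftrightarrow> x$1 = y$1 \<and> x$2 = y$2" for x y :: "real^2"
  by (simp add: Finite_Cartesian_Product.vec_eq_iff forall_2)

lemma inner_plane: "inner x y = x$1 * y$1 + x$2 * y$2" for x y :: "real^2"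
  by (simp add: inner_vec_def sum_2)

lemmas plane_simps = orient_def cross_def inner_plane plane_eq_iff

lemma orient_rotate: "orient b c a = orient a b c"
  by (simp add: plane_simps algebra_simps)

lemma orient_swap: "orient a c b = - orient a b c"
  by (simp add: plane_simps algebra_simps)

lemma orient_degenerate [simp]: "orient a a b = 0" "orient a b a = 0" "orient a b b = 0"
  by (simp_all add: plane_simps algebra_simps)

lemma convex_position_cyclic:
  assumes "convex_position s n p" "cyclic i j k" "i < n" "j < n" "k < n"
  shows "0 < s * orient (p i) (p j) (p k)"
proof -
  have pos: "0 < s * orient (p a) (p b) (p c)" if "a < b" "b < c" "c < n" for a b c
    using assms(1) that unfolding convex_position_def by simp
  from assms(2) consider "i < j" "j < k" | "j < k" "k < i" | "k < i" "i < j"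
    unfolding cyclic_def by blast
  then show ?thesis
  proof cases
    case 1
    then show ?thesis using pos assms by blast
  next
    case 2
    then have "0 < s * orient (p j) (p k) (p i)" using pos assms by blast
    then show ?thesis by (simp only: orient_rotate[of "p j" "p k" "p i"])
  next
    case 3
    then have "0 < s * orient (p k) (p i) (p j)" using pos assms by blast
    then show ?thesis by (simp only: orient_rotate[of "p i" "p j" "p k"])
  qed
qed

lemma cross_zero_imp_parallel:
  assumes "cross d x = 0" "d \<noteq> 0" obtains c where "x = c *\<^sub>R d"
proof -
  have d: "d$1 \<noteq> 0 \<or> d$2 \<noteq> 0" using assms(2) by (simp add: plane_eq_iff)
  have c: "d$1 * x$2 = d$2 * x$1" using assms(1) by (simp add: cross_def)
  show ?thesis
  proof (cases "d$1 = 0")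
    case True
    then have "x = (x$2 / d$2) *\<^sub>R d" using c d by (simp add: plane_eq_iff)
    then show ?thesis using that by blast
  next
    case False
    then have "x = (x$1 / d$1) *\<^sub>R d" using c by (simp add: plane_eq_iff field_simps)
    then show ?thesis using that by blast
  qed
qed

lemma cross_both_zero:
  assumes "cross a x = 0" "cross b x = 0" "cross a b \<noteq> 0" shows "x = 0"
proof -
  have "cross a b * x$1 = b$1 * cross a x - a$1 * cross b x"
    "cross a b * x$2 = b$2 * cross a x - a$2 * cross b x"
    by (simp_all add: cross_def algebra_simps)
  then have "x$1 = 0" "x$2 = 0" using assms by auto
  then show ?thesis by (simp add: plane_eq_iff)
qed

text \<open>The Pluecker relation for four vectors based at \<open>x\<close>. It makes "to the left of" a transitive relation on
vectors in a half plane.\<close>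

lemma orient_plucker:
  "(s * orient x a c) * (s * orient x b d) =
    (s * orient x a b) * (s * orient x c d) + (s * orient x a d) * (s * orient x b c)"
  unfolding orient_def cross_def by (simp add: algebra_simps)

lemma cyclic_successor:
  assumes "i < n" "j < n" "j \<noteq> i" "j \<noteq> (i + 1) mod n" "3 \<le> n"
  shows "cyclic i ((i + 1) mod n) j"
proof (cases "i + 1 < n")
  case True
  then show ?thesis using assms unfolding cyclic_def by auto
next
  case False
  then have "i + 1 = n" using assms by simp
  then show ?thesis using assms unfolding cyclic_def by auto
qed

lemma predecessor_exists:
  fixes i n :: nat
  assumes "i < n" "3 \<le> n"
  obtains h where "h < n" "(h + 1) mod n = i" "h \<noteq> i" "h \<noteq> (i + 1) mod n"
proof (cases "i = 0")
  case True
  then show ?thesis using assms by (intro that[of "n - 1"]) auto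
next
  case False
  then show ?thesis using assms by (intro that[of "i - 1"]) (auto simp: mod_if)
qed

lemma successor_neq:
  fixes i n :: nat
  assumes "i < n" "3 \<le> n"
  shows "(i + 1) mod n < n" "(i + 1) mod n \<noteq> i"
  using assms by (auto simp: mod_if)

lemma convex_position_edge:
  assumes "convex_position s n p" "3 \<le> n" "i < n" "j < n" "j \<noteq> i" "j \<noteq> (i + 1) mod n"
  shows "0 < s * orient (p i) (p ((i + 1) mod n)) (p j)"
  using assms convex_position_cyclic cyclic_successor successor_neq by presburger

text \<open>Seen from vertex \<open>i\<close>, all other vertices lie in the half plane to the left of the side at \<open>i\<close>,
and each is to the right of its successor. There "to the left of" is transitive by the Pluecker relation, so the order
of consecutive vertices extends to all pairs.\<close>

lemma convex_positionI:
  assumes n: "3 \<le> n"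
    and supp: "\<And>i j. \<lbrakk>i < n; j < n; j \<noteq> i; j \<noteq> (i + 1) mod n\<rbrakk>
      \<Longrightarrow> 0 < s * orient (p i) (p ((i + 1) mod n)) (p j)"
  shows "convex_position s n p"
proof -
  have "0 < s * orient (p i) (p j) (p k)" if "i < j" "Suc j \<le> k" "k < n" for i j k
    using that(2,3)
  proof (induction k rule: dec_induct)
    case base
    have "0 < s * orient (p j) (p (Suc j)) (p i)"
      using supp[of j i] base that(1) by simp
    then show ?case by (simp add: orient_rotate)
  next
    case (step k)
    let ?X = "\<lambda>b c. s * orient (p i) (p b) (p c)"
    have IH: "0 < ?X j k" using step by simp
    have k: "0 < s * orient (p k) (p (Suc k)) (p i)"
      using supp[of k i] step that(1) by simp
    have edge: "0 < ?X (Suc i) b" if "Suc i < b" "b < n" for b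
      using supp[of i b] that by simp
    show ?case
    proof (cases "j = Suc i")
      case True
      then show ?thesis using edge[of "Suc k"] step by simp
    next
      case False
      then have "0 < ?X (Suc i) j * ?X k (Suc k) + ?X (Suc i) (Suc k) * ?X j k"
        using edge[of j] edge[of "Suc k"] IH k step that(1)
        by (simp add: add_pos_pos orient_rotate)
      also have "\<dots> = ?X (Suc i) k * ?X j (Suc k)"
        using orient_plucker[of s "p i" "p (Suc i)" "p k" "p j" "p (Suc k)"] by simp
      finally have "0 < ?X (Suc i) k * ?X j (Suc k)" .
      moreover have "0 < ?X (Suc i) k" using edge[of k] step that(1) False by simp
      ultimately show ?thesis by (rule zero_less_mult_pos)
    qed
  qed
  then show ?thesis unfolding convex_position_def by simp
qed

definition perp :: "real^2 \<Rightarrow> real^2" where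
  "perp d = vector [- d$2, d$1]"

lemma inner_perp: "inner (perp d) y = cross d y"
  by (simp add: perp_def cross_def inner_plane)

lemma normal_functional:
  assumes "inner a d = 0" "d \<noteq> 0"
  obtains c where "\<And>y. inner a y = c * cross d y"
proof -
  have "cross (perp d) a = 0"
    using assms(1) by (simp add: perp_def cross_def inner_plane algebra_simps)
  moreover have "perp d \<noteq> 0"
    using assms(2) by (auto simp: perp_def plane_eq_iff)
  ultimately obtain c where "a = c *\<^sub>R perp d"
    using cross_zero_imp_parallel by blast
  then have "inner a y = c * cross d y" for y
    by (simp add: inner_perp)
  then show ?thesis using that by blast
qed

lemma inj_on_convex_position:
  assumes "convex_position s n p" "3 \<le> n"
  shows "inj_on p {..<n}"
proof -
  have "p i \<noteq> p j" if ij: "i < j" "j < n" for i j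
  proof
    assume eq: "p i = p j"
    obtain k where "k < n" "k \<noteq> i" "k \<noteq> j"
    proof -
      have "\<not> {..<n} \<subseteq> {i, j}"
        using card_mono[of "{i, j}" "{..<n}"] assms(2) card_insert_le_m1[of 2 "{j}" i] by auto
      then show ?thesis using that by auto
    qed
    then have "cyclic i j k \<or> cyclic j i k" using ij unfolding cyclic_def by auto
    then show False
      using convex_position_cyclic[OF assms(1)] ij \<open>k < n\<close> eq by fastforce
  qed
  then show ?thesis by (metis inj_onI lessThan_iff linorder_neqE_nat)
qed

text \<open>Faces of a polytope are exposed, so the line through a side supports the polygon; another vertex on this line would
be an extreme point of the side and hence one of its ends. Two consecutive sides agree about the direction
of the interior because they see the orientation of the same triple of vertices.\<close>

lemma convex_position_of_strictly_convex_polygon: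
  assumes scp: "strictly_convex_polygon n p" and n: "3 \<le> n"
  obtains s where "s = 1 \<or> s = - 1" "convex_position s n p"
proof -
  define P where "P = convex hull (p ` {..<n})"
  have inj: "inj_on p {..<n}" and ext: "{x. x extreme_point_of P} = p ` {..<n}"
    and edge: "closed_segment (p i) (p ((i + 1) mod n)) edge_of P" if "i < n" for i
    using scp that unfolding strictly_convex_polygon_def Let_def P_def by auto
  have "polyhedron P" unfolding P_def by (simp add: polytope_convex_hull polytope_imp_polyhedron)
  have side: "\<exists>c. \<forall>j<n. j \<noteq> i \<longrightarrow> j \<noteq> (i + 1) mod n \<longrightarrow>
      0 < c * orient (p i) (p ((i + 1) mod n)) (p j)" if i: "i < n" for i
  proof -
    let ?i' = "(i + 1) mod n" and ?S = "closed_segment (p i) (p ((i + 1) mod n))"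
    have i': "?i' < n" "?i' \<noteq> i" using successor_neq[OF i n] by auto
    have face: "?S face_of P" using edge[OF i] by (simp add: edge_of_def)
    then obtain a b where ab: "P \<subseteq> {x. inner a x \<le> b}" "?S = P \<inter> {x. inner a x = b}"
      using exposed_face_of_polyhedron[OF \<open>polyhedron P\<close>] unfolding exposed_face_of_def by metis
    have on: "inner a (p i) = b" "inner a (p ?i') = b"
      using ab(2) ends_in_segment by blast+
    have "p ?i' - p i \<noteq> 0" using inj i i' by (auto simp: inj_on_def)
    moreover have "inner a (p ?i' - p i) = 0" using on by (simp add: inner_diff_right)
    ultimately obtain c where c: "\<And>y. inner a y = c * cross (p ?i' - p i) y"
      using normal_functional by metis
    have "0 < - c * orient (p i) (p ?i') (p j)" if j: "j < n" "j \<noteq> i" "j \<noteq> ?i'" for j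
    proof -
      have extj: "p j extreme_point_of P" using ext j by blast
      then have "p j \<in> P" by (simp add: extreme_point_of_def)
      moreover have "p j \<notin> ?S"
      proof
        assume "p j \<in> ?S"
        then have "p j extreme_point_of ?S"
          using extj face extreme_point_of_face by blast
        then have "p j = p i \<or> p j = p ?i'" by (simp add: extreme_point_of_segment)
        then show False using inj i i' j by (auto simp: inj_on_def)
      qed
      ultimately have "inner a (p j) < b" using ab by force
      then have "inner a (p j - p i) < 0" using on by (simp add: inner_diff_right)
      then show ?thesis by (simp add: c orient_def)
    qed
    then show ?thesis by blast
  qed
  then obtain c where c: "\<And>i j. \<lbrakk>i < n; j < n; j \<noteq> i; j \<noteq> (i + 1) mod n\<rbrakk> \<Longrightarrow>
      0 < c i * orient (p i) (p ((i + 1) mod n)) (p j)"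
    by metis
  have same: "sgn (c (Suc i)) = sgn (c i)" if i: "Suc i < n" for i
  proof -
    obtain k where k: "k = (Suc i + 1) mod n" by blast
    have kn: "k < n" "k \<noteq> i" "k \<noteq> Suc i" using i n by (auto simp: k mod_if)
    have "0 < c i * orient (p i) (p (Suc i)) (p k)"
      using c[of i k] kn i by simp
    moreover have "0 < c (Suc i) * orient (p (Suc i)) (p k) (p i)"
      using c[of "Suc i" i] kn i k by simp
    ultimately show ?thesis
      by (auto simp: orient_rotate zero_less_mult_iff)
  qed
  have const: "sgn (c i) = sgn (c 0)" if "i < n" for i
    using that by (induction i) (use same in auto)
  have "c 0 \<noteq> 0" using c[of 0 2] n by auto
  then have s: "sgn (c 0) = 1 \<or> sgn (c 0) = - 1" by (auto simp: sgn_real_def)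
  have "convex_position (sgn (c 0)) n p"
  proof (rule convex_positionI[OF n])
    fix i j assume ij: "i < n" "j < n" "j \<noteq> i" "j \<noteq> (i + 1) mod n"
    have "0 < c i * orient (p i) (p ((i + 1) mod n)) (p j)" by (rule c[OF ij])
    then have "0 < sgn (c i) * orient (p i) (p ((i + 1) mod n)) (p j)"
      by (auto simp: sgn_real_def zero_less_mult_iff split: if_splits)
    then show "0 < sgn (c 0) * orient (p i) (p ((i + 1) mod n)) (p j)"
      using const[OF ij(1)] by simp
  qed
  then show ?thesis using s that by blast
qed

lemma convex_hull_supporting_face:
  fixes S :: "'a::euclidean_space set"
  assumes "finite S" and le: "\<And>x. x \<in> S \<Longrightarrow> b \<le> inner a x"
  shows "convex hull S \<inter> {x. inner a x = b} = convex hull {x \<in> S. inner a x = b}" (is "?T = ?U")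
    and "convex hull S \<inter> {x. inner a x = b} face_of convex hull S"
proof -
  have "convex hull S \<subseteq> {x. b \<le> inner a x}"
    using le by (intro hull_minimal) (auto simp: convex_halfspace_ge)
  then have "\<And>x. x \<in> convex hull S \<Longrightarrow> b \<le> inner a x" by blast
  then show face: "?T face_of convex hull S"
    by (intro face_of_Int_supporting_hyperplane_ge) auto
  obtain S' where S': "S' \<subseteq> S" "?T = convex hull S'"
    using face_of_convex_hull_subset[OF finite_imp_compact[OF assms(1)] face] by metis
  have "S' \<subseteq> ?T" using S'(2) hull_subset by metis
  then have "S' \<subseteq> {x \<in> S. inner a x = b}" using S'(1) by blast
  then have "?T \<subseteq> ?U" using S'(2) hull_mono by metis
  moreover have "?U \<subseteq> ?T"
  proof (rule hull_minimal)
    show "{x \<in> S. inner a x = b} \<subseteq> ?T" using hull_subset[of S convex] by auto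
    show "convex ?T" by (intro convex_Int convex_convex_hull convex_hyperplane)
  qed
  ultimately show "?T = ?U" by blast
qed

text \<open>The inner normal of a side is minimised on the vertices exactly at the two ends of the side, and the sum of the inner
normals of two consecutive sides exactly at their common vertex. These functionals exhibit the sides and the vertices as
exposed faces.\<close>

lemma strictly_convex_polygon_of_convex_position:
  assumes pos: "convex_position s n p" and n: "3 \<le> n"
  shows "strictly_convex_polygon n p"
proof -
  define P where "P = convex hull (p ` {..<n})"
  define N :: "nat \<Rightarrow> real^2" where "N i = s *\<^sub>R perp (p ((i + 1) mod n) - p i)" for i
  have N: "inner (N i) (x - p i) = s * orient (p i) (p ((i + 1) mod n)) x" for i and x :: "real^2"
    by (simp add: N_def orient_def inner_perp)
  have inj: "inj_on p {..<n}" using inj_on_convex_position[OF pos n] .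
  have fin: "finite (p ` {..<n})" by simp
  have Npos: "inner (N i) (p i) < inner (N i) (p j)"
    if "i < n" "j < n" "j \<noteq> i" "j \<noteq> (i + 1) mod n" for i j
    using convex_position_edge[OF pos n that] N[of i "p j"] by (simp add: inner_diff_right)
  have Nzero: "inner (N i) (p ((i + 1) mod n)) = inner (N i) (p i)" for i
    using N[of i "p ((i + 1) mod n)"] by (simp add: inner_diff_right)
  have Nge: "inner (N i) (p i) \<le> inner (N i) (p j)" if "i < n" "j < n" for i j
    using Npos[OF that] Nzero[of i] by (cases "j = i \<or> j = (i + 1) mod n") auto
  have edges: "closed_segment (p i) (p ((i + 1) mod n)) edge_of P" if i: "i < n" for i
  proof -
    have i': "(i + 1) mod n < n" "(i + 1) mod n \<noteq> i" using successor_neq[OF i n] by auto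
    have "{x \<in> p ` {..<n}. inner (N i) x = inner (N i) (p i)} = {p i, p ((i + 1) mod n)}"
    proof (intro equalityI subsetI)
      fix x assume "x \<in> {x \<in> p ` {..<n}. inner (N i) x = inner (N i) (p i)}"
      then obtain j where j: "j < n" "x = p j" "inner (N i) (p j) = inner (N i) (p i)" by auto
      then show "x \<in> {p i, p ((i + 1) mod n)}" using Npos[OF i j(1)] by (metis insertCI less_irrefl)
    qed (use Nzero[of i] i i' in auto)
    then have "closed_segment (p i) (p ((i + 1) mod n)) face_of P"
      using convex_hull_supporting_face[OF fin, of "inner (N i) (p i)" "N i"] Nge[OF i]
      unfolding P_def segment_convex_hull by auto
    moreover have "p i \<noteq> p ((i + 1) mod n)" using inj i i' by (auto simp: inj_on_def)
    ultimately show ?thesis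
      by (simp add: edge_of_def segment_convex_hull aff_dim_convex_hull aff_dim_2)
  qed
  have vert: "\<exists>a b. a \<noteq> 0 \<and> P \<inter> {x. inner a x = b} = {p i} \<and> {p i} face_of P" if i: "i < n" for i
  proof -
    obtain h where h: "h < n" "(h + 1) mod n = i" "h \<noteq> i" "h \<noteq> (i + 1) mod n"
      using predecessor_exists[OF i n] by blast
    let ?a = "N h + N i"
    have eqi: "inner (N h) (p i) = inner (N h) (p h)" using Nzero[of h] h by simp
    have gt: "inner ?a (p i) < inner ?a (p j)" if j: "j < n" "j \<noteq> i" for j
    proof (cases "j = h")
      case True
      then show ?thesis using Npos[OF i h(1,3,4)] eqi by (simp add: inner_add_left)
    next
      case False
      then have "inner (N h) (p h) < inner (N h) (p j)" using Npos[OF h(1) j(1)] h j by simp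
      then show ?thesis using Nge[OF i j(1)] eqi by (simp add: inner_add_left)
    qed
    have "{x \<in> p ` {..<n}. inner ?a x = inner ?a (p i)} = {p i}"
    proof (intro equalityI subsetI)
      fix x assume "x \<in> {x \<in> p ` {..<n}. inner ?a x = inner ?a (p i)}"
      then obtain j where j: "j < n" "x = p j" "inner ?a (p j) = inner ?a (p i)" by auto
      then show "x \<in> {p i}" using gt[OF j(1)] by (metis insertCI less_irrefl)
    qed (use i in auto)
    moreover have "inner ?a (p i) \<le> inner ?a x" if x: "x \<in> p ` {..<n}" for x
    proof -
      obtain j where "j < n" "x = p j" using x by auto
      then show ?thesis using gt[of j] by (cases "j = i") auto
    qed
    ultimately have "P \<inter> {x. inner ?a x = inner ?a (p i)} = {p i} \<and> {p i} face_of P"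
      using convex_hull_supporting_face[OF fin, of "inner ?a (p i)" ?a] unfolding P_def by simp
    moreover have "?a \<noteq> 0" using gt[OF h(1,3)] by auto
    ultimately show ?thesis by blast
  qed
  have ext: "{x. x extreme_point_of P} = p ` {..<n}"
  proof
    show "{x. x extreme_point_of P} \<subseteq> p ` {..<n}"
      unfolding P_def using extreme_point_of_convex_hull by blast
    show "p ` {..<n} \<subseteq> {x. x extreme_point_of P}"
      using vert face_of_singleton by blast
  qed
  have line: "\<exists>L. affine L \<and> aff_dim L = 1 \<and> L \<inter> P = {p i}" if i: "i < n" for i
  proof -
    obtain a b where ab: "a \<noteq> 0" "P \<inter> {x. inner a x = b} = {p i}" using vert[OF i] by blast
    show ?thesis
      using ab by (intro exI[of _ "{x. inner a x = b}"])
        (auto simp: affine_hyperplane aff_dim_hyperplane)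
  qed
  have dim: "aff_dim P = 2"
  proof (rule ccontr)
    assume "aff_dim P \<noteq> 2"
    then have "aff_dim P < DIM(real^2)" using aff_dim_le_DIM[of P] by simp
    then obtain a b where ab: "a \<noteq> 0" "P \<subseteq> {x. inner a x = b}"
      using aff_lowdim_subset_hyperplane by metis
    then have "inner a (p i) = b" if "i < n" for i
    proof -
      have "p i \<in> P" unfolding P_def using that by (intro hull_inc) simp
      then show ?thesis using ab(2) by blast
    qed
    then have "inner a (p 1 - p 0) = 0" "inner a (p 2 - p 0) = 0"
      using n by (simp_all add: inner_diff_right)
    moreover have o: "0 < s * orient (p 0) (p 1) (p 2)"
      using pos n unfolding convex_position_def by simp
    then have "p 1 - p 0 \<noteq> 0" by auto
    ultimately obtain c where c: "\<And>y. inner a y = c * cross (p 1 - p 0) y"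
      using normal_functional by metis
    then have "c = 0" using o \<open>inner a (p 2 - p 0) = 0\<close> by (auto simp: orient_def)
    then have "inner a a = 0" using c by simp
    then show False using ab by simp
  qed
  show ?thesis
    unfolding strictly_convex_polygon_def Let_def P_def[symmetric]
    using dim inj ext edges line by (intro conjI allI impI)
qed

section \<open>Chords and 3-connectivity\<close>

lemma boundary_edge_memb:
  assumes "i < n"
  shows "{i, (i + 1) mod n} \<in> boundary_edges n"
  using assms unfolding boundary_edges_def by blast

text \<open>A path in the graph without \<open>u\<close> and \<open>v\<close> that starts in \<open>X\<close> and ends elsewhere has a first edge
that leaves \<open>X\<close>.\<close>

lemma crossing_edge:
  assumes con: "k_connected 3 {..<n} E" and uv: "u < n" "v < n"
    and i: "i \<in> X" and o: "j \<in> {..<n} - {u, v} - X" and X: "X \<subseteq> {..<n} - {u, v}"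
  obtains a b where "a \<in> X" "b \<in> {..<n} - {u, v} - X" "{a, b} \<in> E"
proof -
  have "card {u, v} < 3" by (simp add: card_insert_if)
  then have "connected_graph ({..<n} - {u, v}) {e \<in> E. e \<inter> {u, v} = {}}"
    using con uv unfolding k_connected_def by (metis empty_subsetI insert_subset lessThan_iff)
  then have "(i, j) \<in> {(x, y). x \<in> {..<n} - {u, v} \<and> y \<in> {..<n} - {u, v} \<and>
      {x, y} \<in> {e \<in> E. e \<inter> {u, v} = {}}}\<^sup>*" (is "_ \<in> ?R\<^sup>*")
    using i o X unfolding connected_graph_def by blast
  moreover have "j \<in> X" if "(i, j) \<in> ?R\<^sup>*" "\<not> (\<exists>a b. a \<in> X \<and> b \<in> {..<n} - {u, v} - X \<and> {a, b} \<in> E)" for j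
    using that(1) by (induction rule: rtrancl_induct) (use i that(2) in auto)
  ultimately show ?thesis using o that by blast
qed

lemma vertex_has_brace:
  assumes con: "k_connected 3 {..<n} E" and sg: "simple_graph {..<n} E" and n: "4 \<le> n" and i: "i < n"
  obtains j where "j < n" "{i, j} \<in> braces n E"
proof -
  have n3: "3 \<le> n" using n by simp
  obtain h where h: "h < n" "(h + 1) mod n = i" "h \<noteq> i" "h \<noteq> (i + 1) mod n"
    using predecessor_exists[OF i n3] by blast
  let ?k = "(i + 1) mod n"
  have k: "?k < n" "?k \<noteq> i" using successor_neq[OF i n3] by auto
  have "\<not> {..<n} \<subseteq> {h, i, ?k}"
    using card_mono[of "{h, i, ?k}" "{..<n}"] n card_insert_le_m1[of 3 "{i, ?k}" h]
      card_insert_le_m1[of 2 "{?k}" i] by auto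
  then obtain m where m: "m \<in> {..<n} - {h, ?k} - {i}" by auto
  obtain a b where ab: "a \<in> {i}" "b \<in> {..<n} - {h, ?k} - {i}" "{a, b} \<in> E"
    using crossing_edge[OF con h(1) k(1), of i "{i}" m] m i h k by blast
  have "{i, b} \<notin> boundary_edges n"
  proof
    assume "{i, b} \<in> boundary_edges n"
    then obtain c where c: "c < n" "{i, b} = {c, (c + 1) mod n}" unfolding boundary_edges_def by blast
    then have "c = i \<and> b = ?k \<or> c = b \<and> (b + 1) mod n = i"
      by (auto simp: doubleton_eq_iff)
    moreover have "b = h" if "(b + 1) mod n = i"
    proof -
      have "(b + 1) mod n = (h + 1) mod n" "b < n" using that h ab by auto
      then show ?thesis using h(1) by (auto simp: mod_if split: if_splits)
    qed
    ultimately show False using ab by auto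
  qed
  then show ?thesis using that[of b] ab unfolding braces_def by auto
qed

text \<open>Two vertices that are not adjacent on the polygon, that is, both arcs between them contain a vertex. The vertices
\<open>0\<close> and \<open>n - 1\<close> are adjacent across the wrap-around.\<close>

definition chord :: "nat \<Rightarrow> nat \<Rightarrow> nat \<Rightarrow> bool" where
  "chord n u v \<longleftrightarrow> u < v \<and> v < n \<and> u + 1 < v \<and> \<not> (u = 0 \<and> v = n - 1)"

lemma chord_crossed:
  assumes con: "k_connected 3 {..<n} E" and uv: "chord n u v"
  obtains i j where "u < i" "i < v" "j < n" "j < u \<or> v < j" "{i, j} \<in> E"
proof -
  obtain m where m: "m < n" "m < u \<or> v < m"
    using uv unfolding chord_def by (cases "u = 0") (auto intro: that[of "n - 1"] that[of 0])
  obtain a b where "a \<in> {u<..<v}" "b \<in> {..<n} - {u, v} - {u<..<v}" "{a, b} \<in> E"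
    by (rule crossing_edge[OF con, of u v "u + 1" "{u<..<v}" m])
      (use uv m in \<open>auto simp: chord_def\<close>)
  then show ?thesis using that[of a b] by auto
qed

text \<open>A set closed under adjacency away from \<open>S\<close> cannot separate two vertices joined by a stretch of the
boundary that avoids \<open>S\<close>.\<close>

lemma walk_along:
  assumes bd: "boundary_edges n \<subseteq> E" and X: "\<And>i j. \<lbrakk>i \<in> X; j < n; j \<notin> S; {i, j} \<in> E\<rbrakk> \<Longrightarrow> j \<in> X"
    and ab: "a \<le> b" "b < n" and S: "{a..b} \<inter> S = {}"
  shows "a \<in> X \<longleftrightarrow> b \<in> X"
proof -
  have E: "{i, Suc i} \<in> E" if "Suc i < n" for i
    using boundary_edge_memb[of i n] that bd by auto
  show ?thesis using ab S
  proof (induction b rule: dec_induct)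
    case (step m)
    have "m \<in> X \<longleftrightarrow> Suc m \<in> X"
      using X[of m "Suc m"] X[of "Suc m" m] E[of m] step
      by (metis Int_iff atLeastAtMost_iff empty_iff insert_commute le_SucI order_refl Suc_leD
          order_less_trans lessI)
    moreover have "{a..m} \<subseteq> {a..Suc m}" by auto
    then have "{a..m} \<inter> S = {}" using step by blast
    ultimately show ?case using step by auto
  qed auto
qed

text \<open>The polygon minus one vertex is still a path, so a set \<open>S\<close> of at most two vertices that separates the
graph consists of two vertices, nonadjacent on the polygon, and the separated parts are the two arcs between them.
For \<open>E - {f}\<close> in place of \<open>E\<close> this says that every brace \<open>f\<close> of a minimal graph is the only edge
that crosses some chord.\<close>

lemma chord_with_unique_crossing:
  assumes bd: "boundary_edges n \<subseteq> E" and n: "4 \<le> n"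
    and ncon: "\<not> k_connected 3 {..<n} E"
  obtains u v where "chord n u v"
    "\<And>i j. \<lbrakk>u < i; i < v; j < n; j < u \<or> v < j\<rbrakk> \<Longrightarrow> {i, j} \<notin> E"
proof -
  obtain S where S: "S \<subseteq> {..<n}" "card S < 3" "\<not> connected_graph ({..<n} - S) {e \<in> E. e \<inter> S = {}}"
    using ncon n unfolding k_connected_def by auto
  have finS: "finite S" using S finite_subset by blast
  have "\<not> {..<n} \<subseteq> S" using card_mono[OF finS, of "{..<n}"] S n by auto
  define R where "R = {(x, y). x \<in> {..<n} - S \<and> y \<in> {..<n} - S \<and> {x, y} \<in> {e \<in> E. e \<inter> S = {}}}"
  obtain x y where xy: "x \<in> {..<n} - S" "y \<in> {..<n} - S" "(x, y) \<notin> R\<^sup>*"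
    using S(3) \<open>\<not> {..<n} \<subseteq> S\<close> unfolding connected_graph_def R_def by blast
  \<comment> \<open>The component of \<open>x\<close> after the removal of \<open>S\<close>.\<close>
  define X where "X = {z. (x, z) \<in> R\<^sup>*}"
  have XS: "X \<subseteq> {..<n} - S"
  proof
    fix z assume "z \<in> X"
    then have "(x, z) \<in> R\<^sup>*" by (simp add: X_def)
    then show "z \<in> {..<n} - S" by (cases rule: rtranclE) (use xy in \<open>auto simp: R_def\<close>)
  qed
  have Xstep: "j \<in> X" if ij: "i \<in> X" "j < n" "j \<notin> S" "{i, j} \<in> E" for i j
  proof -
    have "(i, j) \<in> R" using ij XS unfolding R_def by auto
    then show ?thesis using ij(1) unfolding X_def by (auto intro: rtrancl_into_rtrancl)
  qed
  have xX: "x \<in> X" "y \<notin> X" using xy by (auto simp: X_def)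
  have walk: "(a \<in> X) = (b \<in> X)" if "a \<le> b" "b < n" "{a..b} \<inter> S = {}" for a b
    by (rule walk_along[OF bd _ that]) (rule Xstep)
  have wrap: "0 \<in> X \<longleftrightarrow> n - 1 \<in> X" if "0 \<notin> S" "n - 1 \<notin> S"
  proof -
    have "{n - 1, 0} \<in> E" using boundary_edge_memb[of "n - 1" n] n bd by auto
    then show ?thesis using Xstep[of 0 "n - 1"] Xstep[of "n - 1" 0] that n by (auto simp: insert_commute)
  qed
  define a where "a = min x y"
  define b where "b = max x y"
  have ab: "a < b" "a < n" "b < n" "a \<notin> S" "b \<notin> S" "(a \<in> X) \<noteq> (b \<in> X)"
    using xy xX unfolding a_def b_def by (auto simp: min_def max_def)
  obtain v where v: "v \<in> S" "a < v" "v < b"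
  proof -
    have "{a..b} \<inter> S \<noteq> {}" using walk[of a b] ab by auto
    then obtain v where v: "v \<in> S" "a \<le> v" "v \<le> b" by auto
    then have "v \<noteq> a" "v \<noteq> b" using ab by auto
    then show ?thesis using that[of v] v by simp
  qed
  have "\<exists>u. u \<in> S \<and> (u < a \<or> b < u) \<and> u < n"
  proof (rule ccontr)
    assume "\<nexists>u. u \<in> S \<and> (u < a \<or> b < u) \<and> u < n"
    then have no: "u \<notin> S" if "u < a \<or> b < u" for u using that S(1) by blast
    have "{0..a} \<inter> S = {}" "{b..n - 1} \<inter> S = {}"
      using no ab by (auto simp: le_less)
    then have "(0 \<in> X) = (a \<in> X)" "(b \<in> X) = (n - 1 \<in> X)" "0 \<notin> S" "n - 1 \<notin> S"
      using walk[of 0 a] walk[of b "n - 1"] ab by (auto simp: disjoint_iff)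
    then show False using wrap ab by simp
  qed
  then obtain u where u: "u \<in> S" "u < a \<or> b < u" "u < n" by blast
  have Suv: "S = {u, v}"
  proof (rule card_seteq[symmetric])
    show "card S \<le> card {u, v}" using u v S(2) by auto
  qed (use u v finS in auto)
  define u' where "u' = min u v"
  define v' where "v' = max u v"
  have uv': "u' < v'" "v' < n" "S = {u', v'}" using u v ab Suv by (auto simp: u'_def v'_def)
  define c where "c = (if u < a then a else b)"
  define d where "d = (if u < a then b else a)"
  have cd: "u' < c" "c < v'" "d < n" "d < u' \<or> v' < d" "(c \<in> X) \<noteq> (d \<in> X)"
    using u v ab by (auto simp: c_def d_def u'_def v'_def)
  have inside: "(i \<in> X) = (c \<in> X)" if "u' < i" "i < v'" for i
  proof (cases "i \<le> c")
    case True then show ?thesis using walk[of i c] that cd uv' by auto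
  next
    case False then show ?thesis using walk[of c i] that cd uv' by auto
  qed
  have low: "(i \<in> X) = (0 \<in> X)" if "i < u'" for i
    using walk[of 0 i] that uv' by auto
  have high: "(i \<in> X) = (n - 1 \<in> X)" if "v' < i" "i < n" for i
    using walk[of i "n - 1"] that uv' by auto
  have outside: "(j \<in> X) = (d \<in> X)" if jj: "j < n" "j < u' \<or> v' < j" for j
  proof -
    have wr: "(0 \<in> X) = (n - 1 \<in> X)" if "i < u'" "v' < k" "k < n" for i k
    proof (rule wrap)
      show "0 \<notin> S" "n - 1 \<notin> S" using that uv' by auto
    qed
    consider "j < u'" "d < u'" | "j < u'" "v' < d" | "v' < j" "d < u'" | "v' < j" "v' < d"
      using jj(2) cd(4) by blast
    then show ?thesis
    proof cases
      case 1 then show ?thesis using low[of j] low[of d] by simp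
    next
      case 2 then show ?thesis using low[of j] high[of d] wr[of j d] cd(3) by simp
    next
      case 3 then show ?thesis using low[of d] high[of j] wr[of d j] jj(1) by simp
    next
      case 4 then show ?thesis using high[of j] high[of d] jj(1) cd(3) by simp
    qed
  qed
  have "chord n u' v'" using uv' cd unfolding chord_def by auto
  moreover have "{i, j} \<notin> E" if "u' < i" "i < v'" "j < n" "j < u' \<or> v' < j" for i j
  proof
    assume "{i, j} \<in> E"
    then have "(i \<in> X) = (j \<in> X)"
      using Xstep[of i j] Xstep[of j i] that uv' by (auto simp: insert_commute)
    then show False using inside[of i] outside[of j] that cd by simp
  qed
  ultimately show ?thesis using that by blast
qed

lemma boundary_edge_iff:
  assumes "i < n" "j < n"
  shows "{i, j} \<in> boundary_edges n \<longleftrightarrow> j = (i + 1) mod n \<or> i = (j + 1) mod n"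
  using assms unfolding boundary_edges_def by (auto simp: doubleton_eq_iff)

lemma successor_inj:
  fixes i j n :: nat
  assumes "i < n" "j < n" "(i + 1) mod n = (j + 1) mod n"
  shows "i = j"
  using assms by (auto simp: mod_if split: if_splits)


section \<open>Existence of equilibrium stresses\<close>

text \<open>Gaussian elimination: if some unknown \<open>k\<close> occurs in equation \<open>j\<close>, solve for it and substitute in the
other equations.\<close>

lemma homogeneous_system_solution:
  fixes a :: "'j \<Rightarrow> 'i \<Rightarrow> real"
  assumes "finite J" "finite I" "card J < card I"
  obtains x where "\<exists>i\<in>I. x i \<noteq> 0" "\<And>i. i \<notin> I \<Longrightarrow> x i = 0" "\<And>j. j \<in> J \<Longrightarrow> (\<Sum>i\<in>I. a j i * x i) = 0"
proof -
  have "\<exists>x. (\<exists>i\<in>I. x i \<noteq> 0) \<and> (\<forall>i. i \<notin> I \<longrightarrow> x i = 0) \<and> (\<forall>j\<in>J. (\<Sum>i\<in>I. a j i * x i) = 0)"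
    using assms
  proof (induction J arbitrary: I a rule: finite_induct)
    case empty
    then obtain i where "i \<in> I" by (metis all_not_in_conv card.empty less_irrefl)
    then show ?case by (intro exI[of _ "\<lambda>k. if k = i then 1 else 0"]) auto
  next
    case (insert j J)
    show ?case
    proof (cases "\<forall>i\<in>I. a j i = 0")
      case True
      obtain x where "\<exists>i\<in>I. x i \<noteq> 0" "\<forall>i. i \<notin> I \<longrightarrow> x i = 0" "\<forall>j\<in>J. (\<Sum>i\<in>I. a j i * x i) = 0"
        using insert.IH[of I a] insert.prems insert.hyps by auto
      then show ?thesis using True by (intro exI[of _ x]) auto
    next
      case False
      then obtain k where k: "k \<in> I" "a j k \<noteq> 0" by blast
      define a' where "a' l i = a l i - a l k * a j i / a j k" for l i
      have "card J < card (I - {k})" using insert.prems insert.hyps k by simp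
      then obtain x where x: "\<exists>i\<in>I - {k}. x i \<noteq> 0" "\<forall>i. i \<notin> I - {k} \<longrightarrow> x i = 0"
        "\<forall>l\<in>J. (\<Sum>i\<in>I - {k}. a' l i * x i) = 0"
        using insert.IH[of "I - {k}" a'] insert.prems by auto
      define y where "y = x(k := - (\<Sum>i\<in>I - {k}. a j i * x i) / a j k)"
      have split: "(\<Sum>i\<in>I. a l i * y i) = a l k * y k + (\<Sum>i\<in>I - {k}. a l i * x i)" for l
      proof -
        have "(\<Sum>i\<in>I. a l i * y i) = a l k * y k + (\<Sum>i\<in>I - {k}. a l i * y i)"
          using insert.prems k by (subst sum.remove[of I k]) auto
        also have "(\<Sum>i\<in>I - {k}. a l i * y i) = (\<Sum>i\<in>I - {k}. a l i * x i)"
          by (rule sum.cong) (auto simp: y_def)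
        finally show ?thesis .
      qed
      have "(\<Sum>i\<in>I. a l i * y i) = 0" if l: "l \<in> insert j J" for l
      proof (cases "l = j")
        case True
        then show ?thesis unfolding split using k by (simp add: y_def)
      next
        case False
        then have "0 = (\<Sum>i\<in>I - {k}. a' l i * x i)" using x l by auto
        also have "\<dots> = (\<Sum>i\<in>I - {k}. a l i * x i) - a l k / a j k * (\<Sum>i\<in>I - {k}. a j i * x i)"
          by (simp add: a'_def left_diff_distrib sum_subtractf sum_distrib_left mult.assoc)
        finally show ?thesis unfolding split by (simp add: y_def)
      qed
      moreover have "\<exists>i\<in>I. y i \<noteq> 0" using x(1) by (auto simp: y_def)
      moreover have "\<forall>i. i \<notin> I \<longrightarrow> y i = 0" using x(2) k by (auto simp: y_def)
      ultimately show ?thesis by blast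
    qed
  qed
  then show ?thesis using that by blast
qed

definition balanced :: "nat \<Rightarrow> (nat \<Rightarrow> nat \<Rightarrow> real) \<Rightarrow> (nat \<Rightarrow> real^2) \<Rightarrow> bool" where
  "balanced n w p \<longleftrightarrow> (\<forall>i<n. (\<Sum>j<n. w i j *\<^sub>R (p i - p j)) = 0)"

lemma equilibrium_stress_balanced:
  "equilibrium_stress n E p \<omega> \<longleftrightarrow> balanced n (stress_coeff E \<omega>) p"
  by (simp add: equilibrium_stress_def balanced_def)

lemma stress_coeff_sym: "stress_coeff E \<omega> i j = stress_coeff E \<omega> j i"
  by (simp add: stress_coeff_def insert_commute)

lemma balanced_forces:
  assumes "balanced n w p" "i < n"
  shows "(\<Sum>j<n. w i j *\<^sub>R (p j - p i)) = 0"
proof -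
  have "(\<Sum>j<n. w i j *\<^sub>R (p j - p i)) = - (\<Sum>j<n. w i j *\<^sub>R (p i - p j))"
    by (simp add: sum_negf[symmetric] scaleR_diff_right)
  then show ?thesis using assms by (simp add: balanced_def)
qed

lemma cross_linear:
  "cross d (x + y) = cross d x + cross d y" "cross d (c *\<^sub>R x) = c * cross d x" "cross d 0 = 0"
  "cross d (x - y) = cross d x - cross d y" "cross d (- x) = - cross d x"
  by (simp_all add: cross_def algebra_simps)

lemma cross_self [simp]: "cross d d = 0" "cross 0 d = 0"
  by (simp_all add: cross_def)

lemma cross_sum: "cross d (sum f A) = (\<Sum>i\<in>A. cross d (f i))"
  by (simp add: inner_sum_right flip: inner_perp)

lemma balanced_cross:
  assumes "balanced n w p" "i < n"
  shows "(\<Sum>j<n. w i j * cross d (p j - p i)) = 0"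
  using arg_cong[OF balanced_forces[OF assms], of "cross d"] by (simp add: cross_sum cross_linear)

lemma antisymmetric_sum_zero:
  fixes f :: "'i \<Rightarrow> 'i \<Rightarrow> 'a::real_vector"
  assumes "\<And>i j. i \<in> A \<Longrightarrow> j \<in> A \<Longrightarrow> f j i = - f i j"
  shows "(\<Sum>i\<in>A. \<Sum>j\<in>A. f i j) = 0"
proof -
  have "(\<Sum>i\<in>A. \<Sum>j\<in>A. f i j) = (\<Sum>i\<in>A. \<Sum>j\<in>A. f j i)" by (rule sum.swap)
  also have "\<dots> = (\<Sum>i\<in>A. \<Sum>j\<in>A. - f i j)" by (intro sum.cong refl assms)
  also have "\<dots> = - (\<Sum>i\<in>A. \<Sum>j\<in>A. f i j)" by (simp add: sum_negf)
  finally show ?thesis by (simp only: eq_neg_iff_add_eq_0 scaleR_2[symmetric] scaleR_eq_0_iff) simp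
qed

lemma stress_coeff_sum:
  fixes x :: "nat \<Rightarrow> 'a::real_vector"
  assumes "finite E"
  shows "(\<Sum>j\<in>A. stress_coeff E \<omega> i j *\<^sub>R x j) =
    (\<Sum>e\<in>E. \<omega> e *\<^sub>R (\<Sum>j\<in>A. if {i, j} = e then x j else 0))"
proof -
  have if_scale: "c *\<^sub>R (if P then y else 0) = (if P then c *\<^sub>R y else 0)" for c P and y :: 'a
    by simp
  have "(\<Sum>e\<in>E. \<omega> e *\<^sub>R (\<Sum>j\<in>A. if {i, j} = e then x j else 0)) =
      (\<Sum>e\<in>E. \<Sum>j\<in>A. if {i, j} = e then \<omega> e *\<^sub>R x j else 0)"
    by (simp only: scaleR_sum_right if_scale)
  also have "\<dots> = (\<Sum>j\<in>A. \<Sum>e\<in>E. if {i, j} = e then \<omega> e *\<^sub>R x j else 0)"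
    by (rule sum.swap)
  also have "\<dots> = (\<Sum>j\<in>A. stress_coeff E \<omega> i j *\<^sub>R x j)"
  proof (rule sum.cong[OF refl])
    fix j
    have "(\<Sum>e\<in>E. if {i, j} = e then \<omega> e *\<^sub>R x j else 0) =
        (if {i, j} \<in> E then \<omega> {i, j} *\<^sub>R x j else 0)"
      by (rule sum.delta'[OF assms])
    then show "(\<Sum>e\<in>E. if {i, j} = e then \<omega> e *\<^sub>R x j else 0) = stress_coeff E \<omega> i j *\<^sub>R x j"
      by (simp add: stress_coeff_def)
  qed
  finally show ?thesis by simp
qed

text \<open>The forces of a stress always have zero resultant and zero torque, so three of the \<open>2 * card W\<close>
equilibrium conditions are redundant. It suffices to impose equilibrium at all vertices except \<open>a\<close> and \<open>b\<close>,
and at \<open>b\<close> only in the direction of \<open>ab\<close>: the torque about \<open>a\<close> removes the other component at \<open>b\<close>,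
and the resultant then the force at \<open>a\<close>.\<close>

lemma exists_stress:
  fixes p :: "nat \<Rightarrow> real^2"
  assumes W: "W \<subseteq> {..<n}" "inj_on p W" "2 \<le> card W"
    and F: "simple_graph W F" "2 * card W < card F + 3"
  obtains \<omega> where "equilibrium_stress n F p \<omega>" "\<exists>e\<in>F. \<omega> e \<noteq> 0" "\<And>e. e \<notin> F \<Longrightarrow> \<omega> e = 0"
proof -
  have finW: "finite W" using W(1) finite_subset by blast
  have FW: "\<exists>u\<in>W. \<exists>v\<in>W. u \<noteq> v \<and> e = {u, v}" if "e \<in> F" for e
    using F(1) that unfolding simple_graph_def by blast
  have "F \<subseteq> Pow W" using FW by blast
  then have finF: "finite F" using finW finite_subset by blast
  obtain a b where ab: "a \<in> W" "b \<in> W" "a \<noteq> b"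
    using W(3) by (metis card_le_Suc0_iff_eq finW not_less_eq_eq numeral_2_eq_2)
  define d where "d = p b - p a"
  have d: "d \<noteq> 0" using W(2) ab unfolding d_def inj_on_def by auto
  define c where "c i e = (\<Sum>j<n. if {i, j} = e then p i - p j else 0)" for i e
  define dir :: "nat \<Rightarrow> bool \<Rightarrow> real^2" where
    "dir i k = (if i = b then d else axis (if k then 1 else 2) 1)" for i k
  define J where "J = (W - {a}) \<times> (UNIV :: bool set) - {(b, False)}"
  have "card J = card ((W - {a}) \<times> (UNIV :: bool set)) - 1"
    unfolding J_def using ab by (intro card_Diff_singleton) auto
  also have "\<dots> = (card W - 1) * 2 - 1"
    using ab finW by (simp add: card_cartesian_product)
  finally have cJ: "card J < card F" using F(2) W(3) by simp
  have fJ: "finite J" unfolding J_def using finW by simp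
  obtain \<omega> where \<omega>: "\<exists>e\<in>F. \<omega> e \<noteq> 0" "\<And>e. e \<notin> F \<Longrightarrow> \<omega> e = 0"
      and eq: "\<And>ik. ik \<in> J \<Longrightarrow> (\<Sum>e\<in>F. inner (dir (fst ik) (snd ik)) (c (fst ik) e) * \<omega> e) = 0"
    by (rule homogeneous_system_solution[OF fJ finF cJ,
        where a = "\<lambda>ik e. inner (dir (fst ik) (snd ik)) (c (fst ik) e)"]) (rule that)
  define f where "f i = (\<Sum>j<n. stress_coeff F \<omega> i j *\<^sub>R (p i - p j))" for i
  have f: "f i = (\<Sum>e\<in>F. \<omega> e *\<^sub>R c i e)" for i
    unfolding f_def c_def by (rule stress_coeff_sum[OF finF])
  have feq: "inner (dir i k) (f i) = 0" if "(i, k) \<in> J" for i k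
    using eq[OF that] unfolding f by (simp add: inner_sum_right mult.commute)
  have zero: "f i = 0" if "i \<noteq> a" "i \<noteq> b" for i
  proof (cases "i \<in> W")
    case True
    then have "inner (dir i True) (f i) = 0" "inner (dir i False) (f i) = 0"
      using feq that unfolding J_def by auto
    then show ?thesis using that by (simp add: dir_def inner_axis' plane_eq_iff)
  next
    case False
    then have "{i, j} \<notin> F" for j using FW[of "{i, j}"] by (metis insertI1 insertE singletonD)
    then show ?thesis by (simp add: f_def stress_coeff_def)
  qed
  have onlyab: "(\<Sum>i<n. g i) = g a + g b" if "\<And>i. i \<noteq> a \<Longrightarrow> i \<noteq> b \<Longrightarrow> g i = 0" for g :: "nat \<Rightarrow> 'x::comm_monoid_add"
  proof -
    have "(\<Sum>i<n. g i) = (\<Sum>i\<in>{a, b}. g i)"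
      using that ab W(1) by (intro sum.mono_neutral_right) auto
    then show ?thesis using ab by simp
  qed
  have "(\<Sum>i<n. f i) = 0"
    unfolding f_def
  proof (rule antisymmetric_sum_zero)
    show "stress_coeff F \<omega> j i *\<^sub>R (p j - p i) = - (stress_coeff F \<omega> i j *\<^sub>R (p i - p j))" for i j
      by (simp add: stress_coeff_sym[of F \<omega> j i] scaleR_diff_right)
  qed
  then have fab: "f a + f b = 0" using onlyab[of f] zero by simp
  have "(\<Sum>i<n. cross (p i - p a) (f i)) = 0"
    unfolding f_def cross_sum
  proof (rule antisymmetric_sum_zero)
    show "cross (p j - p a) (stress_coeff F \<omega> j i *\<^sub>R (p j - p i)) =
        - cross (p i - p a) (stress_coeff F \<omega> i j *\<^sub>R (p i - p j))" for i j
      by (simp add: stress_coeff_sym[of F \<omega> j i] cross_def algebra_simps)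
  qed
  then have "cross d (f b) = 0"
    using onlyab[of "\<lambda>i. cross (p i - p a) (f i)"] zero by (simp add: d_def cross_linear)
  then obtain t where t: "f b = t *\<^sub>R d" using cross_zero_imp_parallel d by blast
  have "inner d (f b) = 0"
    using feq[of b True] ab by (simp add: J_def dir_def)
  then have "f b = 0" using t d by simp
  then have "f i = 0" for i using fab zero[of i] by (metis add.right_neutral)
  then have "equilibrium_stress n F p \<omega>" by (simp add: equilibrium_stress_def f_def)
  then show ?thesis using that \<omega> by blast
qed

section \<open>Uniqueness of proper stresses\<close>

definition braces_nonpos :: "nat \<Rightarrow> (nat \<Rightarrow> nat \<Rightarrow> real) \<Rightarrow> bool" where
  "braces_nonpos n w \<longleftrightarrow> (\<forall>i j. w i j = w j i) \<and>
    (\<forall>i<n. \<forall>j<n. {i, j} \<notin> boundary_edges n \<longrightarrow> w i j \<le> 0)"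

lemma braces_nonposD:
  assumes "braces_nonpos n w" "i < n" "j < n" "j \<noteq> (i + 1) mod n" "i \<noteq> (j + 1) mod n"
  shows "w i j \<le> 0"
  using assms boundary_edge_iff[of i n j] unfolding braces_nonpos_def by blast

text \<open>All edges at \<open>i\<close> point into the cone spanned by the two sides at \<open>i\<close>. Measured by the distance from the line
of the side towards \<open>i + 1\<close>, the equilibrium at \<open>i\<close> becomes a sum of nonpositive terms once the side
towards \<open>h = i - 1\<close> carries no stress; so all terms vanish.\<close>

lemma vertex_cone:
  assumes pos: "convex_position s n p" and n: "3 \<le> n" and bal: "balanced n w p"
    and neg: "braces_nonpos n w"
    and h: "h < n" and i: "i = (h + 1) mod n" and zero: "w i h = 0"
    and j: "j < n" "j \<noteq> i"
  shows "w i j = 0"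
proof -
  define k where "k = (i + 1) mod n"
  have hi: "i < n" "i \<noteq> h" using successor_neq[OF h n] i by auto
  have k: "k < n" "k \<noteq> i" using successor_neq[OF hi(1) n] by (auto simp: k_def)
  define d where "d = p k - p i"
  let ?t = "\<lambda>m. w i m * (s * cross d (p m - p i))"
  have pos': "0 < s * cross d (p m - p i)" if "m < n" "m \<noteq> i" "m \<noteq> k" for m
    using convex_position_edge[OF pos n hi(1) that(1,2)] that(3) by (simp add: k_def d_def orient_def)
  have other: "w i m \<le> 0" if "m < n" "m \<noteq> k" "m \<noteq> h" for m
  proof (rule braces_nonposD[OF neg hi(1) that(1)])
    show "m \<noteq> (i + 1) mod n" using that by (simp add: k_def)
    show "i \<noteq> (m + 1) mod n" using that successor_inj[OF h that(1)] i by metis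
  qed
  have le: "?t m \<le> 0" if "m < n" for m
  proof -
    consider "m = i" | "m = k" | "m = h" | "m \<noteq> i" "m \<noteq> k" "m \<noteq> h" by blast
    then show ?thesis
    proof cases
      case 4
      then show ?thesis using other[of m] pos'[of m] that by (simp add: mult_nonpos_nonneg)
    qed (use zero in \<open>auto simp: d_def cross_linear(3)\<close>)
  qed
  have "(\<Sum>m<n. ?t m) = s * (\<Sum>m<n. w i m * cross d (p m - p i))"
    by (simp add: sum_distrib_left mult.left_commute)
  also have "\<dots> = 0" by (simp add: balanced_cross[OF bal hi(1)])
  finally have "\<forall>m\<in>{..<n}. ?t m = 0"
    using le sum_nonneg_eq_0_iff[of "{..<n}" "\<lambda>m. - ?t m"] by (simp add: sum_negf)
  then have zero': "w i m = 0" if "m < n" "m \<noteq> i" "m \<noteq> k" for m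
    using pos'[OF that] that(1) by (metis lessThan_iff less_irrefl mult_eq_0_iff)
  have "(\<Sum>m<n. w i m *\<^sub>R (p m - p i)) = w i k *\<^sub>R (p k - p i)"
  proof -
    have "(\<Sum>m<n. w i m *\<^sub>R (p m - p i)) = (\<Sum>m\<in>{k}. w i m *\<^sub>R (p m - p i))"
      by (rule sum.mono_neutral_right) (use k zero' in auto)
    then show ?thesis by simp
  qed
  moreover have "p k \<noteq> p i"
    using inj_on_convex_position[OF pos n] hi k by (auto simp: inj_on_def)
  ultimately have "w i k = 0" using balanced_forces[OF bal hi(1)] by simp
  then show ?thesis using zero' j by (cases "j = k") auto
qed

text \<open>Measured by the distance from the line of the other side at \<open>i\<close>, the side must balance the braces at \<open>i\<close>,
which all contribute nonpositively, and \<open>b\<close> negatively.\<close>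

lemma boundary_positive:
  assumes pos: "convex_position s n p" and n: "3 \<le> n" and bal: "balanced n w p"
    and neg: "braces_nonpos n w"
    and i: "i < n" and b: "b < n" "b \<noteq> i" "w i b < 0" "{i, b} \<notin> boundary_edges n"
  shows "0 < w i ((i + 1) mod n)"
proof -
  obtain h where h: "h < n" "(h + 1) mod n = i" "h \<noteq> i" "h \<noteq> (i + 1) mod n"
    using predecessor_exists[OF i n] by blast
  define k where "k = (i + 1) mod n"
  have k: "k < n" "k \<noteq> i" "k \<noteq> h" using successor_neq[OF i n] h by (auto simp: k_def)
  define d where "d = p i - p h"
  let ?g = "\<lambda>m. s * cross d (p m - p i)"
  have pos': "0 < ?g m" if "m < n" "m \<noteq> i" "m \<noteq> h" for m
  proof -
    have "cross d (p m - p i) = orient (p h) (p i) (p m)"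
      by (simp add: d_def orient_def cross_def algebra_simps)
    then show ?thesis
      using convex_position_edge[OF pos n h(1) that(1)] that h(2) by simp
  qed
  have zero: "?g h = 0" by (simp add: d_def cross_def algebra_simps)
  have other: "w i m \<le> 0" if "m < n" "m \<noteq> k" "m \<noteq> h" for m
  proof (rule braces_nonposD[OF neg i that(1)])
    show "m \<noteq> (i + 1) mod n" using that by (simp add: k_def)
    show "i \<noteq> (m + 1) mod n" using that successor_inj[OF h(1) that(1)] h by metis
  qed
  have bb: "b \<noteq> k" "b \<noteq> h"
    using b(4) boundary_edge_iff[OF i b(1)] h by (auto simp: k_def)
  have "0 = s * (\<Sum>m<n. w i m * cross d (p m - p i))" by (simp add: balanced_cross[OF bal i])
  also have "\<dots> = (\<Sum>m<n. w i m * ?g m)" by (simp add: sum_distrib_left mult.left_commute)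
  also have "\<dots> = w i k * ?g k + (\<Sum>m\<in>{..<n} - {k}. w i m * ?g m)"
    using k by (intro sum.remove) auto
  also have "(\<Sum>m\<in>{..<n} - {k}. w i m * ?g m) < 0"
  proof -
    have "(\<Sum>m\<in>{..<n} - {k}. w i m * ?g m) < (\<Sum>m\<in>{..<n} - {k}. 0)"
    proof (rule sum_strict_mono_ex1)
      show "\<forall>m\<in>{..<n} - {k}. w i m * ?g m \<le> 0"
      proof
        fix m assume m: "m \<in> {..<n} - {k}"
        consider "m = i" | "m = h" | "m \<noteq> i" "m \<noteq> h" by blast
        then show "w i m * ?g m \<le> 0"
        proof cases
          case 2
          show ?thesis unfolding 2 zero by simp
        next
          case 3
          then show ?thesis using other[of m] pos'[of m] m by (intro mult_nonpos_nonneg) auto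
        qed (simp add: cross_linear(3))
      qed
      show "\<exists>m\<in>{..<n} - {k}. w i m * ?g m < 0"
        using pos'[OF b(1,2) bb(2)] b bb by (intro bexI[of _ b] mult_neg_pos) auto
    qed simp
    then show ?thesis by simp
  qed
  finally have "0 < w i k * ?g k" by simp
  moreover have "0 < ?g k" using pos' k by blast
  ultimately show ?thesis unfolding k_def[symmetric]
    by (meson not_less_iff_gr_or_eq zero_less_mult_pos2)
qed

text \<open>If all summands lie on the nonpositive side of \<open>g\<close> and their sum is a multiple of \<open>D\<close>, which is on the
positive side, then the multiple is nonpositive, and it vanishes only if every summand does.\<close>

lemma weighted_cone:
  fixes D :: "real^2" and g :: "real^2 \<Rightarrow> real"
  assumes fin: "finite I" and le: "\<And>j. j \<in> I \<Longrightarrow> w j * g (x j) \<le> 0" and lin: "\<And>c. g (c *\<^sub>R D) = c * g D"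
    and gs: "g (\<Sum>j\<in>I. w j *\<^sub>R x j) = (\<Sum>j\<in>I. w j * g (x j))"
    and c: "(\<Sum>j\<in>I. w j *\<^sub>R x j) = c *\<^sub>R D" and D: "0 < g D"
  shows "c \<le> 0" and "c = 0 \<Longrightarrow> j \<in> I \<Longrightarrow> w j * g (x j) = 0"
proof -
  have eq: "c * g D = (\<Sum>j\<in>I. w j * g (x j))" using gs c lin by simp
  then have "c * g D \<le> 0" using sum_nonpos[of I "\<lambda>j. w j * g (x j)"] le by simp
  then show "c \<le> 0" using D by (simp add: mult_le_0_iff)
  show "w j * g (x j) = 0" if "c = 0" "j \<in> I"
    using eq that sum_nonneg_eq_0_iff[OF fin, of "\<lambda>j. - (w j * g (x j))"] le
    by (simp add: sum_negf)
qed

text \<open>Take the torques about \<open>v\<close> of the forces at the vertices of \<open>I\<close>. Edges inside \<open>I\<close> cancel,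
edges to \<open>v\<close> have no torque, and nothing else leaves \<open>I\<close> but the edges to \<open>u\<close>.\<close>

lemma uncrossed_chord_force:
  assumes bal: "balanced n w p" and sym: "\<And>i j. w i j = w j i" and uv: "u < n" "v < n"
    and I: "I \<subseteq> {..<n} - {u, v}"
    and un: "\<And>i j. \<lbrakk>i \<in> I; j \<in> {..<n} - {u, v} - I\<rbrakk> \<Longrightarrow> w i j = 0" and neq: "u \<noteq> v"
  shows "cross (p v - p u) (\<Sum>j\<in>I. w u j *\<^sub>R (p j - p u)) = 0"
proof -
  let ?c = "\<lambda>i j. w i j * cross (p i - p v) (p i - p j)"
  have finI: "finite I" using I finite_subset by blast
  have "(\<Sum>j<n. ?c i j) = (\<Sum>j\<in>I. ?c i j) + ?c i u" if i: "i \<in> I" for i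
  proof -
    have "(\<Sum>j<n. ?c i j) = (\<Sum>j\<in>I \<union> {u}. ?c i j)"
    proof (rule sum.mono_neutral_right)
      show "\<forall>j\<in>{..<n} - (I \<union> {u}). ?c i j = 0"
      proof
        fix j assume j: "j \<in> {..<n} - (I \<union> {u})"
        show "?c i j = 0"
        proof (cases "j = v")
          case False
          then show ?thesis using un[OF i, of j] j by simp
        qed simp
      qed
    qed (use I uv in auto)
    also have "\<dots> = (\<Sum>j\<in>I. ?c i j) + ?c i u"
      using finI I by (subst sum.union_disjoint) auto
    finally show ?thesis .
  qed
  moreover have "(\<Sum>j<n. ?c i j) = 0" if i: "i \<in> I" for i
  proof -
    have "(\<Sum>j<n. w i j * cross (p i - p v) (p j - p i)) = 0"
      using balanced_cross[OF bal] i I by blast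
    moreover have "?c i j = - (w i j * cross (p i - p v) (p j - p i))" for j
      by (simp add: cross_def algebra_simps)
    ultimately show ?thesis by (simp add: sum_negf)
  qed
  ultimately have "(\<Sum>i\<in>I. (\<Sum>j\<in>I. ?c i j) + ?c i u) = (\<Sum>i\<in>I. 0)"
    by (intro sum.cong) auto
  moreover have "(\<Sum>i\<in>I. \<Sum>j\<in>I. ?c i j) = 0"
  proof (rule antisymmetric_sum_zero)
    show "?c j i = - ?c i j" for i j
      by (simp add: sym[of j i] cross_def algebra_simps)
  qed
  ultimately have "(\<Sum>i\<in>I. ?c i u) = 0" by (simp add: sum.distrib)
  moreover have "?c i u = - (w u i * cross (p v - p u) (p i - p u))" for i
    by (simp add: sym[of i u] cross_def algebra_simps)
  ultimately show ?thesis by (simp add: cross_sum cross_linear sum_negf)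
qed

text \<open>Let \<open>I\<close> and \<open>K\<close> be the two arcs between \<open>u\<close> and \<open>v\<close>. The forces at \<open>u\<close> from \<open>I\<close>
and from \<open>K\<close> are both parallel to the chord. Each of the two is a combination of a side and of braces with
nonpositive coefficients, and the chord lies strictly inside the angle of the polygon at \<open>u\<close>; so the coefficients
\<open>c\<close> and \<open>c'\<close> along the chord are nonpositive. Together with \<open>w u v\<close>, also nonpositive, they sum to
zero, hence all three vanish and there is no stress at \<open>u\<close>. From \<open>u\<close> the vanishing spreads
around the polygon, one vertex at a time.\<close>

lemma uncrossed_chord_stress_zero:
  assumes pos: "convex_position s n p" and n: "3 \<le> n" and bal: "balanced n w p"
    and neg: "braces_nonpos n w" and uv: "chord n u v"
    and un: "\<And>i j. \<lbrakk>u < i; i < v; j < n; j < u \<or> v < j\<rbrakk> \<Longrightarrow> w i j = 0"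
    and ij: "i < n" "j < n" "i \<noteq> j"
  shows "w i j = 0"
proof -
  have uvn: "u < n" "v < n" "u < v" "u + 1 < v" using uv by (auto simp: chord_def)
  have sym: "w i j = w j i" for i j using neg by (simp add: braces_nonpos_def)
  have inj: "inj_on p {..<n}" using inj_on_convex_position[OF pos n] .
  obtain h where h: "h < n" "(h + 1) mod n = u" "h \<noteq> u" "h \<noteq> (u + 1) mod n"
    using predecessor_exists[OF uvn(1) n] by blast
  define k where "k = u + 1"
  have k: "(u + 1) mod n = k" "k < n" "k \<noteq> u" "k \<noteq> v" "k \<noteq> h"
    using uvn h by (auto simp: k_def)
  define I where "I = {u<..<v}"
  define K where "K = {..<n} - {u, v} - I"
  have kI: "k \<in> I" using uvn by (simp add: I_def k_def)
  have hK: "h \<in> K"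
  proof -
    have "h = (if u = 0 then n - 1 else u - 1)"
      using h uvn by (auto simp: mod_if split: if_splits)
    then show ?thesis using uv h by (auto simp: K_def I_def chord_def)
  qed
  define d where "d = p v - p u"
  have d: "d \<noteq> 0" using inj_onD[OF inj, of v u] uvn by (auto simp: d_def)
  have KI: "{..<n} - {u, v} - K = I" using uvn unfolding K_def I_def by auto
  have unI: "w i j = 0" if "i \<in> I" "j \<in> K" for i j
    using un[of i j] that unfolding I_def K_def by auto
  have "cross d (\<Sum>j\<in>I. w u j *\<^sub>R (p j - p u)) = 0"
    unfolding d_def by (rule uncrossed_chord_force[OF bal sym uvn(1,2)]) (use uvn unI in \<open>auto simp: I_def K_def\<close>)
  then obtain c where c: "(\<Sum>j\<in>I. w u j *\<^sub>R (p j - p u)) = c *\<^sub>R d"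
    using cross_zero_imp_parallel[OF _ d] by blast
  have "cross d (\<Sum>j\<in>K. w u j *\<^sub>R (p j - p u)) = 0"
    unfolding d_def
  proof (rule uncrossed_chord_force[OF bal sym uvn(1,2)])
    show "w i j = 0" if "i \<in> K" "j \<in> {..<n} - {u, v} - K" for i j
      using unI[of j i] that sym[of i j] unfolding KI by simp
  qed (use uvn in \<open>auto simp: K_def\<close>)
  then obtain c' where c': "(\<Sum>j\<in>K. w u j *\<^sub>R (p j - p u)) = c' *\<^sub>R d"
    using cross_zero_imp_parallel[OF _ d] by blast
  have nb: "w u j \<le> 0" if "j < n" "j \<noteq> k" "j \<noteq> h" for j
  proof (rule braces_nonposD[OF neg uvn(1) that(1)])
    show "j \<noteq> (u + 1) mod n" using that k by simp
    show "u \<noteq> (j + 1) mod n" using that successor_inj[OF h(1) that(1)] h by metis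
  qed
  have split: "(\<Sum>j<n. w u j *\<^sub>R (p j - p u)) =
      (\<Sum>j\<in>I. w u j *\<^sub>R (p j - p u)) + (\<Sum>j\<in>K. w u j *\<^sub>R (p j - p u)) + w u v *\<^sub>R d"
  proof -
    have "{..<n} = I \<union> (K \<union> {v, u})" using uvn by (auto simp: I_def K_def)
    moreover have "finite I" "finite K" "I \<inter> (K \<union> {v, u}) = {}" "K \<inter> {v, u} = {}" "v \<noteq> u"
      using uvn by (auto simp: I_def K_def)
    ultimately show ?thesis by (simp add: sum.union_disjoint d_def)
  qed
  then have "(c + c' + w u v) *\<^sub>R d = 0"
    using balanced_forces[OF bal uvn(1)] c c' by (simp add: scaleR_add_left)
  then have total: "c + c' + w u v = 0" using d by simp
  have gk: "0 < s * cross (p k - p u) (p j - p u)" if "j < n" "j \<noteq> u" "j \<noteq> k" for j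
    using convex_position_edge[OF pos n uvn(1) that(1,2)] that(3) k by (simp add: orient_def)
  have gh: "0 < s * cross (p u - p h) (p j - p u)" if "j < n" "j \<noteq> u" "j \<noteq> h" for j
  proof -
    have "cross (p u - p h) (p j - p u) = orient (p h) (p u) (p j)"
      by (simp add: orient_def cross_def algebra_simps)
    then show ?thesis using convex_position_edge[OF pos n h(1) that(1)] that h(2) by simp
  qed
  have leI: "w u j * (s * cross (p k - p u) (p j - p u)) \<le> 0" if "j \<in> I" for j
  proof (cases "j = k")
    case False
    then show ?thesis using mult_nonpos_nonneg[OF nb[of j] less_imp_le[OF gk[of j]]] that hK uvn
      by (auto simp: I_def K_def)
  qed simp
  have leK: "w u j * (s * cross (p u - p h) (p j - p u)) \<le> 0" if "j \<in> K" for j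
  proof (cases "j = h")
    case True
    have "cross (p u - p h) (p h - p u) = 0" by (simp add: cross_def algebra_simps)
    then show ?thesis using True by simp
  next
    case False
    then show ?thesis using mult_nonpos_nonneg[OF nb[of j] less_imp_le[OF gh[of j]]] that kI uvn
      by (auto simp: I_def K_def)
  qed
  have fin: "finite I" "finite K" by (auto simp: I_def K_def)
  have dk: "0 < s * cross (p k - p u) d" using gk[of v] uvn k by (simp add: d_def)
  have dh: "0 < s * cross (p u - p h) d" using gh[of v] uvn hK by (simp add: d_def K_def)
  have lin: "s * cross a (c *\<^sub>R d) = c * (s * cross a d)" for a c
    by (simp add: cross_linear)
  have gs: "s * cross a (\<Sum>j\<in>A. w u j *\<^sub>R (p j - p u)) =
      (\<Sum>j\<in>A. w u j * (s * cross a (p j - p u)))" for a A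
    by (simp add: cross_sum cross_linear(2) sum_distrib_left mult.left_commute)
  note coneI = weighted_cone[where g = "\<lambda>x. s * cross (p k - p u) x", OF fin(1) _ lin gs c dk]
  note coneK = weighted_cone[where g = "\<lambda>x. s * cross (p u - p h) x", OF fin(2) _ lin gs c' dh]
  have cI: "c \<le> 0" using leI by (rule coneI(1))
  have cI': "w u j * (s * cross (p k - p u) (p j - p u)) = 0" if "c = 0" "j \<in> I" for j
    using leI that by (rule coneI(2))
  have cK: "c' \<le> 0" using leK by (rule coneK(1))
  have cK': "w u j * (s * cross (p u - p h) (p j - p u)) = 0" if "c' = 0" "j \<in> K" for j
    using leK that by (rule coneK(2))
  have "w u v \<le> 0" using nb[of v] uvn k hK by (auto simp: K_def)
  then have c0: "c = 0" "c' = 0" "w u v = 0" using total cI cK by linarith+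
  have zI: "w u j = 0" if "j \<in> I" "j \<noteq> k" for j
    using cI'[OF c0(1) that(1)] gk[of j] that uvn by (auto simp: I_def)
  have zK: "w u j = 0" if "j \<in> K" "j \<noteq> h" for j
    using cK'[OF c0(2) that(1)] gh[of j] that uvn by (auto simp: K_def)
  have zh: "w u h = 0"
  proof -
    have "(\<Sum>j\<in>K. w u j *\<^sub>R (p j - p u)) = (\<Sum>j\<in>{h}. w u j *\<^sub>R (p j - p u))"
      by (rule sum.mono_neutral_right) (use fin hK zK in auto)
    then have "w u h *\<^sub>R (p h - p u) = 0" using c' c0 by simp
    moreover have "p h \<noteq> p u" using inj h uvn by (auto simp: inj_on_def)
    ultimately show ?thesis by simp
  qed
  have all: "\<forall>j<n. j \<noteq> (u + m) mod n \<longrightarrow> w ((u + m) mod n) j = 0" for m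
  proof (induction m)
    case 0
    have "w u j = 0" if "j < n" "j \<noteq> u" for j
      using vertex_cone[OF pos n bal neg h(1) h(2)[symmetric] zh that] .
    then show ?case using uvn by simp
  next
    case (Suc m)
    let ?h = "(u + m) mod n" and ?i = "(u + Suc m) mod n"
    have i: "?i = (?h + 1) mod n" by (simp add: mod_Suc_eq)
    have hn: "?h < n" using n by simp
    have "?i \<noteq> ?h" "?i < n" using successor_neq[OF hn n] i by auto
    then have "w ?i ?h = 0" using Suc sym by metis
    then show ?case using vertex_cone[OF pos n bal neg hn i] by blast
  qed
  have "(u + (i + n - u)) mod n = i" using ij uvn by simp
  then show ?thesis using all[of "i + n - u"] ij by metis
qed

definition minimal_braced :: "nat \<Rightarrow> nat set set \<Rightarrow> bool" where
  "minimal_braced n E \<longleftrightarrow> 4 \<le> n \<and> minimally_3_connected_braced_polygon n E"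

lemma minimal_bracedD:
  assumes "minimal_braced n E"
  shows "4 \<le> n" "3 \<le> n" "simple_graph {..<n} E" "boundary_edges n \<subseteq> E" "k_connected 3 {..<n} E"
    "e \<in> braces n E \<Longrightarrow> \<not> k_connected 3 {..<n} (E - {e})"
  using assms unfolding minimal_braced_def minimally_3_connected_braced_polygon_def
    braced_polygon_graph_def by auto

lemma simple_graph_edgeD:
  assumes "simple_graph {..<n} E" "{i, j} \<in> E"
  shows "i < n" "j < n" "i \<noteq> j"
proof -
  obtain u v where "u < n" "v < n" "u \<noteq> v" "{i, j} = {u, v}"
    using assms unfolding simple_graph_def by (metis lessThan_iff)
  then show "i < n" "j < n" "i \<noteq> j" by (auto simp: doubleton_eq_iff)
qed

lemma simple_graph_finite:
  assumes "simple_graph V E" shows "finite E"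
proof -
  have "E \<subseteq> Pow V" "finite V" using assms unfolding simple_graph_def by auto
  then show ?thesis by (meson finite_Pow_iff finite_subset)
qed

lemma braces_nonpos_stress_coeff:
  assumes "\<And>e. e \<in> braces n E \<Longrightarrow> \<omega> e \<le> 0"
  shows "braces_nonpos n (stress_coeff E \<omega>)"
  using assms unfolding braces_nonpos_def braces_def
  by (auto simp: stress_coeff_def insert_commute)

text \<open>By minimality some chord is crossed by \<open>f\<close> alone, and \<open>f\<close> carries no stress.\<close>

lemma nonpos_stress_with_zero_brace:
  assumes G: "minimal_braced n E" and pos: "convex_position s n p" and eq: "equilibrium_stress n E p \<omega>"
    and le: "\<And>e. e \<in> braces n E \<Longrightarrow> \<omega> e \<le> 0" and f: "f \<in> braces n E" "\<omega> f = 0" and e: "e \<in> E"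
  shows "\<omega> e = 0"
proof -
  note G' = minimal_bracedD[OF G]
  have "boundary_edges n \<subseteq> E - {f}" using G'(4) f(1) by (auto simp: braces_def)
  then obtain u v where uv: "chord n u v"
    "\<And>i j. \<lbrakk>u < i; i < v; j < n; j < u \<or> v < j\<rbrakk> \<Longrightarrow> {i, j} \<notin> E - {f}"
    using chord_with_unique_crossing[OF _ G'(1) G'(6)[OF f(1)]] by metis
  have un: "stress_coeff E \<omega> i j = 0" if "u < i" "i < v" "j < n" "j < u \<or> v < j" for i j
    using uv(2)[OF that] f(2) by (auto simp: stress_coeff_def)
  obtain i j where ij: "i < n" "j < n" "i \<noteq> j" "e = {i, j}"
    using e G'(3) unfolding simple_graph_def by (metis lessThan_iff)
  have "stress_coeff E \<omega> i j = 0"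
    using uncrossed_chord_stress_zero[OF pos G'(2) _ braces_nonpos_stress_coeff[OF le] uv(1) un ij(1-3)]
      eq by (simp add: equilibrium_stress_balanced)
  then show ?thesis using e ij by (simp add: stress_coeff_def)
qed

lemma equilibrium_stress_combine:
  assumes "equilibrium_stress n E p \<omega>" "equilibrium_stress n E p \<sigma>"
  shows "equilibrium_stress n E p (\<lambda>e. a * \<omega> e + b * \<sigma> e)"
proof -
  have "(\<Sum>j<n. stress_coeff E (\<lambda>e. a * \<omega> e + b * \<sigma> e) i j *\<^sub>R (p i - p j)) =
      a *\<^sub>R (\<Sum>j<n. stress_coeff E \<omega> i j *\<^sub>R (p i - p j)) +
      b *\<^sub>R (\<Sum>j<n. stress_coeff E \<sigma> i j *\<^sub>R (p i - p j))" for i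
    unfolding scaleR_sum_right sum.distrib[symmetric]
    by (intro sum.cong) (auto simp: stress_coeff_def scaleR_add_left)
  then show ?thesis using assms by (simp add: equilibrium_stress_def)
qed

lemma braces_nonempty:
  assumes G: "minimal_braced n E"
  shows "braces n E \<noteq> {}" "finite (braces n E)"
proof -
  note G' = minimal_bracedD[OF G]
  show "braces n E \<noteq> {}" using vertex_has_brace[OF G'(5,3,1), of 0] G'(1) by auto
  show "finite (braces n E)" using simple_graph_finite[OF G'(3)] by (simp add: braces_def)
qed

text \<open>Subtract \<open>\<sigma>\<close> from the multiple of \<open>\<omega>\<close> for which the difference is nonpositive on all braces and first
reaches zero on one of them; the difference then vanishes.\<close>

lemma stress_unique:
  assumes G: "minimal_braced n E" and pos: "convex_position s n p" and ps: "proper_stress n E p \<omega>"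
    and eq: "equilibrium_stress n E p \<sigma>"
  obtains c where "\<And>e. e \<in> E \<Longrightarrow> \<sigma> e = c * \<omega> e"
proof -
  note br = braces_nonempty[OF G]
  have neg: "\<omega> e < 0" if "e \<in> braces n E" for e using ps that by (simp add: proper_stress_def)
  define c where "c = Max ((\<lambda>e. \<sigma> e / \<omega> e) ` braces n E)"
  have cge: "\<sigma> e / \<omega> e \<le> c" if "e \<in> braces n E" for e
    unfolding c_def using br that by (intro Max_ge) auto
  have "c \<in> (\<lambda>e. \<sigma> e / \<omega> e) ` braces n E" unfolding c_def using br by (intro Max_in) auto
  then obtain f where f: "f \<in> braces n E" "\<sigma> f / \<omega> f = c" by auto
  have "equilibrium_stress n E p (\<lambda>e. c * \<omega> e + (- 1) * \<sigma> e)"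
    using ps eq by (intro equilibrium_stress_combine) (auto simp: proper_stress_def)
  then have "c * \<omega> e + (- 1) * \<sigma> e = 0" if "e \<in> E" for e
  proof (rule nonpos_stress_with_zero_brace[OF G pos _ _ f(1) _ that])
    show "c * \<omega> e + (- 1) * \<sigma> e \<le> 0" if "e \<in> braces n E" for e
      using cge[OF that] neg[OF that] by (simp add: divide_le_eq)
    show "c * \<omega> f + (- 1) * \<sigma> f = 0" using f neg[OF f(1)] by auto
  qed
  then show ?thesis using that[of c] by simp
qed

lemma proper_stressI:
  assumes G: "minimal_braced n E" and pos: "convex_position s n p" and eq: "equilibrium_stress n E p \<omega>"
    and neg: "\<And>e. e \<in> braces n E \<Longrightarrow> \<omega> e < 0"
  shows "proper_stress n E p \<omega>"
proof -
  note G' = minimal_bracedD[OF G]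
  have "0 < \<omega> e" if "e \<in> boundary_edges n" for e
  proof -
    obtain i where i: "i < n" "e = {i, (i + 1) mod n}" using \<open>e \<in> boundary_edges n\<close> unfolding boundary_edges_def by blast
    obtain b where b: "b < n" "{i, b} \<in> braces n E" using vertex_has_brace[OF G'(5,3,1) i(1)] by blast
    then have bE: "{i, b} \<in> E" "{i, b} \<notin> boundary_edges n" by (auto simp: braces_def)
    have "0 < stress_coeff E \<omega> i ((i + 1) mod n)"
    proof (rule boundary_positive[OF pos G'(2) _ braces_nonpos_stress_coeff i(1) b(1)])
      show "balanced n (stress_coeff E \<omega>) p" using eq by (simp add: equilibrium_stress_balanced)
      show "b \<noteq> i" using simple_graph_edgeD[OF G'(3) bE(1)] by simp
      show "stress_coeff E \<omega> i b < 0" using neg[OF b(2)] bE by (simp add: stress_coeff_def)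
    qed (use neg bE in \<open>auto intro: less_imp_le\<close>)
    then show ?thesis using i by (auto simp: stress_coeff_def split: if_splits)
  qed
  then show ?thesis using eq neg by (simp add: proper_stress_def)
qed

section \<open>Positive semidefiniteness of proper stresses\<close>

text \<open>The bilinear form of the stress matrix.\<close>

definition stress_form :: "nat \<Rightarrow> (nat \<Rightarrow> nat \<Rightarrow> real) \<Rightarrow> (nat \<Rightarrow> real) \<Rightarrow> (nat \<Rightarrow> real) \<Rightarrow> real" where
  "stress_form n w f g = (\<Sum>i<n. f i * (\<Sum>j<n. w i j * (g i - g j)))"

lemma stress_form_left:
  "stress_form n w (\<lambda>i. f i + f' i) g = stress_form n w f g + stress_form n w f' g"
  "stress_form n w (\<lambda>i. c * f i) g = c * stress_form n w f g"
  by (simp_all add: stress_form_def sum.distrib distrib_right sum_distrib_left mult.assoc)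

lemma stress_form_right:
  "stress_form n w f (\<lambda>i. g i + g' i) = stress_form n w f g + stress_form n w f g'"
  "stress_form n w f (\<lambda>i. c * g i) = c * stress_form n w f g"
  by (simp_all add: stress_form_def algebra_simps sum.distrib sum_subtractf sum_distrib_left)

lemma stress_form_cong:
  assumes "\<And>i. i < n \<Longrightarrow> f i = f' i" "\<And>i. i < n \<Longrightarrow> g i = g' i"
  shows "stress_form n w f g = stress_form n w f' g'"
  unfolding stress_form_def using assms by (intro sum.cong refl arg_cong2[where f = "(*)"]) auto

lemma stress_form_commute:
  assumes "\<And>i j. w i j = w j i"
  shows "stress_form n w f g = stress_form n w g f"
proof -
  have "stress_form n w f g - stress_form n w g f = (\<Sum>i<n. \<Sum>j<n. w i j * (g i * f j - f i * g j))"
    unfolding stress_form_def sum_distrib_left sum_subtractf[symmetric]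
    by (intro sum.cong refl) (simp add: algebra_simps)
  also have "\<dots> = 0"
  proof (rule antisymmetric_sum_zero)
    show "w j i * (g j * f i - f j * g i) = - (w i j * (g i * f j - f i * g j))" for i j
      by (simp add: assms[of j i] algebra_simps)
  qed
  finally show ?thesis by simp
qed

definition affine_on :: "nat \<Rightarrow> (nat \<Rightarrow> real^2) \<Rightarrow> (nat \<Rightarrow> real) \<Rightarrow> bool" where
  "affine_on n p f \<longleftrightarrow> (\<exists>c v. \<forall>j<n. f j = c + inner v (p j))"

text \<open>Equilibrium says that the coordinate functions are in the kernel of the stress matrix.\<close>

lemma affine_on_kernel:
  assumes bal: "balanced n w p" and f: "affine_on n p f" and i: "i < n"
  shows "(\<Sum>j<n. w i j * (f i - f j)) = 0"
proof -
  obtain c v where cv: "\<And>j. j < n \<Longrightarrow> f j = c + inner v (p j)" using f by (auto simp: affine_on_def)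
  have "(\<Sum>j<n. w i j * (f i - f j)) = (\<Sum>j<n. inner v (w i j *\<^sub>R (p i - p j)))"
    using cv i by (intro sum.cong refl) (simp add: inner_diff_right)
  also have "\<dots> = inner v (\<Sum>j<n. w i j *\<^sub>R (p i - p j))" by (simp add: inner_sum_right)
  also have "\<dots> = 0" using bal i by (simp add: balanced_def)
  finally show ?thesis .
qed

lemma stress_form_affine:
  assumes "balanced n w p" "affine_on n p g"
  shows "stress_form n w f g = 0"
  unfolding stress_form_def using affine_on_kernel[OF assms] by simp

lemma affine_on_add_scale:
  assumes "affine_on n p f" "affine_on n p g"
  shows "affine_on n p (\<lambda>i. f i + c * g i)"
proof -
  obtain a v b u where "\<And>j. j < n \<Longrightarrow> f j = a + inner v (p j)" "\<And>j. j < n \<Longrightarrow> g j = b + inner u (p j)"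
    using assms unfolding affine_on_def by metis
  then show ?thesis unfolding affine_on_def
    by (intro exI[of _ "a + c * b"] exI[of _ "v + c *\<^sub>R u"])
      (simp add: algebra_simps inner_add_left)
qed

lemma affine_on_orient: "affine_on n p (\<lambda>j. s * orient a (p j) b)"
  unfolding affine_on_def
proof (intro exI allI impI)
  fix j
  show "s * orient a (p j) b = s * cross (b - a) a + inner (s *\<^sub>R perp (a - b)) (p j)"
    by (simp add: inner_perp orient_def cross_def algebra_simps)
qed

text \<open>Only edges between the two supports contribute, and these are braces.\<close>

lemma stress_form_separated:
  assumes neg: "braces_nonpos n w"
    and f: "\<And>i. i < n \<Longrightarrow> 0 \<le> f i" and g: "\<And>i. i < n \<Longrightarrow> 0 \<le> g i"
    and sep: "\<And>i j. \<lbrakk>i < n; j < n; f i \<noteq> 0; g j \<noteq> 0\<rbrakk> \<Longrightarrow> i \<noteq> j \<and> {i, j} \<notin> boundary_edges n"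
  shows "0 \<le> stress_form n w f g"
    and "\<lbrakk>i < n; j < n; 0 < f i; 0 < g j; w i j < 0\<rbrakk> \<Longrightarrow> 0 < stress_form n w f g"
proof -
  have form: "stress_form n w f g = (\<Sum>i<n. \<Sum>j<n. f i * (w i j * (g i - g j)))"
    by (simp add: stress_form_def sum_distrib_left)
  have ge: "0 \<le> f i * (w i j * (g i - g j))" if ij: "i < n" "j < n" for i j
  proof (cases "f i = 0 \<or> g j = 0")
    case True
    then show ?thesis
    proof (cases "f i = 0")
      case False
      then have "g i = 0" using sep[of i i] ij by auto
      then show ?thesis using True False by simp
    qed simp
  next
    case False
    then have "g i = 0" "w i j \<le> 0"
      using sep[of i i] sep[of i j] ij neg unfolding braces_nonpos_def by auto
    then show ?thesis using f[OF ij(1)] g[OF ij(2)] by (simp add: mult_nonneg_nonpos mult_nonpos_nonneg)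
  qed
  then show "0 \<le> stress_form n w f g" unfolding form by (intro sum_nonneg) auto
  assume ij: "i < n" "j < n" "0 < f i" "0 < g j" "w i j < 0"
  then have "g i = 0" using sep[of i i] by auto
  then have "0 < f i * (w i j * (g i - g j))" using ij by (simp add: mult_pos_neg mult_neg_pos)
  also have "\<dots> \<le> (\<Sum>j<n. f i * (w i j * (g i - g j)))"
    using ij ge by (intro member_le_sum) auto
  also have "\<dots> \<le> (\<Sum>i<n. \<Sum>j<n. f i * (w i j * (g i - g j)))"
  proof (rule member_le_sum)
    show "0 \<le> (\<Sum>j<n. f i * (w i j * (g i - g j)))" if "i \<in> {..<n} - {i'}" for i i'
      using ge that by (intro sum_nonneg) auto
  qed (use ij in auto)
  finally show "0 < stress_form n w f g" by (simp add: form)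
qed

lemma stress_form_zero: "stress_form n w (\<lambda>i. 0) g = 0" "stress_form n w f (\<lambda>i. 0) = 0"
  by (simp_all add: stress_form_def)

text \<open>The analytic form of 3-connectivity: every chord is crossed by a brace with negative stress.\<close>

definition covers_chords :: "nat \<Rightarrow> (nat \<Rightarrow> nat \<Rightarrow> real) \<Rightarrow> bool" where
  "covers_chords n w \<longleftrightarrow> (\<forall>u v. chord n u v \<longrightarrow>
    (\<exists>i j. u < i \<and> i < v \<and> j < n \<and> (j < u \<or> v < j) \<and> w i j < 0))"

lemma outside_inside_not_boundary:
  assumes "u < i" "i < v" "v < n" "j < u \<or> v < j" "j < n"
  shows "{j, i} \<notin> boundary_edges n" "{i, j} \<notin> boundary_edges n"
proof -
  have "i \<noteq> (j + 1) mod n" using assms by (cases "j + 1 = n") auto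
  moreover have "j \<noteq> (i + 1) mod n" using assms by (cases "i + 1 = n") auto
  ultimately show "{j, i} \<notin> boundary_edges n" "{i, j} \<notin> boundary_edges n"
    using boundary_edge_iff[of j n i] boundary_edge_iff[of i n j] assms by auto
qed

text \<open>A nonnegative function that vanishes at \<open>k\<close> is the sum of its restrictions to the two arcs on either side of \<open>k\<close>.
No side of the polygon joins these arcs, so the product of the two parts is nonnegative.\<close>

lemma stress_form_split:
  assumes neg: "braces_nonpos n w" and uv: "v < n" "u < k" "k < v"
    and ge: "\<And>i. 0 \<le> r i" and supp: "\<And>i. \<not> (u < i \<and> i < v) \<Longrightarrow> r i = 0" and rk: "r k = 0"
    and left: "\<And>f m. \<lbrakk>\<And>i. 0 \<le> f i; \<And>i. \<not> (u < i \<and> i < k) \<Longrightarrow> f i = 0; f m \<noteq> 0\<rbrakk> \<Longrightarrow> 0 < stress_form n w f f"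
    and right: "\<And>f m. \<lbrakk>\<And>i. 0 \<le> f i; \<And>i. \<not> (k < i \<and> i < v) \<Longrightarrow> f i = 0; f m \<noteq> 0\<rbrakk> \<Longrightarrow> 0 < stress_form n w f f"
  shows "0 \<le> stress_form n w r r" and "r m \<noteq> 0 \<Longrightarrow> 0 < stress_form n w r r"
proof -
  have sym: "w i j = w j i" for i j using neg by (simp add: braces_nonpos_def)
  define a where "a j = (if j < k then r j else 0)" for j
  define b where "b j = (if k < j then r j else 0)" for j
  have rab: "r j = a j + b j" for j using rk by (cases j k rule: linorder_cases) (auto simp: a_def b_def)
  have age: "0 \<le> a j" "0 \<le> b j" for j using ge by (auto simp: a_def b_def)
  have asupp: "a j = 0" if "\<not> (u < j \<and> j < k)" for j using supp[of j] that uv by (auto simp: a_def)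
  have bsupp: "b j = 0" if "\<not> (k < j \<and> j < v)" for j using supp[of j] that uv by (auto simp: b_def)
  have aa: "0 < stress_form n w a a" if "a j \<noteq> 0" for j by (rule left[where f = a and m = j, OF age(1) asupp that])
  have bb: "0 < stress_form n w b b" if "b j \<noteq> 0" for j by (rule right[where f = b and m = j, OF age(2) bsupp that])
  have nonneg: "0 \<le> stress_form n w f f" if "\<And>j. f j \<noteq> 0 \<Longrightarrow> 0 < stress_form n w f f" for f
  proof (cases "\<exists>j. f j \<noteq> 0")
    case False
    then have "f = (\<lambda>j. 0)" by auto
    then show ?thesis by (simp add: stress_form_zero)
  qed (use that less_imp_le in blast)
  have ab: "0 \<le> stress_form n w a b"
  proof (rule stress_form_separated(1)[OF neg age])
    show "i \<noteq> j \<and> {i, j} \<notin> boundary_edges n" if "i < n" "j < n" "a i \<noteq> 0" "b j \<noteq> 0" for i j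
    proof -
      have "u < i" "i < k" "k < j" using asupp[of i] bsupp[of j] that(3,4) by blast+
      then show ?thesis using outside_inside_not_boundary(2)[of u i k n j] that uv by auto
    qed
  qed
  have eq: "stress_form n w r r = stress_form n w a a + stress_form n w b b + 2 * stress_form n w a b"
    unfolding rab[abs_def]
    by (simp add: stress_form_left stress_form_right stress_form_commute[of w n b a, OF sym])
  have aa0: "0 \<le> stress_form n w a a" using aa by (rule nonneg)
  have bb0: "0 \<le> stress_form n w b b" using bb by (rule nonneg)
  show "0 \<le> stress_form n w r r" unfolding eq using aa0 bb0 ab by linarith
  assume "r m \<noteq> 0"
  then have "a m \<noteq> 0 \<or> b m \<noteq> 0" using rab[of m] by auto
  then show "0 < stress_form n w r r"
    unfolding eq using aa[of m] bb[of m] aa0 bb0 ab by (elim disjE) linarith+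
qed

text \<open>Let \<open>g\<close> be the affine function that vanishes on the chord \<open>uv\<close> and is positive on its arc. The fold \<open>F\<close>
of \<open>g\<close> along the chord agrees with \<open>g\<close> on the arc and is zero elsewhere. As \<open>g\<close> is in
the kernel of the form, \<open>F\<close> may be traded for \<open>G = F - g\<close>, which is nonnegative and supported on the opposite
arc; so \<open>F\<close> has a nonnegative product with every nonnegative function on the arc, and a positive one with itself.
Subtract from \<open>f\<close> the largest multiple of \<open>F\<close> that leaves the remainder \<open>r\<close> nonnegative. Then \<open>r\<close> vanishes at
some \<open>k\<close> on the arc, and the induction applies on the shorter arcs \<open>uk\<close> and \<open>kv\<close>. Iterated, this writes
\<open>f\<close> as a nonnegative combination of folds along pairwise noncrossing chords.\<close>

lemma arc_function_energy_pos:
  assumes pos: "convex_position s n p" and bal: "balanced n w p"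
    and neg: "braces_nonpos n w" and cov: "covers_chords n w"
  shows "\<lbrakk>u < v; v < n; \<not> (u = 0 \<and> v = n - 1); \<And>i. 0 \<le> f i; \<And>i. \<not> (u < i \<and> i < v) \<Longrightarrow> f i = 0;
    f m \<noteq> 0\<rbrakk> \<Longrightarrow> 0 < stress_form n w f f"
proof (induction "v - u" arbitrary: u v f m rule: less_induct)
  case less
  have m: "u < m" "m < v" using less.prems(5,6) by blast+
  define I where "I = {u<..<v}"
  have I: "finite I" "m \<in> I" "I \<noteq> {}" using m by (auto simp: I_def)
  have sym: "w i j = w j i" for i j using neg by (simp add: braces_nonpos_def)
  have uv: "chord n u v" using less.prems m by (auto simp: chord_def)
  define g where "g j = s * orient (p u) (p j) (p v)" for j
  have gpos: "0 < g j" if "j \<in> I" for j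
    using pos that less.prems(2) unfolding g_def I_def convex_position_def by simp
  have gneg: "g j < 0" if "j < n" "j < u \<or> v < j" for j
  proof -
    have "cyclic u v j" using that less.prems(1) by (auto simp: cyclic_def)
    then have "0 < s * orient (p u) (p v) (p j)"
      using convex_position_cyclic[OF pos] less.prems that by simp
    then show ?thesis by (simp add: g_def orient_swap[of "p u" "p j" "p v"])
  qed
  have gaff: "affine_on n p g" unfolding g_def by (rule affine_on_orient)
  define F where "F j = (if j \<in> I then g j else 0)" for j
  define G where "G j = (if j < u \<or> v < j then - g j else 0)" for j
  have FgG: "F j = g j + G j" if "j < n" for j
  proof -
    have "g u = 0" "g v = 0" by (simp_all add: g_def)
    moreover have "j = u \<or> j = v \<or> j \<in> I \<or> (j < u \<or> v < j)" by (auto simp: I_def)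
    ultimately show ?thesis using less.prems(1) by (auto simp: F_def G_def I_def)
  qed
  have FG: "stress_form n w F h = stress_form n w G h" for h
  proof -
    have "stress_form n w F h = stress_form n w (\<lambda>j. g j + G j) h"
      using FgG by (intro stress_form_cong) auto
    also have "\<dots> = stress_form n w h g + stress_form n w G h"
      by (simp add: stress_form_left stress_form_commute[of w n g h, OF sym])
    finally show ?thesis using stress_form_affine[OF bal gaff] by simp
  qed
  have Gsep: "i \<noteq> j \<and> {i, j} \<notin> boundary_edges n"
    if "i < n" "j < n" "G i \<noteq> 0" "j \<in> I" for i j
    using that outside_inside_not_boundary[of u j v n i] less.prems(2)
    by (auto simp: G_def I_def split: if_splits)
  have Gge: "0 \<le> G j" if "j < n" for j using gneg[OF that] by (auto simp: G_def)
  have Fh: "0 \<le> stress_form n w F h" if h: "\<And>i. 0 \<le> h i" "\<And>i. i \<notin> I \<Longrightarrow> h i = 0" for h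
    unfolding FG
  proof (rule stress_form_separated(1)[OF neg Gge h(1)])
    show "i \<noteq> j \<and> {i, j} \<notin> boundary_edges n" if "i < n" "j < n" "G i \<noteq> 0" "h j \<noteq> 0" for i j
      using Gsep[OF that(1-3)] h(2)[of j] that(4) by blast
  qed
  have Fge: "0 \<le> F j" for j using gpos[of j] by (auto simp: F_def)
  have FF: "0 < stress_form n w F F"
  proof -
    obtain i j where ij: "u < i" "i < v" "j < n" "j < u \<or> v < j" "w i j < 0"
      using cov uv unfolding covers_chords_def by blast
    have i: "i < n" "i \<in> I" using ij less.prems by (auto simp: I_def)
    show ?thesis unfolding FG
    proof (rule stress_form_separated(2)[OF neg Gge Fge _ ij(3) i(1)])
      show "i \<noteq> j \<and> {i, j} \<notin> boundary_edges n" if "i < n" "j < n" "G i \<noteq> 0" "F j \<noteq> 0" for i j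
        using Gsep[OF that(1-3)] that(4) by (auto simp: F_def split: if_splits)
      show "0 < G j" using gneg ij by (auto simp: G_def)
      show "0 < F i" using gpos i by (auto simp: F_def)
      show "w j i < 0" using ij sym by simp
    qed
  qed
  define \<alpha> where "\<alpha> = Min ((\<lambda>j. f j / g j) ` I)"
  have ale: "\<alpha> \<le> f j / g j" if "j \<in> I" for j
    unfolding \<alpha>_def using I that by (intro Min_le) auto
  have "\<alpha> \<in> (\<lambda>j. f j / g j) ` I" unfolding \<alpha>_def using I by (intro Min_in) auto
  then obtain k where k: "k \<in> I" "\<alpha> = f k / g k" by auto
  have a0: "0 \<le> \<alpha>" using k gpos[of k] less.prems(4)[of k] by simp
  define r where "r j = f j - \<alpha> * F j" for j
  have r0: "r j = 0" if "j \<notin> I" for j using that less.prems(5)[of j] by (auto simp: r_def F_def I_def)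
  have rk: "r k = 0" using k gpos[of k] by (simp add: r_def F_def)
  have rge: "0 \<le> r j" for j
  proof (cases "j \<in> I")
    case True
    then show ?thesis using ale[OF True] gpos[OF True] by (simp add: r_def F_def pos_le_divide_eq)
  qed (simp add: r0)
  have ku: "u < k" "k < v" using k by (auto simp: I_def)
  have rsupp: "r i = 0" if "\<not> (u < i \<and> i < v)" for i using r0[of i] that by (simp add: I_def)
  have left: "0 < stress_form n w h h" if "\<And>i. 0 \<le> h i" "\<And>i. \<not> (u < i \<and> i < k) \<Longrightarrow> h i = 0" "h l \<noteq> 0" for h l
    by (rule less.hyps[of k u h l]) (use ku less.prems that in auto)
  have right: "0 < stress_form n w h h" if "\<And>i. 0 \<le> h i" "\<And>i. \<not> (k < i \<and> i < v) \<Longrightarrow> h i = 0" "h l \<noteq> 0" for h l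
    by (rule less.hyps[of v k h l]) (use ku less.prems that in auto)
  note split = stress_form_split[where r = r, OF neg less.prems(2) ku]
  have rr0: "0 \<le> stress_form n w r r" using rge rsupp rk left right by (rule split(1))
  have rr: "0 < stress_form n w r r" if "r l \<noteq> 0" for l using rge rsupp rk left right that by (rule split(2))
  have Fr: "0 \<le> stress_form n w F r" using rge r0 by (rule Fh)
  have f: "f j = \<alpha> * F j + r j" for j by (simp add: r_def)
  have "stress_form n w f f = \<alpha> * (\<alpha> * stress_form n w F F) + 2 * (\<alpha> * stress_form n w F r) + stress_form n w r r"
    unfolding f[abs_def]
    by (simp add: stress_form_left stress_form_right stress_form_commute[of w n r F, OF sym] algebra_simps)
  moreover have "0 \<le> \<alpha> * stress_form n w F r" using a0 Fr by simp
  moreover have "0 < \<alpha> * (\<alpha> * stress_form n w F F) + stress_form n w r r"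
  proof (cases "\<alpha> = 0")
    case True
    then show ?thesis using rr[of m] f[of m] less.prems(6) by simp
  next
    case False
    then have "0 < \<alpha> * (\<alpha> * stress_form n w F F)" using a0 FF by simp
    then show ?thesis using rr0 by linarith
  qed
  ultimately show ?case by linarith
qed

text \<open>Subtract from \<open>f\<close> the affine function that agrees with it at \<open>0\<close>, at \<open>n - 1\<close> and at a third
vertex \<open>k\<close> and is below it elsewhere. The rest is a sum of two nonnegative functions on the arcs on
either side of \<open>k\<close>.\<close>

lemma stress_form_psd:
  assumes pos: "convex_position s n p" and n: "3 \<le> n" and bal: "balanced n w p"
    and neg: "braces_nonpos n w" and cov: "covers_chords n w"
  shows "0 \<le> stress_form n w f f" and "stress_form n w f f = 0 \<Longrightarrow> affine_on n p f"
proof -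
  have sym: "w i j = w j i" for i j using neg by (simp add: braces_nonpos_def)
  define d where "d = p (n - 1) - p 0"
  have d: "d \<noteq> 0" using inj_onD[OF inj_on_convex_position[OF pos n], of "n - 1" 0] n by (auto simp: d_def)
  define L where "L j = f 0 + (f (n - 1) - f 0) / inner d d * inner d (p j - p 0)" for j
  have L: "L 0 = f 0" "L (n - 1) = f (n - 1)"
    using d by (simp_all only: L_def d_def[symmetric] inner_eq_zero_iff diff_self inner_zero_right) simp_all
  have Laff: "affine_on n p L" unfolding affine_on_def
  proof (intro exI allI impI)
    fix j
    show "L j = (f 0 - (f (n - 1) - f 0) / inner d d * inner d (p 0)) +
        inner (((f (n - 1) - f 0) / inner d d) *\<^sub>R d) (p j)"
      by (simp add: L_def inner_diff_right right_diff_distrib)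
  qed
  define I where "I = {0<..<n - 1}"
  have "1 \<in> I" using n by (simp add: I_def)
  then have I: "finite I" "I \<noteq> {}" by (auto simp: I_def)
  define g where "g j = s * orient (p 0) (p j) (p (n - 1))" for j
  have gpos: "0 < g j" if "j \<in> I" for j
    using pos that n unfolding g_def I_def convex_position_def by simp
  define \<alpha> where "\<alpha> = Min ((\<lambda>j. (f j - L j) / g j) ` I)"
  have ale: "\<alpha> \<le> (f j - L j) / g j" if "j \<in> I" for j
    unfolding \<alpha>_def using I that by (intro Min_le) auto
  have "\<alpha> \<in> (\<lambda>j. (f j - L j) / g j) ` I" unfolding \<alpha>_def using I by (intro Min_in) auto
  then obtain k where k: "k \<in> I" "\<alpha> = (f k - L k) / g k" by auto
  define h where "h j = L j + \<alpha> * g j" for j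
  have haff: "affine_on n p h" unfolding h_def
    by (rule affine_on_add_scale[OF Laff]) (auto simp: g_def[abs_def] affine_on_orient)
  define r where "r j = (if j \<in> I then f j - h j else 0)" for j
  have fr: "f j = h j + r j" if "j < n" for j
  proof (cases "j \<in> I")
    case False
    then have "j = 0 \<or> j = n - 1" using that by (auto simp: I_def)
    then show ?thesis using L False by (auto simp: r_def h_def g_def)
  qed (simp add: r_def)
  have rk: "r k = 0" using k gpos[of k] by (simp add: r_def h_def)
  have rge: "0 \<le> r j" for j
    using ale[of j] gpos[of j] by (auto simp: r_def h_def pos_le_divide_eq)
  have ku: "0 < k" "k < n - 1" "n - 1 < n" using k n by (auto simp: I_def)
  have rsupp: "r i = 0" if "\<not> (0 < i \<and> i < n - 1)" for i using that by (auto simp: r_def I_def)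
  have left: "0 < stress_form n w h h" if "\<And>i. 0 \<le> h i" "\<And>i. \<not> (0 < i \<and> i < k) \<Longrightarrow> h i = 0" "h l \<noteq> 0" for h l
    by (rule arc_function_energy_pos[OF pos bal neg cov, of 0 k h l]) (use ku that in auto)
  have right: "0 < stress_form n w h h" if "\<And>i. 0 \<le> h i" "\<And>i. \<not> (k < i \<and> i < n - 1) \<Longrightarrow> h i = 0" "h l \<noteq> 0" for h l
    by (rule arc_function_energy_pos[OF pos bal neg cov, of k "n - 1" h l]) (use ku that in auto)
  note split = stress_form_split[where r = r, OF neg ku(3,1,2)]
  have rr0: "0 \<le> stress_form n w r r" using rge rsupp rk left right by (rule split(1))
  have rr: "0 < stress_form n w r r" if "r l \<noteq> 0" for l using rge rsupp rk left right that by (rule split(2))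
  have "stress_form n w f f = stress_form n w (\<lambda>j. h j + r j) (\<lambda>j. h j + r j)"
    using fr by (intro stress_form_cong) auto
  also have "\<dots> = stress_form n w r r"
    by (simp add: stress_form_left stress_form_right stress_form_affine[OF bal haff]
        stress_form_commute[of w n h, OF sym])
  finally have eq: "stress_form n w f f = stress_form n w r r" .
  show "0 \<le> stress_form n w f f" unfolding eq by (rule rr0)
  assume "stress_form n w f f = 0"
  then have "r j = 0" for j using rr[of j] eq by (metis less_irrefl)
  then have "f j = h j" if "j < n" for j using fr[OF that] by simp
  then show "affine_on n p f" using haff by (auto simp: affine_on_def)
qed

section \<open>The rank of the stress matrix and super stability\<close>

text \<open>A linear dependency between the columns outside \<open>T\<close> is a kernel vector that vanishes on \<open>T\<close>.\<close>

lemma rank_ge_of_kernel: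
  fixes M :: "real mat"
  assumes M: "M \<in> carrier_mat n n" and T: "T \<subseteq> {..<n}"
    and ker: "\<And>x. \<lbrakk>\<And>j. j \<in> T \<Longrightarrow> x j = 0; \<And>i. i < n \<Longrightarrow> (\<Sum>j<n. M $$ (i, j) * x j) = 0\<rbrakk> \<Longrightarrow> \<forall>j<n. x j = (0 :: real)"
  shows "n \<le> vec_space.rank n M + card T"
proof -
  interpret vec_space "TYPE(real)" n .
  define J where "J = {..<n} - T"
  have J: "J \<subseteq> {..<n}" "finite J" by (auto simp: J_def)
  have entry: "vec_index (col M j) i = M $$ (i, j)" if "i < n" "j < n" for i j
    using that M by simp
  have sumJ: "(\<Sum>j<n. M $$ (i, j) * x j) = (\<Sum>j\<in>J. M $$ (i, j) * x j)"
    if "\<And>j. j \<notin> J \<Longrightarrow> x j = 0" for x i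
    using that J by (intro sum.mono_neutral_right) auto
  have inj: "inj_on (col M) J"
  proof (rule inj_onI, rule ccontr)
    fix a b assume ab: "a \<in> J" "b \<in> J" "col M a = col M b" "a \<noteq> b"
    define x where "x j = (if j = a then 1 else if j = b then -1 else 0 :: real)" for j
    have "(\<Sum>j<n. M $$ (i, j) * x j) = 0" if i: "i < n" for i
    proof -
      have "(\<Sum>j<n. M $$ (i, j) * x j) = (\<Sum>j\<in>{a, b}. M $$ (i, j) * x j)"
        using ab J by (intro sum.mono_neutral_right) (auto simp: x_def)
      also have "\<dots> = M $$ (i, a) - M $$ (i, b)" using ab(4) by (simp add: x_def)
      also have "\<dots> = 0"
      proof -
        have "a < n" "b < n" using ab J by auto
        then show ?thesis using entry[OF i, of a] entry[OF i, of b] ab(3) by simp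
      qed
      finally show ?thesis .
    qed
    moreover have "x j = 0" if "j \<in> T" for j using that ab by (auto simp: x_def J_def)
    ultimately have "x a = 0" using ker[of x] ab J by blast
    then show False by (simp add: x_def)
  qed
  have U: "col M ` J \<subseteq> set (cols M)"
    using J M by (auto simp: cols_def)
  have colsn: "set (cols M) \<subseteq> carrier_vec n" using cols_dim M by blast
  have "lin_indpt (col M ` J)"
  proof
    assume "lin_dep (col M ` J)"
    then obtain c v where c: "lincomb c (col M ` J) = 0\<^sub>v n" "v \<in> col M ` J" "c v \<noteq> 0"
      using finite_lin_dep[of "col M ` J"] J U colsn by (metis finite_imageI order_trans)
    define x where "x j = (if j \<in> J then c (col M j) else 0)" for j
    have "(\<Sum>j<n. M $$ (i, j) * x j) = 0" if i: "i < n" for i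
    proof -
      have "(\<Sum>j<n. M $$ (i, j) * x j) = (\<Sum>j\<in>J. M $$ (i, j) * x j)"
        by (rule sumJ) (simp add: x_def)
      also have "\<dots> = (\<Sum>j\<in>J. c (col M j) * vec_index (col M j) i)"
        using entry[OF i] J by (intro sum.cong refl) (auto simp: x_def)
      also have "\<dots> = (\<Sum>v\<in>col M ` J. c v * vec_index v i)"
        using inj by (simp add: sum.reindex)
      also have "\<dots> = vec_index (lincomb c (col M ` J)) i"
        using lincomb_index[OF i, of "col M ` J" c] U colsn by simp
      finally show ?thesis using c(1) i by simp
    qed
    moreover have "x j = 0" if "j \<in> T" for j using that by (auto simp: x_def J_def)
    ultimately have "\<forall>j<n. x j = 0" using ker[of x] by blast
    then show False using c(2,3) J by (auto simp: x_def)
  qed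
  then have "card (col M ` J) \<le> rank M" by (rule rank_ge_card_indpt[OF M U])
  moreover have "card (col M ` J) = n - card T"
    using inj T finite_subset[OF T] by (simp add: card_image J_def card_Diff_subset)
  ultimately show ?thesis by linarith
qed

text \<open>Let \<open>S\<close> be a maximal independent set of columns. If there were more kernel vectors \<open>k t\<close> than columns outside
\<open>S\<close>, then a nontrivial combination of the \<open>k t\<close> would vanish at the latter, and it would be a dependency
between the columns in \<open>S\<close>.\<close>

lemma rank_le_of_kernel:
  fixes M :: "real mat" and k :: "'t \<Rightarrow> nat \<Rightarrow> real"
  assumes M: "M \<in> carrier_mat n n" and T: "finite T"
    and ker: "\<And>t i. \<lbrakk>t \<in> T; i < n\<rbrakk> \<Longrightarrow> (\<Sum>j<n. M $$ (i, j) * k t j) = 0"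
    and indep: "\<And>c. (\<And>j. j < n \<Longrightarrow> (\<Sum>t\<in>T. c t * k t j) = 0) \<Longrightarrow> \<forall>t\<in>T. c t = (0 :: real)"
  shows "vec_space.rank n M + card T \<le> n"
proof (rule ccontr)
  assume "\<not> vec_space.rank n M + card T \<le> n"
  interpret vec_space "TYPE(real)" n .
  have rk: "n < rank M + card T" using \<open>\<not> vec_space.rank n M + card T \<le> n\<close> by simp
  have colsn: "set (cols M) \<subseteq> carrier_vec n" using cols_dim M by blast
  have "lin_indpt {}" by (simp add: lin_dep_def)
  then obtain S where S: "maximal S (\<lambda>T. T \<subseteq> set (cols M) \<and> lin_indpt T)"
    using maximal_exists_superset[of "set (cols M)" "\<lambda>T. T \<subseteq> set (cols M) \<and> lin_indpt T" "{}"] by auto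
  then have S': "S \<subseteq> set (cols M)" "lin_indpt S" "finite S" "rank M = card S"
    using rank_card_indpt[OF M S] finite_subset[of S "set (cols M)"] by (auto simp: maximal_def)
  have "\<exists>j<n. col M j = v" if "v \<in> S" for v
  proof -
    have "v \<in> col M ` {0..<n}" using that S'(1) M by (auto simp: cols_def)
    then show ?thesis by auto
  qed
  then obtain ix where ix: "\<And>v. v \<in> S \<Longrightarrow> ix v < n" "\<And>v. v \<in> S \<Longrightarrow> col M (ix v) = v" by metis
  have injix: "inj_on ix S" using ix(2) by (metis inj_onI)
  define C where "C = {..<n} - ix ` S"
  have "card C = n - card S"
    using ix(1) injix S'(3) unfolding C_def by (subst card_Diff_subset) (auto simp: card_image)
  moreover have "card S \<le> n"
    using card_mono[of "{..<n}" "ix ` S"] ix(1) injix by (auto simp: card_image)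
  ultimately have "card C < card T" using rk S'(4) by linarith
  moreover have fC: "finite C" by (simp add: C_def)
  ultimately obtain c where c: "\<exists>t\<in>T. c t \<noteq> 0" "\<And>j. j \<in> C \<Longrightarrow> (\<Sum>t\<in>T. k t j * c t) = 0"
    using homogeneous_system_solution[OF fC T, of "\<lambda>j t. k t j"] by metis
  define x where "x j = (\<Sum>t\<in>T. c t * k t j)" for j
  have xC: "x j = 0" if "j \<in> C" for j using c(2)[OF that] by (simp add: x_def mult.commute)
  have Mx: "(\<Sum>j<n. M $$ (i, j) * x j) = 0" if i: "i < n" for i
  proof -
    have "(\<Sum>j<n. M $$ (i, j) * x j) = (\<Sum>j<n. \<Sum>t\<in>T. c t * (M $$ (i, j) * k t j))"
      by (simp add: x_def sum_distrib_left mult.left_commute)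
    also have "\<dots> = (\<Sum>t\<in>T. c t * (\<Sum>j<n. M $$ (i, j) * k t j))"
      by (subst sum.swap) (simp add: sum_distrib_left)
    finally show ?thesis using ker i by simp
  qed
  have "lincomb (\<lambda>v. x (ix v)) S = 0\<^sub>v n"
  proof (rule eq_vecI)
    show "dim_vec (lincomb (\<lambda>v. x (ix v)) S) = dim_vec (0\<^sub>v n)"
      using lincomb_dim[of S "\<lambda>v. x (ix v)"] S' colsn by auto
    fix i assume "i < dim_vec (0\<^sub>v n)"
    then have i: "i < n" by simp
    have "vec_index (lincomb (\<lambda>v. x (ix v)) S) i = (\<Sum>v\<in>S. x (ix v) * vec_index v i)"
      using lincomb_index[OF i, of S] S' colsn by simp
    also have "\<dots> = (\<Sum>v\<in>S. M $$ (i, ix v) * x (ix v))"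
    proof (intro sum.cong refl)
      fix v assume v: "v \<in> S"
      then have "vec_index v i = vec_index (col M (ix v)) i" using ix(2) by simp
      also have "\<dots> = M $$ (i, ix v)" using ix(1)[OF v] i M by simp
      finally show "x (ix v) * vec_index v i = M $$ (i, ix v) * x (ix v)" by simp
    qed
    also have "\<dots> = (\<Sum>j\<in>ix ` S. M $$ (i, j) * x j)" using injix by (simp add: sum.reindex)
    also have "\<dots> = (\<Sum>j<n. M $$ (i, j) * x j)"
      using ix(1) xC by (intro sum.mono_neutral_left) (auto simp: C_def)
    finally show "vec_index (lincomb (\<lambda>v. x (ix v)) S) i = vec_index (0\<^sub>v n) i" using Mx i by simp
  qed
  then have lc: "lincomb (\<lambda>v. x (ix v)) S = 0\<^sub>v n" .
  have "x (ix v) = 0" if v: "v \<in> S" for v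
  proof (rule ccontr)
    assume "x (ix v) \<noteq> 0"
    have "(\<lambda>v. x (ix v)) \<in> S \<rightarrow> UNIV" by blast
    then have "lin_dep S"
      using lin_dep_crit[OF S'(3) subset_refl _ v \<open>x (ix v) \<noteq> 0\<close> lc] by blast
    then show False using S'(2) by simp
  qed
  then have all0: "x j = 0" if "j < n" for j using xC[of j] that by (cases "j \<in> ix ` S") (auto simp: C_def)
  have "\<forall>t\<in>T. c t = 0"
    by (rule indep) (use all0 in \<open>simp only: x_def\<close>)
  then show False using c(1) by blast
qed

lemma stress_matrix_apply:
  assumes i: "i < n"
  shows "(\<Sum>j<n. stress_matrix n E \<omega> $$ (i, j) * x j) = (\<Sum>j<n. stress_coeff E \<omega> i j * (x i - x j))"
proof -
  have "(\<Sum>j<n. stress_matrix n E \<omega> $$ (i, j) * x j) =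
      stress_matrix n E \<omega> $$ (i, i) * x i + (\<Sum>j\<in>{..<n} - {i}. stress_matrix n E \<omega> $$ (i, j) * x j)"
    using i by (intro sum.remove) auto
  also have "\<dots> = (\<Sum>j\<in>{..<n} - {i}. stress_coeff E \<omega> i j) * x i + (\<Sum>j\<in>{..<n} - {i}. - stress_coeff E \<omega> i j * x j)"
    using i by (intro arg_cong2[where f = "(+)"] sum.cong refl) (auto simp: stress_matrix_def)
  also have "\<dots> = (\<Sum>j\<in>{..<n} - {i}. stress_coeff E \<omega> i j * (x i - x j))"
    by (simp add: sum_distrib_right right_diff_distrib sum_subtractf sum_negf)
  also have "\<dots> = (\<Sum>j<n. stress_coeff E \<omega> i j * (x i - x j))"
    by (rule sum.mono_neutral_left) auto
  finally show ?thesis .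
qed

lemma stress_matrix_quadratic:
  assumes "v \<in> carrier_vec n"
  shows "scalar_prod v (stress_matrix n E \<omega> *\<^sub>v v) =
    stress_form n (stress_coeff E \<omega>) (vec_index v) (vec_index v)"
proof -
  have dim: "dim_row (stress_matrix n E \<omega>) = n" "dim_col (stress_matrix n E \<omega>) = n"
    by (simp_all add: stress_matrix_def)
  have "vec_index (stress_matrix n E \<omega> *\<^sub>v v) i =
      (\<Sum>j<n. stress_coeff E \<omega> i j * (vec_index v i - vec_index v j))" if i: "i < n" for i
  proof -
    have "vec_index (stress_matrix n E \<omega> *\<^sub>v v) i = (\<Sum>j<n. stress_matrix n E \<omega> $$ (i, j) * vec_index v j)"
      using i assms dim by (simp add: scalar_prod_def lessThan_atLeast0)
    then show ?thesis by (simp only: stress_matrix_apply[OF i])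
  qed
  then show ?thesis
    using dim by (simp add: scalar_prod_def stress_form_def lessThan_atLeast0)
qed

lemma affine_vanishing:
  fixes p :: "nat \<Rightarrow> real^2"
  assumes o: "orient (p 0) (p 1) (p 2) \<noteq> 0" and aff: "affine_on n p f" and n: "3 \<le> n"
    and zero: "f 0 = 0" "f 1 = 0" "f 2 = 0" and j: "j < n"
  shows "f j = 0"
proof -
  obtain c v where cv: "\<And>j. j < n \<Longrightarrow> f j = c + inner v (p j)" using aff by (auto simp: affine_on_def)
  have "inner v (p 1 - p 0) = 0" "inner v (p 2 - p 0) = 0"
    using cv[of 0] cv[of 1] cv[of 2] zero n by (simp_all add: inner_diff_right)
  then have "cross (perp v) (p 1 - p 0) = 0" "cross (perp v) (p 2 - p 0) = 0"
    by (simp_all add: cross_def perp_def inner_plane)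
  then have "cross (p 1 - p 0) (perp v) = 0" "cross (p 2 - p 0) (perp v) = 0"
    by (simp_all add: cross_def algebra_simps)
  then have "perp v = 0" using cross_both_zero o unfolding orient_def by blast
  then have "v = 0" by (simp add: perp_def plane_eq_iff)
  then show ?thesis using cv[of j] cv[of 0] zero n j by simp
qed

lemma affine_independent_family:
  fixes p :: "nat \<Rightarrow> real^2" and n :: nat
  assumes o: "orient (p 0) (p 1) (p 2) \<noteq> 0" and n: "3 \<le> n"
    and zero: "\<And>j. j < n \<Longrightarrow> c + a * (p j)$1 + b * (p j)$2 = 0"
  shows "c = 0 \<and> a = 0 \<and> b = 0"
proof -
  define v where "v = (vector [a, b] :: real^2)"
  have "inner v (p j) = a * (p j)$1 + b * (p j)$2" for j by (simp add: v_def inner_plane)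
  then have e: "c + inner v (p j) = 0" if "j < n" for j using zero[OF that] by simp
  have "inner v (p 1) = inner v (p 0)" "inner v (p 2) = inner v (p 0)"
    using e[of 0] e[of 1] e[of 2] n by simp_all
  then have "inner v (p 1 - p 0) = 0" "inner v (p 2 - p 0) = 0"
    by (simp_all add: inner_diff_right)
  then have "cross (p 1 - p 0) (perp v) = 0" "cross (p 2 - p 0) (perp v) = 0"
    by (simp_all add: cross_def perp_def inner_plane algebra_simps)
  then have "perp v = 0" using cross_both_zero o unfolding orient_def by blast
  then have "a = 0 \<and> b = 0" by (simp add: perp_def plane_eq_iff v_def)
  then show ?thesis using zero[of 0] n by simp
qed

lemma affine_on_coordinate: "affine_on n p (\<lambda>j. (p j)$1)" "affine_on n p (\<lambda>j. (p j)$2)"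
  "affine_on n p (\<lambda>j. c)"
proof -
  show "affine_on n p (\<lambda>j. (p j)$1)" unfolding affine_on_def
    by (rule exI[of _ 0], rule exI[of _ "vector [1, 0]"]) (simp add: inner_plane)
  show "affine_on n p (\<lambda>j. (p j)$2)" unfolding affine_on_def
    by (rule exI[of _ 0], rule exI[of _ "vector [0, 1]"]) (simp add: inner_plane)
  show "affine_on n p (\<lambda>j. c)" unfolding affine_on_def
    by (rule exI[of _ c], rule exI[of _ 0]) simp
qed

text \<open>Moving \<open>f\<close> slightly in the direction of the \<open>i\<close>-th unit vector would make the form negative if the product of
the two did not vanish.\<close>

lemma stress_form_zero_kernel:
  assumes sym: "\<And>i j. w i j = w j i" and psd: "\<And>f. 0 \<le> stress_form n w f f"
    and zero: "stress_form n w f f = 0" and i: "i < n"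
  shows "(\<Sum>j<n. w i j * (f i - f j)) = 0"
proof -
  define y where "y j = (if j = i then 1 else 0 :: real)" for j :: nat
  define K where "K = stress_form n w y f"
  have "K = (\<Sum>k<n. if k = i then (\<Sum>j<n. w k j * (f k - f j)) else 0)"
    unfolding K_def stress_form_def y_def by (intro sum.cong) auto
  also have "\<dots> = (\<Sum>j<n. w i j * (f i - f j))" using i by (simp add: sum.delta)
  finally have K: "K = (\<Sum>j<n. w i j * (f i - f j))" .
  define Y where "Y = stress_form n w y y"
  have quad: "0 \<le> 2 * t * K + t * (t * Y)" for t
  proof -
    have "0 \<le> stress_form n w (\<lambda>j. f j + t * y j) (\<lambda>j. f j + t * y j)" by (rule psd)
    also have "\<dots> = 2 * t * K + t * (t * Y)"
      by (simp add: stress_form_left stress_form_right zero K_def Y_def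
          stress_form_commute[of w n f y, OF sym] algebra_simps)
    finally show ?thesis .
  qed
  have "K = 0"
  proof (rule ccontr)
    assume "K \<noteq> 0"
    have "0 \<le> Y" unfolding Y_def by (rule psd)
    \<comment> \<open>The quadratic \<open>2 t K + t^2 Y\<close> is negative for \<open>t = - K / (Y + 1)\<close>.\<close>
    define u where "u = 1 / (Y + 1)"
    have u: "0 < u" "u * Y = 1 - u" using \<open>0 \<le> Y\<close> by (simp_all add: u_def field_simps)
    define t where "t = - K * u"
    have "2 * t * K + t * (t * Y) = K * K * u * (u * Y - 2)"
      by (simp add: t_def algebra_simps)
    also have "\<dots> = - (K * K * u * (1 + u))" by (simp only: u(2)) (simp add: algebra_simps)
    also have "\<dots> < 0"
    proof -
      have "0 < K * K" using \<open>K \<noteq> 0\<close> by (metis not_real_square_gt_zero)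
      then have "0 < K * K * u * (1 + u)" using u(1) by simp
      then show ?thesis by simp
    qed
    finally show False using quad[of t] by linarith
  qed
  then show ?thesis using K by simp
qed

lemma covers_chords_proper:
  assumes G: "minimal_braced n E" and ps: "proper_stress n E p \<omega>"
  shows "covers_chords n (stress_coeff E \<omega>)"
  unfolding covers_chords_def
proof (intro allI impI)
  fix u v assume uv: "chord n u v"
  obtain i j where ij: "u < i" "i < v" "j < n" "j < u \<or> v < j" "{i, j} \<in> E"
    using chord_crossed[OF minimal_bracedD(5)[OF G] uv] by metis
  then have "{i, j} \<in> braces n E"
    using outside_inside_not_boundary(2)[of u i v n j] uv by (auto simp: braces_def chord_def)
  then have "stress_coeff E \<omega> i j < 0"
    using ps ij by (simp add: proper_stress_def stress_coeff_def)
  then show "\<exists>i j. u < i \<and> i < v \<and> j < n \<and> (j < u \<or> v < j) \<and> stress_coeff E \<omega> i j < 0"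
    using ij by blast
qed

lemma proper_stress_psd:
  assumes G: "minimal_braced n E" and pos: "convex_position s n p" and ps: "proper_stress n E p \<omega>"
  shows "0 \<le> stress_form n (stress_coeff E \<omega>) f f"
    and "stress_form n (stress_coeff E \<omega>) f f = 0 \<Longrightarrow> affine_on n p f"
proof -
  have bal: "balanced n (stress_coeff E \<omega>) p"
    using ps by (simp add: proper_stress_def equilibrium_stress_balanced)
  have neg: "braces_nonpos n (stress_coeff E \<omega>)"
    using ps by (intro braces_nonpos_stress_coeff) (auto simp: proper_stress_def intro: less_imp_le)
  note psd = stress_form_psd[OF pos minimal_bracedD(2)[OF G] bal neg covers_chords_proper[OF G ps]]
  show "0 \<le> stress_form n (stress_coeff E \<omega>) f f" by (rule psd(1))
  show "affine_on n p f" if "stress_form n (stress_coeff E \<omega>) f f = 0" by (rule psd(2)[OF that])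
qed

lemma stress_matrix_carrier [simp]: "stress_matrix n E \<omega> \<in> carrier_mat n n"
  by (simp add: stress_matrix_def)

lemma coordinate_family_kernel:
  assumes bal: "balanced n (stress_coeff E \<omega>) p" and i: "i < n" and f: "affine_on n p f"
  shows "(\<Sum>j<n. stress_matrix n E \<omega> $$ (i, j) * f j) = 0"
  using stress_matrix_apply[OF i] affine_on_kernel[OF bal f i] by simp

lemma convex_position_orient:
  assumes "convex_position s n p" "i < j" "j < k" "k < n"
  shows "orient (p i) (p j) (p k) \<noteq> 0"
proof
  assume "orient (p i) (p j) (p k) = 0"
  moreover have "0 < s * orient (p i) (p j) (p k)"
    using assms unfolding convex_position_def by blast
  ultimately show False by simp
qed

text \<open>The kernel consists exactly of the affine functions, which are determined by their values at three vertices.\<close>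

lemma rank_of_proper_stress:
  assumes G: "minimal_braced n E" and pos: "convex_position s n p" and ps: "proper_stress n E p \<omega>"
  shows "vec_space.rank n (stress_matrix n E \<omega>) + 3 = n"
proof (rule antisym)
  have n: "3 \<le> n" using minimal_bracedD[OF G] by simp
  have o: "orient (p 0) (p 1) (p 2) \<noteq> 0" using n by (intro convex_position_orient[OF pos]) auto
  have bal: "balanced n (stress_coeff E \<omega>) p"
    using ps by (simp add: proper_stress_def equilibrium_stress_balanced)
  have "n \<le> vec_space.rank n (stress_matrix n E \<omega>) + card {0, 1, 2 :: nat}"
  proof (rule rank_ge_of_kernel)
    show "{0, 1, 2} \<subseteq> {..<n}" using n by auto
    fix x :: "nat \<Rightarrow> real"
    assume x: "\<And>j. j \<in> {0, 1, 2} \<Longrightarrow> x j = 0" "\<And>i. i < n \<Longrightarrow> (\<Sum>j<n. stress_matrix n E \<omega> $$ (i, j) * x j) = 0"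
    then have "stress_form n (stress_coeff E \<omega>) x x = 0"
      by (simp add: stress_form_def stress_matrix_apply)
    then have "affine_on n p x" by (rule proper_stress_psd(2)[OF G pos ps])
    then show "\<forall>j<n. x j = 0" using affine_vanishing[OF o _ n] x(1) by simp
  qed simp
  then show "n \<le> vec_space.rank n (stress_matrix n E \<omega>) + 3" by simp
  define k where "k t = (if t = 0 then (\<lambda>j. 1) else (\<lambda>j. (p j) $ (if t = 1 then 1 else 2)))" for t :: nat
  have "vec_space.rank n (stress_matrix n E \<omega>) + card {0, 1, 2 :: nat} \<le> n"
  proof (rule rank_le_of_kernel)
    show "(\<Sum>j<n. stress_matrix n E \<omega> $$ (i, j) * k t j) = 0" if "t \<in> {0, 1, 2}" "i < n" for t i
      by (rule coordinate_family_kernel[OF bal that(2)]) (use affine_on_coordinate in \<open>auto simp: k_def\<close>)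
    show "\<forall>t\<in>{0, 1, 2}. c t = 0" if "\<And>j. j < n \<Longrightarrow> (\<Sum>t\<in>{0, 1, 2}. c t * k t j) = 0" for c
      using affine_independent_family[OF o n, of "c 0" "c 1" "c 2"] that by (simp add: k_def add.assoc)
  qed auto
  then show "vec_space.rank n (stress_matrix n E \<omega>) + 3 \<le> n" by simp
qed

text \<open>A kernel vector that is not affine would, together with the constants and the coordinates, give four independent
kernel vectors.\<close>

lemma affine_on_of_rank:
  fixes p :: "nat \<Rightarrow> real^2"
  assumes o: "orient (p 0) (p 1) (p 2) \<noteq> 0" and n: "3 \<le> n"
    and bal: "balanced n (stress_coeff E \<omega>) p"
    and rk: "vec_space.rank n (stress_matrix n E \<omega>) + 3 = n"
    and x: "\<And>i. i < n \<Longrightarrow> (\<Sum>j<n. stress_coeff E \<omega> i j * (x i - x j)) = 0"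
  shows "affine_on n p x"
proof (rule ccontr)
  assume na: "\<not> affine_on n p x"
  define k where "k t = (if t = 0 then (\<lambda>j. 1) else if t = 3 then x else (\<lambda>j. (p j) $ (if t = 1 then 1 else 2)))" for t :: nat
  have "vec_space.rank n (stress_matrix n E \<omega>) + card {0, 1, 2, 3 :: nat} \<le> n"
  proof (rule rank_le_of_kernel)
    show "(\<Sum>j<n. stress_matrix n E \<omega> $$ (i, j) * k t j) = 0" if "t \<in> {0, 1, 2, 3}" "i < n" for t i
    proof (cases "t = 3")
      case True
      then show ?thesis using stress_matrix_apply[OF that(2)] x[OF that(2)] by (simp add: k_def)
    next
      case False
      show ?thesis
        by (rule coordinate_family_kernel[OF bal that(2)])
          (use affine_on_coordinate that(1) False in \<open>auto simp: k_def\<close>)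
    qed
    show "\<forall>t\<in>{0, 1, 2, 3}. c t = 0" if "\<And>j. j < n \<Longrightarrow> (\<Sum>t\<in>{0, 1, 2, 3}. c t * k t j) = 0" for c
    proof -
      have e: "c 0 + c 1 * (p j)$1 + c 2 * (p j)$2 + c 3 * x j = 0" if "j < n" for j
        using \<open>\<And>j. j < n \<Longrightarrow> (\<Sum>t\<in>{0, 1, 2, 3}. c t * k t j) = 0\<close>[OF that] by (simp add: k_def add.assoc)
      have "c 3 = 0"
      proof (rule ccontr)
        assume c3: "c 3 \<noteq> 0"
        have "x j = - c 0 / c 3 + inner (vector [- c 1 / c 3, - c 2 / c 3]) (p j)" if "j < n" for j
        proof -
          have "c 3 * x j = - c 0 - c 1 * (p j)$1 - c 2 * (p j)$2" using e[OF that] by linarith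
          then have "x j = (- c 0 - c 1 * (p j)$1 - c 2 * (p j)$2) / c 3"
            using c3 by (simp add: nonzero_eq_divide_eq mult.commute)
          then show ?thesis by (simp add: inner_plane diff_divide_distrib)
        qed
        then show False using na unfolding affine_on_def by blast
      qed
      then show ?thesis using affine_independent_family[OF o n, of "c 0" "c 1" "c 2"] e by simp
    qed
  qed auto
  then show False using rk by simp
qed

text \<open>The quadratic form \<open>norm (A x)^2 - norm x^2\<close> has at most two isotropic lines unless it vanishes.\<close>

lemma linear_preserving_three_directions:
  fixes A :: "real^2 \<Rightarrow> real^2"
  assumes A: "linear A" and n: "norm (A a) = norm a" "norm (A b) = norm b" "norm (A c) = norm c"
    and ind: "cross a b \<noteq> 0" "cross a c \<noteq> 0" "cross c b \<noteq> 0"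
  shows "norm (A x) = norm x"
proof -
  define B where "B y z = inner (A y) (A z) - inner y z" for y z
  have B0: "B a a = 0" "B b b = 0" "B c c = 0"
    using n by (simp_all add: B_def dot_square_norm)
  have exp: "x = (cross x b / cross a b) *\<^sub>R a + (cross a x / cross a b) *\<^sub>R b" for x
  proof -
    have "cross a b *\<^sub>R x = cross x b *\<^sub>R a + cross a x *\<^sub>R b"
      by (simp add: plane_eq_iff cross_def algebra_simps)
    then have "(1 / cross a b) *\<^sub>R (cross a b *\<^sub>R x) = (1 / cross a b) *\<^sub>R (cross x b *\<^sub>R a + cross a x *\<^sub>R b)"
      by simp
    then show ?thesis using ind(1) by (simp add: scaleR_add_right)
  qed
  have Bsq: "B x x = 2 * (cross x b / cross a b) * (cross a x / cross a b) * B a b" for x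
  proof -
    define \<alpha> \<beta> where "\<alpha> = cross x b / cross a b" and "\<beta> = cross a x / cross a b"
    have x: "x = \<alpha> *\<^sub>R a + \<beta> *\<^sub>R b" unfolding \<alpha>_def \<beta>_def by (rule exp)
    have "B x x = \<alpha> * \<alpha> * B a a + \<beta> * \<beta> * B b b + 2 * \<alpha> * \<beta> * B a b"
      unfolding x B_def linear_add[OF A] linear_scale[OF A]
      by (simp add: inner_add_left inner_add_right inner_commute[of b a] inner_commute[of "A b" "A a"] algebra_simps)
    then show ?thesis using B0 by (simp add: \<alpha>_def \<beta>_def)
  qed
  have "B a b = 0" using Bsq[of c] B0(3) ind by simp
  then have "B x x = 0" by (simp add: Bsq[of x])
  then show ?thesis by (simp add: B_def norm_eq_sqrt_inner)
qed

text \<open>For the affine condition, the two sides and a brace at vertex \<open>0\<close> give three pairwise independent directions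
in which lengths are preserved.\<close>

lemma super_stable_of_proper_stress:
  assumes G: "minimal_braced n E" and pos: "convex_position s n p" and ps: "proper_stress n E p \<omega>"
  shows "super_stable n E p"
proof -
  note G' = minimal_bracedD[OF G]
  have eq: "equilibrium_stress n E p \<omega>" using ps by (simp add: proper_stress_def)
  have "positive_semidefinite n (stress_matrix n E \<omega>)"
    unfolding positive_semidefinite_def
  proof (intro conjI ballI)
    show "transpose_mat (stress_matrix n E \<omega>) = stress_matrix n E \<omega>"
      by (rule eq_matI) (auto simp: stress_matrix_def stress_coeff_sym)
    fix x :: "real Matrix.vec" assume "x \<in> carrier_vec n"
    then show "0 \<le> scalar_prod x (stress_matrix n E \<omega> *\<^sub>v x)"
      by (simp add: stress_matrix_quadratic proper_stress_psd(1)[OF G pos ps])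
  qed simp
  moreover have "vec_space.rank n (stress_matrix n E \<omega>) + DIM(real^2) + 1 = n"
    using rank_of_proper_stress[OF G pos ps] by simp
  moreover have "congruent_realisations n p (\<lambda>i. A (p i) + b)"
    if A: "linear A" "same_edge_lengths E p (\<lambda>i. A (p i) + b)" for A b
  proof -
    have pres: "norm (A (p i - p j)) = norm (p i - p j)" if "{i, j} \<in> E" for i j
      using A(2) that by (simp add: same_edge_lengths_def linear_diff[OF A(1)])
    obtain j where j: "j < n" "{0, j} \<in> braces n E" using vertex_has_brace[OF G'(5,3,1), of 0] G'(1) by auto
    have jE: "{0, j} \<in> E" "j \<noteq> 0" "j \<noteq> 1" "j \<noteq> n - 1"
    proof -
      show jE: "{0, j} \<in> E" using j by (simp add: braces_def)
      show "j \<noteq> 0" using simple_graph_edgeD[OF G'(3) jE] by simp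
      show "j \<noteq> 1" using j boundary_edge_memb[of 0 n] G'(1) by (auto simp: braces_def)
      show "j \<noteq> n - 1" using j boundary_edge_memb[of "n - 1" n] G'(1) by (auto simp: braces_def insert_commute)
    qed
    have bd: "{0, 1} \<in> E" "{0, n - 1} \<in> E"
      using boundary_edge_memb[of 0 n] boundary_edge_memb[of "n - 1" n] G'(1,4) by (auto simp: insert_commute)
    have o: "orient (p 0) (p a) (p b) \<noteq> 0" if "0 < a" "a < b" "b < n" for a b
      by (rule convex_position_orient[OF pos that])
    have "norm (A x) = norm x" for x
    proof (rule linear_preserving_three_directions[OF A(1)])
      show "norm (A (p 1 - p 0)) = norm (p 1 - p 0)" "norm (A (p (n - 1) - p 0)) = norm (p (n - 1) - p 0)"
        "norm (A (p j - p 0)) = norm (p j - p 0)"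
        using pres[of 1 0] pres[of "n - 1" 0] pres[of j 0] bd jE(1) by (simp_all add: insert_commute)
      show "cross (p 1 - p 0) (p (n - 1) - p 0) \<noteq> 0" "cross (p 1 - p 0) (p j - p 0) \<noteq> 0"
        "cross (p j - p 0) (p (n - 1) - p 0) \<noteq> 0"
        using o[of 1 "n - 1"] o[of 1 j] o[of j "n - 1"] jE j(1) G'(1) by (simp_all add: orient_def)
    qed
    then show ?thesis
      by (simp add: congruent_realisations_def linear_diff[OF A(1), symmetric])
  qed
  ultimately show ?thesis unfolding super_stable_def using eq by blast
qed

lemma stress_energy:
  assumes sym: "\<And>i j. w i j = w j i"
  shows "2 * (stress_form n w (\<lambda>i. (q i)$1) (\<lambda>i. (q i)$1) + stress_form n w (\<lambda>i. (q i)$2) (\<lambda>i. (q i)$2)) =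
    (\<Sum>i<n. \<Sum>j<n. w i j * (norm (q i - q j :: real^2))\<^sup>2)"
proof -
  have half: "2 * stress_form n w f f = (\<Sum>i<n. \<Sum>j<n. w i j * (f i - f j)\<^sup>2)" for f
  proof -
    have a: "stress_form n w f f = (\<Sum>i<n. \<Sum>j<n. w i j * (f i * (f i - f j)))"
      by (simp add: stress_form_def sum_distrib_left mult.left_commute)
    also have "\<dots> = (\<Sum>i<n. \<Sum>j<n. w j i * (f j * (f j - f i)))" by (rule sum.swap)
    also have "\<dots> = (\<Sum>i<n. \<Sum>j<n. w i j * (f j * (f j - f i)))" by (simp add: sym)
    finally have b: "stress_form n w f f = (\<Sum>i<n. \<Sum>j<n. w i j * (f j * (f j - f i)))" .
    have "2 * stress_form n w f f = stress_form n w f f + stress_form n w f f" by simp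
    also have "\<dots> = (\<Sum>i<n. \<Sum>j<n. w i j * (f i * (f i - f j))) + (\<Sum>i<n. \<Sum>j<n. w i j * (f j * (f j - f i)))"
      using a b by simp
    also have "\<dots> = (\<Sum>i<n. \<Sum>j<n. w i j * (f i - f j)\<^sup>2)"
      unfolding sum.distrib[symmetric] by (intro sum.cong refl) (simp add: power2_eq_square algebra_simps)
    finally show ?thesis .
  qed
  have "(norm (q i - q j))\<^sup>2 = ((q i)$1 - (q j)$1)\<^sup>2 + ((q i)$2 - (q j)$2)\<^sup>2" for i j
    unfolding power2_norm_eq_inner inner_plane by (simp add: power2_eq_square)
  then show ?thesis by (simp add: half distrib_left sum.distrib)
qed

text \<open>The energy \<open>\<Sum> \<omega> e * (length of e)^2\<close> depends on the edge lengths only, and it is zero at \<open>p\<close>. As the stress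
matrix is positive semidefinite, zero energy puts the coordinates of \<open>q\<close> into its kernel, so that \<open>q\<close> is an affine
image of \<open>p\<close>.\<close>

lemma globally_rigid_of_super_stable:
  assumes G: "minimal_braced n E" and pos: "convex_position s n p" and ss: "super_stable n E p"
  shows "globally_rigid n E p"
  unfolding globally_rigid_def
proof (intro allI impI)
  fix q assume q: "same_edge_lengths E p q"
  have n: "3 \<le> n" using minimal_bracedD[OF G] by simp
  have o: "orient (p 0) (p 1) (p 2) \<noteq> 0" using n by (intro convex_position_orient[OF pos]) auto
  obtain \<omega> where eq: "equilibrium_stress n E p \<omega>" and psd: "positive_semidefinite n (stress_matrix n E \<omega>)"
    and rk: "vec_space.rank n (stress_matrix n E \<omega>) + DIM(real^2) + 1 = n"
    and aff: "\<And>A b. linear A \<Longrightarrow> same_edge_lengths E p (\<lambda>i. A (p i) + b) \<Longrightarrow>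
      congruent_realisations n p (\<lambda>i. A (p i) + b)"
    using ss unfolding super_stable_def by blast
  define w where "w = stress_coeff E \<omega>"
  have sym: "w i j = w j i" for i j unfolding w_def by (rule stress_coeff_sym)
  have bal: "balanced n w p" using eq by (simp add: w_def equilibrium_stress_balanced)
  have psd': "0 \<le> stress_form n w f f" for f
  proof -
    define v where "v = vec n f"
    have v: "v \<in> carrier_vec n" by (simp add: v_def)
    then have "0 \<le> scalar_prod v (stress_matrix n E \<omega> *\<^sub>v v)"
      using psd unfolding positive_semidefinite_def by blast
    then have "0 \<le> stress_form n w (vec_index v) (vec_index v)"
      by (simp only: stress_matrix_quadratic[OF v] w_def)
    also have "\<dots> = stress_form n w f f" by (intro stress_form_cong) (auto simp: v_def)
    finally show ?thesis .
  qed
  have "(\<Sum>i<n. \<Sum>j<n. w i j * (norm (q i - q j))\<^sup>2) = (\<Sum>i<n. \<Sum>j<n. w i j * (norm (p i - p j))\<^sup>2)"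
    using q by (intro sum.cong refl) (auto simp: w_def stress_coeff_def same_edge_lengths_def)
  then have "stress_form n w (\<lambda>i. (q i)$1) (\<lambda>i. (q i)$1) + stress_form n w (\<lambda>i. (q i)$2) (\<lambda>i. (q i)$2) = 0"
    using stress_energy[of w n q, OF sym] stress_energy[of w n p, OF sym]
      stress_form_affine[OF bal affine_on_coordinate(1)] stress_form_affine[OF bal affine_on_coordinate(2)] by simp
  then have e: "stress_form n w (\<lambda>i. (q i)$1) (\<lambda>i. (q i)$1) = 0" "stress_form n w (\<lambda>i. (q i)$2) (\<lambda>i. (q i)$2) = 0"
    using psd'[of "\<lambda>i. (q i)$1"] psd'[of "\<lambda>i. (q i)$2"] by linarith+
  have ker1: "(\<Sum>j<n. w i j * ((q i)$1 - (q j)$1)) = 0" if "i < n" for i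
    using stress_form_zero_kernel[where w = w and n = n, OF sym psd' e(1) that] .
  have ker2: "(\<Sum>j<n. w i j * ((q i)$2 - (q j)$2)) = 0" if "i < n" for i
    using stress_form_zero_kernel[where w = w and n = n, OF sym psd' e(2) that] .
  have rk3: "vec_space.rank n (stress_matrix n E \<omega>) + 3 = n" using rk by simp
  have "affine_on n p (\<lambda>i. (q i)$1)"
    by (rule affine_on_of_rank[OF o n bal[unfolded w_def] rk3]) (rule ker1[unfolded w_def])
  moreover have "affine_on n p (\<lambda>i. (q i)$2)"
    by (rule affine_on_of_rank[OF o n bal[unfolded w_def] rk3]) (rule ker2[unfolded w_def])
  ultimately obtain c1 v1 c2 v2 where cv: "\<And>i. i < n \<Longrightarrow> (q i)$1 = c1 + inner v1 (p i)"
    "\<And>i. i < n \<Longrightarrow> (q i)$2 = c2 + inner v2 (p i)"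
    unfolding affine_on_def by metis
  define A where "A x = (vector [inner v1 x, inner v2 x] :: real^2)" for x
  define b where "b = (vector [c1, c2] :: real^2)"
  have qA: "q i = A (p i) + b" if "i < n" for i
    using cv[OF that] by (simp add: A_def b_def plane_eq_iff)
  have linA: "linear A"
    by (rule linearI) (simp_all add: A_def plane_eq_iff inner_add_right)
  have "same_edge_lengths E p (\<lambda>i. A (p i) + b)"
    unfolding same_edge_lengths_def
  proof (intro allI impI)
    fix i j assume ij: "{i, j} \<in> E"
    then have "i < n" "j < n" using simple_graph_edgeD[OF minimal_bracedD(3)[OF G]] by blast+
    then show "norm (A (p i) + b - (A (p j) + b)) = norm (p i - p j)"
      using q ij unfolding same_edge_lengths_def by (metis qA)
  qed
  then have "congruent_realisations n p (\<lambda>i. A (p i) + b)" by (rule aff[OF linA])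
  then show "congruent_realisations n p q"
    using qA unfolding congruent_realisations_def by simp
qed

section \<open>Infinitesimal rigidity from convex rigidity\<close>

lemma eventually_convex_position:
  assumes lim: "\<And>i. i < n \<Longrightarrow> ((\<lambda>t. q t i) \<longlongrightarrow> p i) F" and pos: "convex_position s n p"
  shows "eventually (\<lambda>t. convex_position s n (q t)) F"
proof -
  define T where "T = {(i, j, k). i < j \<and> j < k \<and> k < n}"
  have "T \<subseteq> {..<n} \<times> {..<n} \<times> {..<n}" by (auto simp: T_def)
  then have "finite T" by (rule finite_subset) auto
  have "eventually (\<lambda>t. 0 < s * orient (q t i) (q t j) (q t k)) F" if ijk: "i < j" "j < k" "k < n" for i j k
  proof -
    have l: "((\<lambda>t. q t i) \<longlongrightarrow> p i) F" "((\<lambda>t. q t j) \<longlongrightarrow> p j) F" "((\<lambda>t. q t k) \<longlongrightarrow> p k) F"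
      using lim ijk by auto
    have "((\<lambda>t. s * orient (q t i) (q t j) (q t k)) \<longlongrightarrow> s * orient (p i) (p j) (p k)) F"
      unfolding orient_def cross_def by (intro tendsto_intros l)
    moreover have "0 < s * orient (p i) (p j) (p k)" using pos ijk by (simp add: convex_position_def)
    ultimately show ?thesis by (rule order_tendstoD(1))
  qed
  then have "eventually (\<lambda>t. \<forall>x\<in>T. case x of (i, j, k) \<Rightarrow> 0 < s * orient (q t i) (q t j) (q t k)) F"
    using \<open>finite T\<close> by (intro eventually_ball_finite) (auto simp: T_def)
  then show ?thesis
    by (rule eventually_mono) (auto simp: T_def convex_position_def)
qed

lemma convex_position_perturb:
  assumes "convex_position s n p"
  shows "eventually (\<lambda>t. convex_position s n (\<lambda>i. p i + t *\<^sub>R q i)) (at 0)"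
proof (rule eventually_convex_position[OF _ assms])
  fix i
  have "((\<lambda>t. p i + t *\<^sub>R q i) \<longlongrightarrow> p i + 0 *\<^sub>R q i) (at 0)" by (intro tendsto_intros)
  then show "((\<lambda>t. p i + t *\<^sub>R q i) \<longlongrightarrow> p i) (at 0)" by simp
qed

text \<open>The distance of any two points is constant along a family of congruences.\<close>

lemma trivial_flex_pairs:
  assumes tf: "trivial_flex n p p'" and ij: "i < n" "j < n"
  shows "inner (p i - p j) (p' i - p' j) = 0"
proof -
  obtain \<Phi> where \<Phi>: "\<And>t. congruence_map (\<Phi> t)" "\<Phi> 0 = id"
    "\<And>i. i < n \<Longrightarrow> ((\<lambda>t. \<Phi> t (p i)) has_vector_derivative p' i) (at 0)"
    using tf unfolding trivial_flex_def by blast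
  define g where "g t = \<Phi> t (p i) - \<Phi> t (p j)" for t
  have g: "(g has_vector_derivative (p' i - p' j)) (at 0)"
    unfolding g_def[abs_def] by (intro has_vector_derivative_diff \<Phi>(3) ij)
  have "((\<lambda>t. inner (g t) (g t)) has_vector_derivative (inner (g 0) (p' i - p' j) + inner (p' i - p' j) (g 0))) (at 0)"
    by (rule bounded_bilinear.has_vector_derivative[OF bounded_bilinear_inner g g])
  moreover have "inner (g t) (g t) = inner (p i - p j) (p i - p j)" for t
    using \<Phi>(1)[of t] unfolding congruence_map_def g_def by (metis dot_square_norm)
  ultimately have "((\<lambda>t. inner (p i - p j) (p i - p j)) has_vector_derivative
      (inner (g 0) (p' i - p' j) + inner (p' i - p' j) (g 0))) (at 0)"
    by simp
  then have "inner (g 0) (p' i - p' j) + inner (p' i - p' j) (g 0) = 0"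
    using vector_derivative_unique_at has_vector_derivative_const by blast
  moreover have "g 0 = p i - p j" by (simp add: g_def \<Phi>(2))
  ultimately show ?thesis by (simp add: inner_commute)
qed

lemma perp_simps:
  "perp (x + y) = perp x + perp y" "perp (x - y) = perp x - perp y" "perp (c *\<^sub>R x) = c *\<^sub>R perp x"
  "inner x (perp x) = 0" "cross (perp x) y = - inner x y" "cross (perp x) (perp y) = cross x y"
  "perp x = 0 \<longleftrightarrow> x = 0" "inner (perp x) (perp y) = inner x y" "inner (perp x) y = - inner x (perp y)"
  by (auto simp: perp_def plane_simps algebra_simps)

text \<open>Subtract the infinitesimal rotation and translation that agree with \<open>p'\<close> at the vertices \<open>0\<close> and \<open>1\<close>. At
any other vertex the rest is orthogonal to two independent directions.\<close>

lemma complete_flex_is_rotation: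
  assumes pos: "convex_position s n p" and n: "3 \<le> n"
    and flex: "\<And>i j. \<lbrakk>i < n; j < n\<rbrakk> \<Longrightarrow> inner (p i - p j) (p' i - p' j) = 0"
  obtains c b where "\<And>i. i < n \<Longrightarrow> p' i = c *\<^sub>R perp (p i) + b"
proof -
  define d where "d = p 1 - p 0"
  have "p 1 \<noteq> p 0" using inj_onD[OF inj_on_convex_position[OF pos n], of 1 0] n by auto
  then have d: "perp d \<noteq> 0" unfolding d_def perp_simps(7) by simp
  have "cross (perp d) (p' 1 - p' 0) = 0" using flex[of 1 0] n unfolding perp_simps(5) d_def by simp
  then obtain c where c: "p' 1 - p' 0 = c *\<^sub>R perp d" using cross_zero_imp_parallel d by blast
  define b where "b = p' 0 - c *\<^sub>R perp (p 0)"
  define r where "r i = p' i - (c *\<^sub>R perp (p i) + b)" for i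
  have r0: "r 0 = 0" by (simp add: r_def b_def)
  have r1: "r 1 = 0" using c by (simp add: r_def b_def d_def perp_simps algebra_simps)
  have rr: "inner (p i - p j) (r i - r j) = 0" if "i < n" "j < n" for i j
  proof -
    have "r i - r j = (p' i - p' j) - c *\<^sub>R perp (p i - p j)"
      by (simp add: r_def perp_simps algebra_simps)
    moreover have "inner z (y - c *\<^sub>R perp z) = inner z y" for z y
      by (simp add: inner_diff_right perp_simps(4))
    ultimately show ?thesis using flex[OF that] by simp
  qed
  have "r i = 0" if i: "i < n" for i
  proof (cases "i = 0 \<or> i = 1")
    case False
    have "cross (perp (p i - p 0)) (r i) = 0" "cross (perp (p i - p 1)) (r i) = 0"
      using rr[OF i, of 0] rr[OF i, of 1] r0 r1 n unfolding perp_simps(5) by simp_all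
    moreover have "cross (p i - p 0) (p i - p 1) = orient (p 0) (p 1) (p i)"
      by (simp add: orient_def cross_def algebra_simps)
    then have "cross (perp (p i - p 0)) (perp (p i - p 1)) \<noteq> 0"
      using convex_position_orient[OF pos, of 0 1 i] False i unfolding perp_simps(6) by simp
    ultimately show ?thesis using cross_both_zero by blast
  qed (use r0 r1 in auto)
  then have "p' i = c *\<^sub>R perp (p i) + b" if "i < n" for i using that by (simp add: r_def)
  then show ?thesis using that by blast
qed

text \<open>The congruences rotate with angular velocity \<open>c\<close> and translate with velocity \<open>b\<close>. Each derivative of a rotating
point adds a quarter turn and a factor \<open>c\<close>.\<close>

lemma rotation_flex_trivial:
  assumes p': "\<And>i. i < n \<Longrightarrow> p' i = c *\<^sub>R perp (p i) + b"
  shows "trivial_flex n p p'"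
proof -
  define \<Phi> where "\<Phi> t x = cos (c * t) *\<^sub>R x + sin (c * t) *\<^sub>R perp x + t *\<^sub>R b" for t x
  have congr: "congruence_map (\<Phi> t)" for t
    unfolding congruence_map_def
  proof (intro allI)
    fix x y
    have e: "\<Phi> t x - \<Phi> t y = cos (c * t) *\<^sub>R (x - y) + sin (c * t) *\<^sub>R perp (x - y)"
      by (simp add: \<Phi>_def perp_simps algebra_simps)
    have rot: "inner (C *\<^sub>R z + S *\<^sub>R perp z) (C *\<^sub>R z + S *\<^sub>R perp z) = (C\<^sup>2 + S\<^sup>2) * inner z z" for C S z
      by (simp add: inner_plane perp_def power2_eq_square algebra_simps)
    have "inner (\<Phi> t x - \<Phi> t y) (\<Phi> t x - \<Phi> t y) = inner (x - y) (x - y)"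
      unfolding e rot by simp
    then show "norm (\<Phi> t x - \<Phi> t y) = norm (x - y)" by (simp add: norm_eq_sqrt_inner)
  qed
  have deriv: "((\<lambda>t. c ^ k *\<^sub>R (cos (c * t + k * pi / 2) *\<^sub>R x + sin (c * t + k * pi / 2) *\<^sub>R perp x))
      has_vector_derivative c ^ Suc k *\<^sub>R (cos (c * t + Suc k * pi / 2) *\<^sub>R x + sin (c * t + Suc k * pi / 2) *\<^sub>R perp x)) (at t)"
    for k t x
  proof -
    have sh: "c * t + Suc k * pi / 2 = (c * t + k * pi / 2) + pi / 2" by (simp add: field_simps)
    have cs: "cos (c * t + Suc k * pi / 2) = - sin (c * t + k * pi / 2)" "sin (c * t + Suc k * pi / 2) = cos (c * t + k * pi / 2)"
      unfolding sh by (simp_all only: cos_add sin_add cos_pi_half sin_pi_half) simp_all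
    have d: "((\<lambda>t. cos (c * t + k * pi / 2)) has_real_derivative - sin (c * t + k * pi / 2) * c) (at t)"
      "((\<lambda>t. sin (c * t + k * pi / 2)) has_real_derivative cos (c * t + k * pi / 2) * c) (at t)"
      by (auto intro!: derivative_eq_intros)
    have "((\<lambda>t. cos (c * t + k * pi / 2) *\<^sub>R x + sin (c * t + k * pi / 2) *\<^sub>R perp x) has_vector_derivative
        (- sin (c * t + k * pi / 2) * c) *\<^sub>R x + (cos (c * t + k * pi / 2) * c) *\<^sub>R perp x) (at t)"
      using has_vector_derivative_add[OF has_vector_derivative_scaleR[OF d(1) has_vector_derivative_const[of x]]
          has_vector_derivative_scaleR[OF d(2) has_vector_derivative_const[of "perp x"]]] by simp
    then have "((\<lambda>t. c ^ k *\<^sub>R (cos (c * t + k * pi / 2) *\<^sub>R x + sin (c * t + k * pi / 2) *\<^sub>R perp x)) has_vector_derivative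
        c ^ k *\<^sub>R ((- sin (c * t + k * pi / 2) * c) *\<^sub>R x + (cos (c * t + k * pi / 2) * c) *\<^sub>R perp x)) (at t)"
      by (rule bounded_linear.has_vector_derivative[OF bounded_linear_scaleR_right])
    then show ?thesis unfolding cs by (simp add: algebra_simps)
  qed
  define D where "D x k t = c ^ k *\<^sub>R (cos (c * t + k * pi / 2) *\<^sub>R x + sin (c * t + k * pi / 2) *\<^sub>R perp x) +
    (if k = 0 then t *\<^sub>R b else if k = 1 then b else 0)" for x k t
  have D: "(D x k has_vector_derivative D x (Suc k) t) (at t)" for x k t
  proof -
    have "((\<lambda>t. if k = 0 then t *\<^sub>R b else if k = 1 then b else 0) has_vector_derivative
        (if Suc k = 0 then t *\<^sub>R b else if Suc k = 1 then b else 0)) (at t)"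
    proof (cases "k = 0")
      case True
      have "((\<lambda>t. t *\<^sub>R b) has_vector_derivative b) (at t)"
        using has_vector_derivative_scaleR[OF DERIV_ident has_vector_derivative_const[of b]] by simp
      then show ?thesis using True by simp
    qed auto
    then show ?thesis unfolding D_def by (intro has_vector_derivative_add deriv)
  qed
  have D0: "D x 0 = (\<lambda>t. \<Phi> t x)" for x by (auto simp: D_def \<Phi>_def)
  have smooth: "smooth_curve (\<lambda>t. \<Phi> t x)" for x
    unfolding smooth_curve_def using D[of x] D0[of x] by blast
  have "((\<lambda>t. \<Phi> t (p i)) has_vector_derivative p' i) (at 0)" if "i < n" for i
  proof -
    have "D (p i) (Suc 0) 0 = p' i" by (simp add: D_def p'[OF that])
    then show ?thesis using D[of "p i" 0 0] by (simp add: D0)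
  qed
  moreover have "\<Phi> 0 = id" by (auto simp: \<Phi>_def)
  ultimately show ?thesis unfolding trivial_flex_def using congr smooth by blast
qed

text \<open>If \<open>p'\<close> is a flex, then \<open>p + t p'\<close> and \<open>p - t p'\<close> have equal edge lengths, since the terms linear in \<open>t\<close>
of the squared lengths vanish. For small \<open>t\<close> both are strictly convex, hence congruent, so that the linear terms vanish
for all pairs of vertices.\<close>

lemma infinitesimally_rigid_of_convexly_rigid:
  assumes G: "minimal_braced n E" and pos: "convex_position s n p"
    and rigid: "\<And>q. strictly_convex_polygon n q \<Longrightarrow> convexly_rigid n E q"
  shows "infinitesimally_rigid n E p"
  unfolding infinitesimally_rigid_def
proof (intro allI impI)
  fix p' assume flex: "infinitesimal_flex E p p'"
  have n: "3 \<le> n" using minimal_bracedD[OF G] by simp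
  define q where "q t i = p i + t *\<^sub>R p' i" for t i
  have "eventually (\<lambda>t. convex_position s n (q t) \<and> convex_position s n (q (- t))) (at 0)"
    using convex_position_perturb[OF pos, of p'] convex_position_perturb[OF pos, of "\<lambda>i. - p' i"]
    by (intro eventually_conj) (simp_all add: q_def[abs_def])
  then obtain \<epsilon> where \<epsilon>: "0 < \<epsilon>" "\<And>t. \<lbrakk>t \<noteq> 0; dist t 0 < \<epsilon>\<rbrakk> \<Longrightarrow> convex_position s n (q t) \<and> convex_position s n (q (- t))"
    unfolding eventually_at by blast
  define t where "t = \<epsilon> / 2"
  have t: "0 < t" "convex_position s n (q t)" "convex_position s n (q (- t))"
    using \<epsilon>(1) \<epsilon>(2)[of t] by (auto simp: t_def dist_real_def)
  have sq: "(norm (q u i - q u j))\<^sup>2 = (norm (p i - p j))\<^sup>2 + u\<^sup>2 * (norm (p' i - p' j))\<^sup>2 + 2 * u * inner (p i - p j) (p' i - p' j)" for u i j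
  proof -
    have "q u i - q u j = (p i - p j) + u *\<^sub>R (p' i - p' j)" by (simp add: q_def algebra_simps)
    moreover have "(norm (a + u *\<^sub>R b))\<^sup>2 = (norm a)\<^sup>2 + u\<^sup>2 * (norm b)\<^sup>2 + 2 * u * inner a b" for a b :: "real^2"
      unfolding power2_norm_eq_inner by (simp add: inner_plane power2_eq_square algebra_simps)
    ultimately show ?thesis by simp
  qed
  have "same_edge_lengths E (q t) (q (- t))"
    unfolding same_edge_lengths_def
  proof (intro allI impI)
    fix i j assume "{i, j} \<in> E"
    then have "inner (p i - p j) (p' i - p' j) = 0" using flex by (simp add: infinitesimal_flex_def)
    then have "(norm (q (- t) i - q (- t) j))\<^sup>2 = (norm (q t i - q t j))\<^sup>2" unfolding sq by simp
    then show "norm (q (- t) i - q (- t) j) = norm (q t i - q t j)" by simp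
  qed
  then have "congruent_realisations n (q t) (q (- t))"
    using rigid[OF strictly_convex_polygon_of_convex_position[OF t(2) n]]
      strictly_convex_polygon_of_convex_position[OF t(3) n] unfolding convexly_rigid_def by blast
  then have lt: "inner (p i - p j) (p' i - p' j) = 0" if "i < j" "j < n" for i j
  proof -
    have "norm (q t i - q t j) = norm (q (- t) i - q (- t) j)"
      using \<open>congruent_realisations n (q t) (q (- t))\<close> that by (simp add: congruent_realisations_def)
    then have "(norm (q t i - q t j))\<^sup>2 = (norm (q (- t) i - q (- t) j))\<^sup>2" by simp
    then show ?thesis unfolding sq using t(1) by simp
  qed
  have "inner (p i - p j) (p' i - p' j) = 0" if ij: "i < n" "j < n" for i j
  proof (cases i j rule: linorder_cases)
    case greater
    then have "inner (p j - p i) (p' j - p' i) = 0" using lt ij by blast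
    then show ?thesis by (simp add: inner_diff_left inner_diff_right)
  qed (use lt ij in auto)
  then obtain c b where "\<And>i. i < n \<Longrightarrow> p' i = c *\<^sub>R perp (p i) + b"
    using complete_flex_is_rotation[OF pos n] by metis
  then show "trivial_flex n p p'" by (rule rotation_flex_trivial)
qed

section \<open>Weakly convex polygons\<close>

text \<open>The inner product of the vectors that \<open>x\<close> and \<open>y\<close> span on an edge, written so that no order of the two ends need
be chosen; see \<open>edge_form_pair\<close>.\<close>

definition edge_form :: "nat \<Rightarrow> nat set \<Rightarrow> (nat \<Rightarrow> real^2) \<Rightarrow> (nat \<Rightarrow> real^2) \<Rightarrow> real" where
  "edge_form n e x y = (\<Sum>i<n. \<Sum>j<n. if {i, j} = e then inner (x i - x j) (y i) else 0)"

lemma edge_form_pair: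
  assumes "a < n" "b < n" "a \<noteq> b"
  shows "edge_form n {a, b} x y = inner (x a - x b) (y a - y b)"
proof -
  have "edge_form n {a, b} x y = (\<Sum>i<n. (if i = a then inner (x a - x b) (y a) else 0) + (if i = b then inner (x b - x a) (y b) else 0))"
    unfolding edge_form_def
  proof (rule sum.cong[OF refl])
    fix i assume "i \<in> {..<n}"
    have "(\<Sum>j<n. if {i, j} = {a, b} then inner (x i - x j) (y i) else 0) =
        (\<Sum>j<n. (if j = b then (if i = a then inner (x a - x b) (y a) else 0) else 0) +
          (if j = a then (if i = b then inner (x b - x a) (y b) else 0) else 0))"
      using assms(3) by (intro sum.cong refl) (auto simp: doubleton_eq_iff)
    also have "\<dots> = (if i = a then inner (x a - x b) (y a) else 0) + (if i = b then inner (x b - x a) (y b) else 0)"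
      using assms by (simp add: sum.distrib)
    finally show "(\<Sum>j<n. if {i, j} = {a, b} then inner (x i - x j) (y i) else 0) =
        (if i = a then inner (x a - x b) (y a) else 0) + (if i = b then inner (x b - x a) (y b) else 0)" .
  qed
  also have "\<dots> = inner (x a - x b) (y a) + inner (x b - x a) (y b)"
    using assms by (simp add: sum.distrib)
  also have "\<dots> = inner (x a - x b) (y a - y b)" by (simp add: inner_diff_left inner_diff_right)
  finally show ?thesis .
qed

text \<open>The work of the internal forces against a displacement, computed edge by edge and vertex by vertex.\<close>

lemma virtual_work:
  assumes "finite E"
  shows "(\<Sum>e\<in>E. \<omega> e * edge_form n e p \<delta>) = (\<Sum>i<n. inner (\<Sum>j<n. stress_coeff E \<omega> i j *\<^sub>R (p i - p j)) (\<delta> i))"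
proof -
  have inner_if: "inner (if P then x else 0) y = (if P then inner x y else 0)" for P and x y :: "real^2" by simp
  have "(\<Sum>i<n. inner (\<Sum>j<n. stress_coeff E \<omega> i j *\<^sub>R (p i - p j)) (\<delta> i)) =
      (\<Sum>i<n. \<Sum>e\<in>E. \<omega> e * (\<Sum>j<n. if {i, j} = e then inner (p i - p j) (\<delta> i) else 0))"
    by (simp only: stress_coeff_sum[OF assms] inner_sum_left inner_scaleR_left inner_if)
  also have "\<dots> = (\<Sum>e\<in>E. \<Sum>i<n. \<omega> e * (\<Sum>j<n. if {i, j} = e then inner (p i - p j) (\<delta> i) else 0))"
    by (rule sum.swap)
  also have "\<dots> = (\<Sum>e\<in>E. \<omega> e * edge_form n e p \<delta>)"
    by (simp add: edge_form_def sum_distrib_left)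
  finally show ?thesis by simp
qed

definition weakly_convex :: "nat \<Rightarrow> (nat \<Rightarrow> real^2) \<Rightarrow> bool" where
  "weakly_convex n p \<longleftrightarrow> (\<forall>i j k. i < j \<and> j < k \<and> k < n \<longrightarrow> 0 \<le> orient (p i) (p j) (p k))"

lemma weakly_convex_cyclic:
  assumes "weakly_convex n p" "cyclic i j k" "i < n" "j < n" "k < n"
  shows "0 \<le> orient (p i) (p j) (p k)"
proof -
  have pos: "0 \<le> orient (p a) (p b) (p c)" if "a < b" "b < c" "c < n" for a b c
    using assms(1) that unfolding weakly_convex_def by simp
  from assms(2) consider "i < j" "j < k" | "j < k" "k < i" | "k < i" "i < j"
    unfolding cyclic_def by blast
  then show ?thesis
  proof cases
    case 1
    then show ?thesis using pos assms by blast
  next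
    case 2
    then have "0 \<le> orient (p j) (p k) (p i)" using pos assms by blast
    then show ?thesis by (simp only: orient_rotate[of "p j" "p k" "p i"])
  next
    case 3
    then have "0 \<le> orient (p k) (p i) (p j)" using pos assms by blast
    then show ?thesis by (simp only: orient_rotate[of "p i" "p j" "p k"])
  qed
qed

lemma point_on_line:
  assumes "cross d (x - a) = 0" "d \<noteq> 0"
  shows "x = a + (inner d (x - a) / inner d d) *\<^sub>R d"
proof -
  obtain c where c: "x - a = c *\<^sub>R d" using cross_zero_imp_parallel assms by blast
  then have "inner d (x - a) / inner d d = c" using assms(2) by simp
  then show ?thesis using c by (simp add: algebra_simps)
qed

lemma orient_on_line:
  assumes "cross d (x - a) = 0" "cross d (y - a) = 0" "d \<noteq> 0"
  shows "orient x y z = (inner d (y - a) - inner d (x - a)) / inner d d * cross d (z - a)"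
proof -
  let ?t = "(inner d (y - a) - inner d (x - a)) / inner d d"
  have "y - x = ?t *\<^sub>R d"
    using point_on_line[OF assms(1,3)] point_on_line[OF assms(2,3)]
    by (metis (no_types, lifting) add_diff_cancel_left diff_divide_distrib scaleR_left_diff_distrib)
  moreover have "cross d (z - x) = cross d (z - a)"
    using assms(1) by (simp add: cross_def algebra_simps)
  moreover have "cross (c *\<^sub>R d) w = c * cross d w" for c w
    by (simp add: cross_def algebra_simps)
  ultimately show ?thesis by (simp add: orient_def)
qed

text \<open>Seen from a point to the left of a directed line, points on the line appear in counterclockwise order precisely if they
follow each other in the direction of the line.\<close>

lemma weakly_convex_line_order:
  assumes wc: "weakly_convex n p" and d: "d \<noteq> 0"
    and xy: "cross d (p x - a) = 0" "cross d (p y - a) = 0" "x < n" "y < n"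
    and l: "l < n" "0 < cross d (p l - a)" and cyc: "cyclic x y l"
  shows "inner d (p x - a) \<le> inner d (p y - a)"
proof -
  have "0 \<le> orient (p x) (p y) (p l)" using weakly_convex_cyclic[OF wc cyc] xy l by simp
  then have "0 \<le> (inner d (p y - a) - inner d (p x - a)) / inner d d * cross d (p l - a)"
    unfolding orient_on_line[OF xy(1,2) d] .
  moreover have "0 < inner d d" using d by simp
  ultimately show ?thesis using l(2) by (simp add: zero_le_mult_iff zero_le_divide_iff)
qed

text \<open>In the presence of a vertex to the left of a line, vertices on the line are met in the direction of the line, up to a
cyclic rotation. The Vandermonde product is the form of "in cyclic order" in which the three rotations need not be
distinguished.\<close>

lemma weakly_convex_line_cyclic:
  assumes wc: "weakly_convex n p" and d: "d \<noteq> 0" and ord: "x < y" "y < z" "z < n"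
    and on: "cross d (p x - a) = 0" "cross d (p y - a) = 0" "cross d (p z - a) = 0"
    and l: "l < n" "0 < cross d (p l - a)"
  shows "0 \<le> (inner d (p y - a) - inner d (p x - a)) * (inner d (p z - a) - inner d (p y - a)) *
    (inner d (p z - a) - inner d (p x - a))"
proof -
  let ?S = "\<lambda>x. inner d (p x - a)"
  note o = weakly_convex_line_order[OF wc d _ _ _ _ l]
  have "l \<noteq> x" "l \<noteq> y" "l \<noteq> z" using on l by auto
  then consider "l < x \<or> z < l" | "x < l" "l < y" | "y < l" "l < z" by linarith
  then show ?thesis
  proof cases
    case 1
    then have "cyclic x y l" "cyclic y z l" using ord by (auto simp: cyclic_def)
    then have "?S x \<le> ?S y" "?S y \<le> ?S z" using o on ord by auto
    then show ?thesis by (intro mult_nonneg_nonneg) auto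
  next
    case 2
    then have "cyclic y z l" "cyclic y x l" "cyclic z x l" using ord by (auto simp: cyclic_def)
    then have "?S y \<le> ?S z" "?S y \<le> ?S x" "?S z \<le> ?S x" using o on ord by auto
    then show ?thesis by (intro mult_nonpos_nonpos mult_nonpos_nonneg) auto
  next
    case 3
    then have "cyclic x y l" "cyclic z x l" "cyclic z y l" using ord by (auto simp: cyclic_def)
    then have "?S x \<le> ?S y" "?S z \<le> ?S x" "?S z \<le> ?S y" using o on ord by auto
    then show ?thesis by (intro mult_nonpos_nonpos mult_nonneg_nonpos) auto
  qed
qed

lemma on_line_inj:
  assumes inj: "inj_on p {..<n}" and d: "d \<noteq> 0"
    and on: "cross d (p x - a) = 0" "cross d (p y - a) = 0" "x < n" "y < n"
    and eq: "inner d (p x - a) = inner d (p y - a)"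
  shows "x = y"
proof -
  have "p x = p y"
    using point_on_line[OF on(1) d] point_on_line[OF on(2) d] eq by simp
  then show ?thesis using inj on by (auto simp: inj_on_def)
qed

text \<open>Vertices on different sides of the line would require opposite cyclic orders of the three vertices on it.\<close>

lemma weakly_convex_one_side:
  assumes wc: "weakly_convex n p" and inj: "inj_on p {..<n}" and d: "d \<noteq> 0" and ord: "x < y" "y < z" "z < n"
    and on: "cross d (p x - a) = 0" "cross d (p y - a) = 0" "cross d (p z - a) = 0"
  shows "(\<forall>l<n. 0 \<le> cross d (p l - a)) \<or> (\<forall>l<n. cross d (p l - a) \<le> 0)"
proof (rule ccontr)
  assume "\<not> ?thesis"
  then obtain l m where lm: "l < n" "cross d (p l - a) < 0" "m < n" "0 < cross d (p m - a)"
    by (auto simp: not_le)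
  let ?S = "\<lambda>x. inner d (p x - a)"
  let ?P = "(?S y - ?S x) * (?S z - ?S y) * (?S z - ?S x)"
  have neg: "cross (- d) w = - cross d w" for w by (simp add: cross_def)
  have "0 \<le> ?P" by (rule weakly_convex_line_cyclic[OF wc d ord on lm(3,4)])
  moreover have "0 \<le> - ?P"
    using weakly_convex_line_cyclic[OF wc _ ord, of "- d" a l] d on lm(1,2)
    by (simp add: neg algebra_simps)
  ultimately have "?P = 0" by linarith
  then have "?S x = ?S y \<or> ?S y = ?S z \<or> ?S x = ?S z" by auto
  then show False
    using on_line_inj[OF inj d on(1,2)] on_line_inj[OF inj d on(2,3)] on_line_inj[OF inj d on(1,3)] ord by auto
qed

definition flat :: "nat \<Rightarrow> (nat \<Rightarrow> real^2) \<Rightarrow> bool" where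
  "flat n p \<longleftrightarrow> (\<exists>a d. d \<noteq> 0 \<and> (\<forall>l<n. cross d (p l - a) = 0))"

text \<open>If the vertices \<open>i\<close> and \<open>j\<close> coincide, then every triangle of \<open>i\<close> with one vertex on each
of the two arcs is counted with both orientations and so is degenerate. This puts both arcs on one line.\<close>

lemma inj_on_weakly_convex:
  assumes wc: "weakly_convex n p" and nf: "\<not> flat n p" and n: "3 \<le> n"
    and adj: "\<And>i. i < n \<Longrightarrow> p i \<noteq> p ((i + 1) mod n)"
  shows "inj_on p {..<n}"
proof -
  have "p i \<noteq> p j" if ij: "i < j" "j < n" for i j
  proof
    assume eq: "p i = p j"
    have j1: "j \<noteq> i + 1" using adj[of i] eq ij by auto
    define m where "m = (j + 1) mod n"
    have m: "m < n" "m < i \<or> j < m"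
    proof -
      show "m < n" using ij by (simp add: m_def)
      show "m < i \<or> j < m"
      proof (cases "j + 1 < n")
        case False
        then have "j + 1 = n" using ij by simp
        then have "m = 0" by (simp add: m_def)
        moreover have "p j \<noteq> p 0" using adj[of j] ij \<open>m = 0\<close> by (simp add: m_def)
        then have "i \<noteq> 0" using eq by metis
        ultimately show ?thesis by simp
      qed (simp add: m_def)
    qed
    have zero: "orient (p i) (p k) (p l) = 0" if kl: "i < k" "k < j" "l < n" "l < i \<or> j < l" for k l
    proof -
      have "cyclic i k l" "cyclic k j l" using kl by (auto simp: cyclic_def)
      then have "0 \<le> orient (p i) (p k) (p l)" "0 \<le> orient (p k) (p j) (p l)"
        using weakly_convex_cyclic[OF wc] kl ij by auto
      moreover have "orient (p k) (p j) (p l) = - orient (p i) (p k) (p l)"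
        unfolding eq[symmetric] by (simp add: orient_def cross_def algebra_simps)
      ultimately show ?thesis by linarith
    qed
    define d where "d = p (i + 1) - p i"
    have d: "d \<noteq> 0" using adj[of i] ij by (simp add: d_def)
    have out: "cross d (p l - p i) = 0" if "l < n" "l < i \<or> j < l" for l
      using zero[of "i + 1" l] that ij j1 by (simp add: orient_def d_def)
    have pm: "p m \<noteq> p i" using adj[of j] ij eq by (simp add: m_def)
    obtain c where c: "p m - p i = c *\<^sub>R d" using cross_zero_imp_parallel[OF out[OF m] d] by blast
    have "c \<noteq> 0" using c pm by auto
    have ins: "cross d (p k - p i) = 0" if "i < k" "k < j" for k
    proof -
      have "cross (p k - p i) (c *\<^sub>R d) = 0" using zero[OF that m] c by (simp add: orient_def)
      moreover have "cross x (c *\<^sub>R d) = - c * cross d x" for x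
        by (simp add: cross_def algebra_simps)
      ultimately show ?thesis using \<open>c \<noteq> 0\<close> by simp
    qed
    have "cross d (p l - p i) = 0" if "l < n" for l
    proof -
      consider "l < i \<or> j < l" | "l = i" | "l = j" | "i < l" "l < j" by linarith
      then show ?thesis using out[OF that] ins eq by cases (auto simp: cross_linear(3))
    qed
    then show False using nf d unfolding flat_def by blast
  qed
  then show ?thesis by (metis inj_onI lessThan_iff linorder_neqE_nat)
qed

section \<open>An elastic energy on weakly convex polygons\<close>

text \<open>The points \<open>(0, 0), (1, 0), \<dots>, (m, 0)\<close>, where \<open>m = n - 2\<close>, and \<open>(0, m^2 - 1/4)\<close>. The corresponding
right triangle has hypotenuse \<open>m^2 + 1/4\<close>.\<close>

definition reference_polygon :: "nat \<Rightarrow> nat \<Rightarrow> real^2" where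
  "reference_polygon n j = (if j + 1 < n then vector [real j, 0] else vector [0, (real n - 2)\<^sup>2 - 1 / 4])"

abbreviation target_sqlength :: "nat \<Rightarrow> nat set \<Rightarrow> real" where
  "target_sqlength n e \<equiv> edge_form n e (reference_polygon n) (reference_polygon n)"

abbreviation excess :: "nat \<Rightarrow> (nat \<Rightarrow> real^2) \<Rightarrow> nat set \<Rightarrow> real" where
  "excess n p e \<equiv> edge_form n e p p - target_sqlength n e"

text \<open>Side lengths enter through their squares, so that the condition is polynomial in \<open>p\<close>.\<close>

definition near_reference :: "nat \<Rightarrow> real \<Rightarrow> (nat \<Rightarrow> real^2) \<Rightarrow> bool" where
  "near_reference n \<eta> p \<longleftrightarrow> weakly_convex n p \<and> (\<forall>e\<in>boundary_edges n.
    \<bar>excess n p e\<bar> \<le> \<eta>)"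

lemma boundary_edge_form:
  assumes "i < n" "3 \<le> n"
  shows "edge_form n {i, (i + 1) mod n} x y = inner (x i - x ((i + 1) mod n)) (y i - y ((i + 1) mod n))"
  using successor_neq[OF assms] assms by (intro edge_form_pair) auto

lemma reference_lengths:
  assumes n: "4 \<le> n"
  shows "\<lbrakk>i + 2 < n\<rbrakk> \<Longrightarrow> target_sqlength n {i, (i + 1) mod n} = 1"
    and "target_sqlength n {n - 2, (n - 2 + 1) mod n} = ((real n - 2)\<^sup>2 + 1 / 4)\<^sup>2"
    and "target_sqlength n {n - 1, (n - 1 + 1) mod n} = ((real n - 2)\<^sup>2 - 1 / 4)\<^sup>2"
proof -
  have n3: "3 \<le> n" using n by simp
  show "target_sqlength n {i, (i + 1) mod n} = 1" if i: "i + 2 < n"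
  proof -
    have "i < n" using i by simp
    then show ?thesis
      unfolding boundary_edge_form[OF \<open>i < n\<close> n3] using i by (simp add: reference_polygon_def inner_plane)
  qed
  have e: "n - 2 + 1 = n - 1" "n - 1 < n" "n - 2 < n" using n by simp_all
  have "(n - 2 + 1) mod n = n - 1" using e by simp
  then show "target_sqlength n {n - 2, (n - 2 + 1) mod n} = ((real n - 2)\<^sup>2 + 1 / 4)\<^sup>2"
    unfolding boundary_edge_form[OF e(3) n3] using n
    by (simp add: reference_polygon_def inner_plane of_nat_diff power2_eq_square algebra_simps)
  have "(n - 1 + 1) mod n = 0" using n by simp
  then show "target_sqlength n {n - 1, (n - 1 + 1) mod n} = ((real n - 2)\<^sup>2 - 1 / 4)\<^sup>2"
    unfolding boundary_edge_form[OF e(2) n3] using n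
    by (simp add: reference_polygon_def inner_plane power2_eq_square)
qed

lemma reference_near:
  assumes n: "4 \<le> n" and \<eta>: "0 \<le> \<eta>"
  shows "near_reference n \<eta> (reference_polygon n)"
proof -
  have h: "0 \<le> (real n - 2)\<^sup>2 - 1 / 4"
  proof -
    have "(1::real)\<^sup>2 \<le> (real n - 2)\<^sup>2" using n by (intro power_mono) auto
    then show ?thesis by simp
  qed
  have "0 \<le> orient (reference_polygon n i) (reference_polygon n j) (reference_polygon n k)"
    if ijk: "i < j" "j < k" "k < n" for i j k
  proof -
    have "orient (reference_polygon n i) (reference_polygon n j) (reference_polygon n k) =
        (real j - real i) * (reference_polygon n k $ 2)"
      using ijk by (simp add: reference_polygon_def orient_def cross_def algebra_simps)
    moreover have "0 \<le> reference_polygon n k $ 2" using h by (simp add: reference_polygon_def)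
    ultimately show ?thesis using ijk by simp
  qed
  then show ?thesis using \<eta> by (simp add: near_reference_def weakly_convex_def)
qed

lemma near_square_root:
  fixes x c \<eta> :: real
  assumes "\<bar>x\<^sup>2 - c\<^sup>2\<bar> \<le> \<eta>" "1 \<le> c"
  obtains "\<bar>x - c\<bar> \<le> \<eta>" | "\<bar>x + c\<bar> \<le> \<eta>"
proof (cases "0 \<le> x")
  case True
  have "\<bar>x - c\<bar> * 1 \<le> \<bar>x - c\<bar> * \<bar>x + c\<bar>" using True assms(2) by (intro mult_left_mono) auto
  also have "\<dots> = \<bar>x\<^sup>2 - c\<^sup>2\<bar>" by (simp add: power2_eq_square algebra_simps flip: abs_mult)
  finally show ?thesis using that(1) assms(1) by simp
next
  case False
  have "\<bar>x + c\<bar> * 1 \<le> \<bar>x + c\<bar> * \<bar>x - c\<bar>" using False assms(2) by (intro mult_left_mono) auto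
  also have "\<dots> = \<bar>x\<^sup>2 - c\<^sup>2\<bar>" by (simp add: power2_eq_square algebra_simps flip: abs_mult)
  finally show ?thesis using that(2) assms(1) by simp
qed

text \<open>A polygon on a line would make a signed sum of the side lengths zero. The unit sides contribute an integer of absolute
value at most \<open>m\<close>, up to a small error; the two other sides contribute nearly \<open>1/2\<close> or \<open>2 * m^2\<close>, up to sign,
and this is not within \<open>1/2\<close> of minus such an integer.\<close>

lemma near_reference_not_flat:
  assumes n: "4 \<le> n" and near: "near_reference n \<eta> p" and \<eta>: "0 \<le> \<eta>" "real n * \<eta> < 1 / 2"
  shows "\<not> flat n p"
proof
  assume "flat n p"
  then obtain a d where d: "d \<noteq> 0" and line: "\<And>l. l < n \<Longrightarrow> cross d (p l - a) = 0" unfolding flat_def by blast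
  have n3: "3 \<le> n" using n by simp
  define S where "S l = inner d (p l - a) / norm d" for l
  have len: "inner (p i - p j) (p i - p j) = (S i - S j)\<^sup>2" if ij: "i < n" "j < n" for i j
  proof -
    obtain c where c: "p i - a = c *\<^sub>R d" using cross_zero_imp_parallel[OF line[OF ij(1)] d] by blast
    obtain e where e: "p j - a = e *\<^sub>R d" using cross_zero_imp_parallel[OF line[OF ij(2)] d] by blast
    have "p i - p j = (p i - a) - (p j - a)" by simp
    also have "\<dots> = (c - e) *\<^sub>R d" by (simp add: c e scaleR_left_diff_distrib)
    finally have pij: "p i - p j = (c - e) *\<^sub>R d" .
    have "S i = c * norm d" "S j = e * norm d"
      using d by (simp_all add: S_def c e dot_square_norm power2_eq_square)
    then have "S i - S j = (c - e) * norm d" by (simp add: algebra_simps)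
    then show ?thesis by (simp add: pij power_mult_distrib dot_square_norm)
  qed
  have bd: "\<bar>(S i - S ((i + 1) mod n))\<^sup>2 - target_sqlength n {i, (i + 1) mod n}\<bar> \<le> \<eta>"
    if "i < n" for i
  proof -
    have "\<bar>excess n p {i, (i + 1) mod n}\<bar> \<le> \<eta>"
      using near boundary_edge_memb[OF that] unfolding near_reference_def by blast
    moreover have "edge_form n {i, (i + 1) mod n} p p = (S i - S ((i + 1) mod n))\<^sup>2"
      unfolding boundary_edge_form[OF that n3] using len successor_neq[OF that n3] that by simp
    ultimately show ?thesis by simp
  qed
  have base: "\<exists>N::int. \<bar>N\<bar> \<le> int k \<and> \<bar>S k - S 0 - N\<bar> \<le> k * \<eta>" if "k + 2 \<le> n" for k
    using that
  proof (induction k)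
    case 0
    show ?case by (intro exI[of _ 0]) simp
  next
    case (Suc k)
    then obtain N :: int where N: "\<bar>N\<bar> \<le> int k" "\<bar>S k - S 0 - N\<bar> \<le> k * \<eta>" by auto
    have "\<bar>(S k - S (Suc k))\<^sup>2 - 1\<^sup>2\<bar> \<le> \<eta>"
      using bd[of k] reference_lengths(1)[OF n, of k] Suc.prems by simp
    then consider "\<bar>S k - S (Suc k) - 1\<bar> \<le> \<eta>" | "\<bar>S k - S (Suc k) + 1\<bar> \<le> \<eta>"
      using near_square_root by (metis order_refl)
    then show ?case
    proof cases
      case 1
      have "\<bar>S (Suc k) - S 0 - real_of_int (N - 1)\<bar> \<le> real (Suc k) * \<eta>"
        using 1 N(2) by (simp add: algebra_simps)
      then show ?thesis using N(1) by (intro exI[of _ "N - 1"]) simp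
    next
      case 2
      have "\<bar>S (Suc k) - S 0 - real_of_int (N + 1)\<bar> \<le> real (Suc k) * \<eta>"
        using 2 N(2) by (simp add: algebra_simps)
      then show ?thesis using N(1) by (intro exI[of _ "N + 1"]) simp
    qed
  qed
  define m where "m = real n - 2"
  have m: "2 \<le> m" using n by (simp add: m_def)
  have m2: "2 * m \<le> m\<^sup>2" using m by (simp add: power2_eq_square)
  have "n - 2 + 2 \<le> n" using n by simp
  then obtain N :: int where N: "\<bar>N\<bar> \<le> int (n - 2)" "\<bar>S (n - 2) - S 0 - N\<bar> \<le> (n - 2) * \<eta>"
    using base by blast
  have nn: "(n - 2 + 1) mod n = n - 1" "(n - 1 + 1) mod n = 0" "n - 2 < n" "n - 1 < n" "real (n - 2) = m"
    using n by (simp_all add: m_def of_nat_diff)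
  have NN: "\<bar>real_of_int N\<bar> \<le> m"
  proof -
    have "real_of_int \<bar>N\<bar> \<le> real_of_int (int (n - 2))" using N(1) by linarith
    then show ?thesis using nn(5) by simp
  qed
  have "\<bar>(S (n - 2) - S (n - 1))\<^sup>2 - (m\<^sup>2 + 1 / 4)\<^sup>2\<bar> \<le> \<eta>"
    using bd[OF nn(3), unfolded reference_lengths(2)[OF n], unfolded nn(1)] by (simp add: m_def)
  then consider "\<bar>S (n - 2) - S (n - 1) - (m\<^sup>2 + 1 / 4)\<bar> \<le> \<eta>" | "\<bar>S (n - 2) - S (n - 1) + (m\<^sup>2 + 1 / 4)\<bar> \<le> \<eta>"
    by (rule near_square_root) (use m m2 in auto)
  note B = this
  have "\<bar>(S (n - 1) - S 0)\<^sup>2 - (m\<^sup>2 - 1 / 4)\<^sup>2\<bar> \<le> \<eta>"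
    using bd[OF nn(4), unfolded reference_lengths(3)[OF n], unfolded nn(2)] by (simp add: m_def)
  then consider "\<bar>S (n - 1) - S 0 - (m\<^sup>2 - 1 / 4)\<bar> \<le> \<eta>" | "\<bar>S (n - 1) - S 0 + (m\<^sup>2 - 1 / 4)\<bar> \<le> \<eta>"
    by (rule near_square_root) (use m m2 in auto)
  note A = this
  have small: "m * \<eta> + 2 * \<eta> < 1 / 2" using \<eta> by (simp add: m_def algebra_simps)
  have N2: "\<bar>S (n - 2) - S 0 - N\<bar> \<le> m * \<eta>" using N(2) nn(5) by simp
  have half: "1 / 2 \<le> \<bar>real_of_int N - 1 / 2\<bar>" "1 / 2 \<le> \<bar>real_of_int N + 1 / 2\<bar>"
  proof -
    have "N \<le> 0 \<or> 1 \<le> N" "N \<le> -1 \<or> 0 \<le> N" by linarith+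
    then have "real_of_int N \<le> 0 \<or> 1 \<le> real_of_int N" "real_of_int N \<le> -1 \<or> 0 \<le> real_of_int N" by linarith+
    then show "1 / 2 \<le> \<bar>real_of_int N - 1 / 2\<bar>" "1 / 2 \<le> \<bar>real_of_int N + 1 / 2\<bar>" by linarith+
  qed
  show False
  proof (rule B; rule A)
    assume "\<bar>S (n - 2) - S (n - 1) - (m\<^sup>2 + 1 / 4)\<bar> \<le> \<eta>" "\<bar>S (n - 1) - S 0 - (m\<^sup>2 - 1 / 4)\<bar> \<le> \<eta>"
    then show False using N2 small NN m2 m by linarith
  next
    assume "\<bar>S (n - 2) - S (n - 1) - (m\<^sup>2 + 1 / 4)\<bar> \<le> \<eta>" "\<bar>S (n - 1) - S 0 + (m\<^sup>2 - 1 / 4)\<bar> \<le> \<eta>"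
    then show False using N2 small half by linarith
  next
    assume "\<bar>S (n - 2) - S (n - 1) + (m\<^sup>2 + 1 / 4)\<bar> \<le> \<eta>" "\<bar>S (n - 1) - S 0 - (m\<^sup>2 - 1 / 4)\<bar> \<le> \<eta>"
    then show False using N2 small half by linarith
  next
    assume "\<bar>S (n - 2) - S (n - 1) + (m\<^sup>2 + 1 / 4)\<bar> \<le> \<eta>" "\<bar>S (n - 1) - S 0 + (m\<^sup>2 - 1 / 4)\<bar> \<le> \<eta>"
    then show False using N2 small NN m2 m by linarith
  qed
qed

lemma near_reference_adjacent:
  assumes n: "4 \<le> n" and near: "near_reference n \<eta> p" and \<eta>: "\<eta> < 1" and i: "i < n"
  shows "p i \<noteq> p ((i + 1) mod n)"
proof
  assume eq: "p i = p ((i + 1) mod n)"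
  have n3: "3 \<le> n" using n by simp
  have "4 \<le> (real n - 2)\<^sup>2" using power_mono[of 2 "real n - 2" 2] n by simp
  then have "1\<^sup>2 \<le> ((real n - 2)\<^sup>2 + 1 / 4)\<^sup>2" "1\<^sup>2 \<le> ((real n - 2)\<^sup>2 - 1 / 4)\<^sup>2"
    by (intro power_mono; simp)+
  moreover have "i + 2 < n \<or> i = n - 2 \<or> i = n - 1" using i by linarith
  ultimately have "1 \<le> target_sqlength n {i, (i + 1) mod n}"
    using reference_lengths[OF n] by (metis one_power2 order_refl)
  moreover have "\<bar>excess n p {i, (i + 1) mod n}\<bar> \<le> \<eta>"
    using near boundary_edge_memb[OF i] unfolding near_reference_def by blast
  moreover have "edge_form n {i, (i + 1) mod n} p p = 0"
    unfolding boundary_edge_form[OF i n3] eq by simp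
  ultimately show False using \<eta> by linarith
qed

definition elastic_energy :: "nat \<Rightarrow> nat set set \<Rightarrow> real \<Rightarrow> (nat \<Rightarrow> real^2) \<Rightarrow> real" where
  "elastic_energy n E \<epsilon> p = \<epsilon> * (\<Sum>e\<in>braces n E. edge_form n e p p) -
    (\<Sum>e\<in>boundary_edges n. (excess n p e)\<^sup>2)"

lemma continuous_edge_form: "continuous_on UNIV (\<lambda>p. edge_form n e p p)"
  unfolding edge_form_def
proof (intro continuous_on_sum)
  fix i j
  show "continuous_on UNIV (\<lambda>p :: nat \<Rightarrow> real^2. if {i, j} = e then inner (p i - p j) (p i) else 0)"
    by (cases "{i, j} = e")
      (auto intro!: continuous_intros continuous_on_product_coordinates)
qed

text \<open>Tychonoff's theorem: configurations are functions on all natural numbers.\<close>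

lemma compact_bounded_configurations:
  "compact {p :: nat \<Rightarrow> real^2. \<forall>i. norm (p i) \<le> R}"
proof -
  have "compactin (product_topology (\<lambda>_. euclidean) UNIV) (PiE UNIV (\<lambda>_::nat. cball (0 :: real^2) R))"
    unfolding compactin_PiE by (simp add: compactin_euclidean_iff)
  moreover have "PiE UNIV (\<lambda>_::nat. cball (0 :: real^2) R) = {p. \<forall>i. norm (p i) \<le> R}"
    by (auto simp: PiE_def Pi_def)
  ultimately show ?thesis by (simp add: euclidean_product_topology)
qed

lemma edge_in_range:
  assumes "simple_graph {..<n} E" "e \<in> E"
  obtains a b where "a < n" "b < n" "a \<noteq> b" "e = {a, b}"
  using assms unfolding simple_graph_def by blast

lemma simple_graph_boundary: "3 \<le> n \<Longrightarrow> simple_graph {..<n} (boundary_edges n)"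
  unfolding simple_graph_def boundary_edges_def
  using successor_neq[of _ n] by fastforce

definition diameter_bound :: "nat \<Rightarrow> real" where
  "diameter_bound n = real n * (1 + (\<Sum>e\<in>boundary_edges n. 1 + \<bar>target_sqlength n e\<bar>))"

lemma near_reference_diameter:
  assumes n: "4 \<le> n" and near: "near_reference n \<eta> p" and \<eta>: "\<eta> \<le> 1" and i: "i < n"
  shows "norm (p i - p 0) \<le> diameter_bound n"
proof -
  have n3: "3 \<le> n" using n by simp
  define R where "R = 1 + (\<Sum>e\<in>boundary_edges n. 1 + \<bar>target_sqlength n e\<bar>)"
  have fin: "finite (boundary_edges n)" using simple_graph_finite[OF simple_graph_boundary[OF n3]] .
  have R1: "1 \<le> R" unfolding R_def by (simp add: sum_nonneg)
  have step: "norm (p (Suc k) - p k) \<le> R" if k: "Suc k < n" for k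
  proof -
    let ?e = "{k, (k + 1) mod n}"
    have e: "?e \<in> boundary_edges n" using boundary_edge_memb[of k n] k by simp
    have "(norm (p (Suc k) - p k))\<^sup>2 = edge_form n ?e p p"
      using boundary_edge_form[of k n p p] k n3 by (simp add: dot_square_norm norm_minus_commute)
    also have "\<dots> \<le> 1 + \<bar>target_sqlength n ?e\<bar>"
      using near e \<eta> unfolding near_reference_def by fastforce
    also have "\<dots> \<le> (\<Sum>e\<in>boundary_edges n. 1 + \<bar>target_sqlength n e\<bar>)"
      using e fin by (intro member_le_sum) auto
    also have "\<dots> \<le> R" by (simp add: R_def)
    also have "\<dots> \<le> R\<^sup>2" using R1 by (simp add: power2_eq_square)
    finally show ?thesis using R1 by (simp add: power2_le_iff_abs_le)
  qed
  have "norm (p k - p 0) \<le> real k * R" if "k < n" for k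
    using that
  proof (induction k)
    case (Suc k)
    have "norm (p (Suc k) - p 0) \<le> norm (p (Suc k) - p k) + norm (p k - p 0)"
      using norm_triangle_ineq[of "p (Suc k) - p k" "p k - p 0"] by simp
    also have "\<dots> \<le> R + real k * R" using step Suc by (intro add_mono) auto
    finally show ?case by (simp add: algebra_simps)
  qed simp
  then have "norm (p i - p 0) \<le> real i * R" using i by blast
  also have "\<dots> \<le> real n * R" using i R1 by (intro mult_right_mono) auto
  finally show ?thesis by (simp add: diameter_bound_def R_def)
qed

text \<open>Only configurations with vertex \<open>0\<close> at the origin and with value \<open>0\<close> at indices from \<open>n\<close> on need be
considered, and these are bounded.\<close>

lemma energy_maximiser:
  assumes G: "minimal_braced n E" and \<eta>: "0 \<le> \<eta>" "\<eta> \<le> 1"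
  obtains p where "near_reference n \<eta> p" "\<And>q. near_reference n \<eta> q \<Longrightarrow> elastic_energy n E \<epsilon> q \<le> elastic_energy n E \<epsilon> p"
proof -
  note G' = minimal_bracedD[OF G]
  define r where "r = reference_polygon n"
  define R where "R = diameter_bound n"
  have R0: "0 \<le> R" unfolding R_def diameter_bound_def by (intro mult_nonneg_nonneg add_nonneg_nonneg sum_nonneg) auto
  \<comment> \<open>Translate vertex \<open>0\<close> to the origin, and forget the values that do not matter.\<close>
  define norml where "norml q = (\<lambda>i. if i < n then q i - q 0 else (0 :: real^2))" for q :: "nat \<Rightarrow> real^2"
  have ef: "edge_form n e (norml q) (norml q) = edge_form n e q q" if e: "e \<in> E" for e q
  proof -
    obtain a b where ab: "a < n" "b < n" "a \<noteq> b" "e = {a, b}" using edge_in_range[OF G'(3) e] by blast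
    show ?thesis unfolding ab(4) edge_form_pair[OF ab(1-3)] by (simp add: norml_def ab)
  qed
  have en: "elastic_energy n E \<epsilon> (norml q) = elastic_energy n E \<epsilon> q" for q
  proof -
    have "(\<Sum>e\<in>braces n E. edge_form n e (norml q) (norml q)) = (\<Sum>e\<in>braces n E. edge_form n e q q)"
      by (intro sum.cong refl ef) (simp add: braces_def)
    moreover have "(\<Sum>e\<in>boundary_edges n. (edge_form n e (norml q) (norml q) - target_sqlength n e)\<^sup>2) =
        (\<Sum>e\<in>boundary_edges n. (excess n q e)\<^sup>2)"
      using G'(4) by (intro sum.cong refl) (auto simp: ef)
    ultimately show ?thesis by (simp add: elastic_energy_def)
  qed
  have near: "near_reference n \<eta> (norml q)" if q: "near_reference n \<eta> q" for q
  proof -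
    have "orient (norml q i) (norml q j) (norml q k) = orient (q i) (q j) (q k)" if "i < n" "j < n" "k < n" for i j k
      using that by (simp add: norml_def orient_def)
    then have "weakly_convex n (norml q)" using q by (simp add: near_reference_def weakly_convex_def)
    then show ?thesis using q ef G'(4) by (auto simp: near_reference_def)
  qed
  define K where "K = {p. \<forall>i. norm (p i) \<le> R} \<inter> {p. near_reference n \<eta> p}"
  have "{p. near_reference n \<eta> p} =
      (\<Inter>i. \<Inter>j. \<Inter>k. {p. i < j \<and> j < k \<and> k < n \<longrightarrow> 0 \<le> orient (p i) (p j) (p k)}) \<inter>
      (\<Inter>e\<in>boundary_edges n. {p. \<bar>edge_form n e p p - edge_form n e r r\<bar> \<le> \<eta>})"
    by (auto simp: near_reference_def weakly_convex_def r_def)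
  also have "closed \<dots>"
  proof (intro closed_Int closed_INT ballI)
    fix i j k
    show "closed {p :: nat \<Rightarrow> real^2. i < j \<and> j < k \<and> k < n \<longrightarrow> 0 \<le> orient (p i) (p j) (p k)}"
    proof (cases "i < j \<and> j < k \<and> k < n")
      case True
      have "closed {p :: nat \<Rightarrow> real^2. 0 \<le> orient (p i) (p j) (p k)}"
        unfolding orient_def cross_def
        by (intro closed_Collect_le continuous_intros continuous_on_product_coordinates)
      then show ?thesis using True by simp
    qed (auto simp: closed_UNIV[unfolded UNIV_def])
  next
    fix e
    show "closed {p. \<bar>edge_form n e p p - edge_form n e r r\<bar> \<le> \<eta>}"
      by (intro closed_Collect_le continuous_intros continuous_edge_form)
  qed
  finally have "compact K" unfolding K_def by (intro compact_Int_closed compact_bounded_configurations)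
  have inK: "norml q \<in> K" if q: "near_reference n \<eta> q" for q
  proof -
    have "norm (norml q i) \<le> R" for i
      using near_reference_diameter[OF G'(1) q \<eta>(2), of i] R0 by (auto simp: norml_def R_def)
    then show ?thesis using near[OF q] by (simp add: K_def)
  qed
  have "K \<noteq> {}" using inK[OF reference_near[OF G'(1) \<eta>(1)]] by blast
  moreover have "continuous_on K (elastic_energy n E \<epsilon>)"
    unfolding elastic_energy_def[abs_def]
    by (intro continuous_intros continuous_on_subset[OF continuous_edge_form]) auto
  ultimately obtain p where p: "p \<in> K" "\<And>q. q \<in> K \<Longrightarrow> elastic_energy n E \<epsilon> q \<le> elastic_energy n E \<epsilon> p"
    using continuous_attains_sup[OF \<open>compact K\<close>] by blast
  show ?thesis
  proof (rule that)
    show "near_reference n \<eta> p" using p(1) by (simp add: K_def)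
    show "elastic_energy n E \<epsilon> q \<le> elastic_energy n E \<epsilon> p" if "near_reference n \<eta> q" for q
      using p(2)[OF inK[OF that]] by (simp add: en)
  qed
qed

section \<open>Maximisers of the energy are properly stressed\<close>

text \<open>On the line through \<open>a\<close> with direction \<open>d\<close> this is a concave parabola, with zeros at the extreme vertices
on the line. Displacing the vertices by it makes the side strictly convex.\<close>

definition bulge :: "nat \<Rightarrow> (nat \<Rightarrow> real^2) \<Rightarrow> real^2 \<Rightarrow> real^2 \<Rightarrow> nat \<Rightarrow> real" where
  "bulge n p a d l = (let S = (\<lambda>l. inner d (p l - a)); L = {l. l < n \<and> cross d (p l - a) = 0} in
    if l \<in> L then (S l - Min (S ` L)) * (Max (S ` L) - S l) else 0)"

lemma bulge_nonneg: "0 \<le> bulge n p a d l"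
  unfolding bulge_def Let_def by (auto intro!: mult_nonneg_nonneg)

lemma bulge_pos_between:
  assumes "0 < bulge n p a d l"
  obtains u v where "l < n" "cross d (p l - a) = 0" "u < n" "cross d (p u - a) = 0" "v < n" "cross d (p v - a) = 0"
    "inner d (p u - a) < inner d (p l - a)" "inner d (p l - a) < inner d (p v - a)"
proof -
  define S where "S l = inner d (p l - a)" for l
  define L where "L = {l. l < n \<and> cross d (p l - a) = 0}"
  have b: "bulge n p a d l = (if l \<in> L then (S l - Min (S ` L)) * (Max (S ` L) - S l) else 0)"
    by (simp add: bulge_def S_def[abs_def] L_def Let_def)
  have l: "l \<in> L" using assms b by (auto split: if_splits)
  have fin: "finite L" by (simp add: L_def)
  have "Min (S ` L) \<in> S ` L" "Max (S ` L) \<in> S ` L" using fin l by (auto intro!: Min_in Max_in)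
  then obtain u v where uv: "u \<in> L" "Min (S ` L) = S u" "v \<in> L" "Max (S ` L) = S v" by auto
  have "S u \<le> S l" "S l \<le> S v" unfolding uv(2)[symmetric] uv(4)[symmetric] using fin l by auto
  moreover have "0 < (S l - S u) * (S v - S l)" using assms b l uv by simp
  ultimately have "S u < S l" "S l < S v" by (auto simp: zero_less_mult_iff)
  then show ?thesis using that[of u v] l uv by (simp add: S_def L_def)
qed

lemma bulge_posI:
  assumes "l < n" "cross d (p l - a) = 0" "u < n" "cross d (p u - a) = 0" "v < n" "cross d (p v - a) = 0"
    "inner d (p u - a) < inner d (p l - a)" "inner d (p l - a) < inner d (p v - a)"
  shows "0 < bulge n p a d l"
proof -
  define S where "S l = inner d (p l - a)" for l
  define L where "L = {l. l < n \<and> cross d (p l - a) = 0}"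
  have b: "bulge n p a d l = (if l \<in> L then (S l - Min (S ` L)) * (Max (S ` L) - S l) else 0)"
    by (simp add: bulge_def S_def[abs_def] L_def Let_def)
  have L: "l \<in> L" "u \<in> L" "v \<in> L" "finite L" using assms by (auto simp: L_def)
  have "Min (S ` L) \<le> S u" "S v \<le> Max (S ` L)" using L by auto
  then show ?thesis using assms(7,8) L(1) unfolding b S_def[symmetric] by simp
qed

lemma bulge_off: "cross d (p l - a) \<noteq> 0 \<Longrightarrow> bulge n p a d l = 0"
  by (simp add: bulge_def Let_def)

text \<open>The linear and constant parts of the parabola cancel, and its quadratic part is a Vandermonde determinant.\<close>

lemma bulge_vandermonde:
  assumes "l < n" "m < n" "k < n"
    and "cross d (p l - a) = 0" "cross d (p m - a) = 0" "cross d (p k - a) = 0"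
  shows "(inner d (p k - a) - inner d (p l - a)) * (bulge n p a d m - bulge n p a d l) -
      (inner d (p m - a) - inner d (p l - a)) * (bulge n p a d k - bulge n p a d l) =
    (inner d (p m - a) - inner d (p l - a)) * (inner d (p k - a) - inner d (p m - a)) *
      (inner d (p k - a) - inner d (p l - a))"
  using assms by (simp add: bulge_def Let_def algebra_simps)

text \<open>The line through \<open>a\<close> with direction \<open>d\<close> supports the polygon, which is on its left. The position of a vertex along the
line is \<open>spos\<close>, and \<open>push\<close> is its displacement outwards, orthogonal to the line.\<close>

context
  fixes n :: nat and p :: "nat \<Rightarrow> real^2" and a d :: "real^2"
  assumes wc: "weakly_convex n p" and inj: "inj_on p {..<n}" and d: "d \<noteq> 0"
    and left: "\<And>l. l < n \<Longrightarrow> 0 \<le> cross d (p l - a)"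
    and off: "\<exists>m<n. 0 < cross d (p m - a)"
begin

abbreviation (input) "side l \<equiv> l < n \<and> cross d (p l - a) = 0"
abbreviation (input) "spos l \<equiv> inner d (p l - a)"
abbreviation (input) "push l \<equiv> - (bulge n p a d l *\<^sub>R perp d)"

text \<open>If a vertex \<open>l\<close> on the side is adjacent to a vertex \<open>m\<close> off the side, then no other vertex comes
between them in cyclic order, so that seen from \<open>m\<close> all vertices of the side lie beyond \<open>l\<close> in the same direction. Thus \<open>l\<close> is
an extreme vertex of the side, where the parabola has a zero.\<close>

lemma side_neighbour_extreme:
  assumes l: "side l" and m: "m < n" "\<not> side m" and adj: "m = (l + 1) mod n \<or> l = (m + 1) mod n" and n: "3 \<le> n"
  shows "bulge n p a d l = 0"
proof (rule ccontr)
  assume "bulge n p a d l \<noteq> 0"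
  then have "0 < bulge n p a d l" using bulge_nonneg[of n p a d l] by linarith
  then obtain u v where uv: "side u" "side v" "spos u < spos l" "spos l < spos v"
    using bulge_pos_between by metis
  have mpos: "0 < cross d (p m - a)" using left[OF m(1)] m by auto
  have ne: "u \<noteq> l" "v \<noteq> l" "u \<noteq> m" "v \<noteq> m" using uv m by auto
  have order: "spos x \<le> spos y" if "side x" "side y" "cyclic x y m" for x y
    using weakly_convex_line_order[OF wc d _ _ _ _ m(1) mpos that(3)] that by blast
  from adj show False
  proof
    assume "m = (l + 1) mod n"
    then have "cyclic l m v" using cyclic_successor[of l n v] l uv ne n by simp
    then have "cyclic v l m" by (auto simp: cyclic_def)
    then show False using order[of v l] uv l by simp
  next
    assume "l = (m + 1) mod n"
    then have "cyclic m l u" using cyclic_successor[of m n u] m uv ne n by simp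
    then have "cyclic l u m" by (auto simp: cyclic_def)
    then show False using order[of l u] uv l by simp
  qed
qed

lemma push_work:
  assumes "l < n" "m < n"
  shows "inner (p l - p m) (push l - push m) = bulge n p a d l * cross d (p m - a) + bulge n p a d m * cross d (p l - a)"
proof -
  have e: "inner (p l - p m) (perp d) = cross d (p l - a) - cross d (p m - a)"
    by (simp add: inner_commute[of _ "perp d"] inner_perp cross_def algebra_simps)
  have z: "bulge n p a d l * cross d (p l - a) = 0" "bulge n p a d m * cross d (p m - a) = 0"
    using bulge_off by (metis mult_eq_0_iff)+
  have "inner x (- (\<alpha> *\<^sub>R y) - - (\<beta> *\<^sub>R y)) = (\<beta> - \<alpha>) * inner x y" for x y :: "real^2" and \<alpha> \<beta>
    by (simp add: inner_diff_right left_diff_distrib)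
  then have "inner (p l - p m) (push l - push m) = (bulge n p a d m - bulge n p a d l) * inner (p l - p m) (perp d)" .
  then show ?thesis unfolding e using z by (simp only: left_diff_distrib right_diff_distrib)
qed

text \<open>Triangles of positive orientation stay positive for a while. A degenerate triangle on the side becomes convex, since the
displacement is concave. A degenerate triangle on another line does not move: a vertex strictly inside the side has
vertices on both sides of any other line through it, which is impossible for a line that contains three vertices.\<close>

lemma push_weakly_convex:
  "eventually (\<lambda>t. weakly_convex n (\<lambda>l. p l + t *\<^sub>R push l)) (at_right 0)"
proof -
  define q where "q t l = p l + t *\<^sub>R push l" for t l
  define T where "T = {(i, j, k). i < j \<and> j < k \<and> k < n}"
  have "T \<subseteq> {..<n} \<times> {..<n} \<times> {..<n}" by (auto simp: T_def)
  then have finT: "finite T" by (rule finite_subset) auto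
  have "eventually (\<lambda>t. 0 \<le> orient (q t i) (q t j) (q t k)) (at_right 0)" if ijk: "i < j" "j < k" "k < n" for i j k
  proof (cases "orient (p i) (p j) (p k) = 0")
    case False
    then have "0 < orient (p i) (p j) (p k)" using wc ijk by (auto simp: weakly_convex_def less_le)
    moreover have lim: "((\<lambda>t. q t l) \<longlongrightarrow> p l) (at_right 0)" for l
    proof -
      have "((\<lambda>t. p l + t *\<^sub>R push l) \<longlongrightarrow> p l + 0 *\<^sub>R push l) (at_right 0)" by (intro tendsto_intros)
      then show ?thesis by (simp add: q_def)
    qed
    have "((\<lambda>t. orient (q t i) (q t j) (q t k)) \<longlongrightarrow> orient (p i) (p j) (p k)) (at_right 0)"
      unfolding orient_def cross_def by (intro tendsto_intros lim)
    ultimately have "eventually (\<lambda>t. 0 < orient (q t i) (q t j) (q t k)) (at_right 0)"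
      by (intro order_tendstoD(1))
    then show ?thesis by (rule eventually_mono) simp
  next
    case zero: True
    show ?thesis
    proof (cases "side i \<and> side j \<and> side k")
      case True
      have on: "p x = a + (spos x / inner d d) *\<^sub>R d" if "side x" for x
        using point_on_line[of d "p x" a] that d by blast
      have V: "orient (q t i) (q t j) (q t k) = t * ((spos j - spos i) * (spos k - spos j) * (spos k - spos i))" for t
      proof -
        define \<beta> where "\<beta> x = bulge n p a d x" for x
        have dd: "inner d d \<noteq> 0" using d by simp
        have q: "q t x - q t y = ((spos x - spos y) / inner d d) *\<^sub>R d - (t * (\<beta> x - \<beta> y)) *\<^sub>R perp d"
          if "side x" "side y" for x y
        proof -
          have "q t x - q t y = (p x - p y) - (t * (\<beta> x - \<beta> y)) *\<^sub>R perp d"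
            by (simp add: q_def \<beta>_def algebra_simps)
          also have "p x - p y = ((spos x - spos y) / inner d d) *\<^sub>R d"
            using on[OF that(1)] on[OF that(2)]
            by (metis (no_types, lifting) add_diff_cancel_left diff_divide_distrib scaleR_left_diff_distrib)
          finally show ?thesis .
        qed
        have cr: "cross (x *\<^sub>R d - y *\<^sub>R perp d) (z *\<^sub>R d - w *\<^sub>R perp d) = (y * z - x * w) * inner d d" for x y z w
          by (simp add: cross_def perp_def inner_plane algebra_simps)
        have "orient (q t i) (q t j) (q t k) =
            (t * (\<beta> j - \<beta> i) * ((spos k - spos i) / inner d d) - (spos j - spos i) / inner d d * (t * (\<beta> k - \<beta> i))) * inner d d"
          unfolding orient_def q[OF conjunct1[OF conjunct2[OF True]] conjunct1[OF True]]
            q[OF conjunct2[OF conjunct2[OF True]] conjunct1[OF True]] cr by simp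
        also have "\<dots> = t * ((spos k - spos i) * (\<beta> j - \<beta> i) - (spos j - spos i) * (\<beta> k - \<beta> i))"
          using dd by (simp add: field_simps)
        finally show ?thesis unfolding \<beta>_def using bulge_vandermonde[of i n j k d p a] True by simp
      qed
      obtain m where m: "m < n" "0 < cross d (p m - a)" using off by blast
      have "0 \<le> (spos j - spos i) * (spos k - spos j) * (spos k - spos i)"
        using weakly_convex_line_cyclic[OF wc d ijk _ _ _ m] True by blast
      then have "0 \<le> orient (q t i) (q t j) (q t k)" if "0 < t" for t
        unfolding V using that by simp
      then show ?thesis unfolding eventually_at_right_field by (intro exI[of _ 1]) auto
    next
      case notall: False
      have nomove: "bulge n p a d x = 0" if x: "x = i \<or> x = j \<or> x = k" for x
      proof (rule ccontr)
        assume "bulge n p a d x \<noteq> 0"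
        then have "0 < bulge n p a d x" using bulge_nonneg[of n p a d x] by linarith
        then obtain u v where uv: "side x" "side u" "side v" "spos u < spos x" "spos x < spos v"
          using bulge_pos_between by metis
        define d' where "d' = p j - p i"
        have d': "d' \<noteq> 0" using inj_onD[OF inj, of j i] ijk by (auto simp: d'_def)
        have on': "cross d' (p i - p i) = 0" "cross d' (p j - p i) = 0" "cross d' (p k - p i) = 0"
          using zero by (simp_all add: d'_def orient_def cross_linear(3))
        have x0: "cross d' (p x - p i) = 0" using x on' by auto
        have rel: "cross d' (p y - p i) = (spos y - spos x) / inner d d * cross d' d" if "side y" for y
        proof -
          have "p y - p x = ((spos y - spos x) / inner d d) *\<^sub>R d"
            using point_on_line[of d "p y" a] point_on_line[of d "p x" a] that uv(1) d
            by (metis (no_types, lifting) add_diff_cancel_left diff_divide_distrib scaleR_left_diff_distrib)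
          then have "cross d' (p y - p x) = (spos y - spos x) / inner d d * cross d' d"
            by (simp only: cross_linear)
          moreover have "cross d' (p y - p i) = cross d' (p y - p x) + cross d' (p x - p i)"
            by (simp add: cross_def algebra_simps)
          ultimately show ?thesis using x0 by simp
        qed
        have dd: "0 < inner d d" using d by simp
        have "cross d' d = 0"
        proof (rule ccontr)
          assume c: "cross d' d \<noteq> 0"
          have "cross d' (p u - p i) * cross d' (p v - p i) =
              ((spos u - spos x) * (spos v - spos x)) * (cross d' d / inner d d)\<^sup>2"
            unfolding rel[OF uv(2)] rel[OF uv(3)] by (simp add: power2_eq_square)
          also have "\<dots> < 0" using uv c dd by (intro mult_neg_pos) auto
          finally have neg: "cross d' (p u - p i) * cross d' (p v - p i) < 0" .
          from weakly_convex_one_side[OF wc inj d' ijk on'] uv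
          have "0 \<le> cross d' (p u - p i) * cross d' (p v - p i)"
            by (auto intro: mult_nonneg_nonneg mult_nonpos_nonpos)
          then show False using neg by linarith
        qed
        then obtain c where c: "d = c *\<^sub>R d'" using cross_zero_imp_parallel d' by blast
        have "side y" if "cross d' (p y - p i) = 0" "y < n" for y
        proof -
          have "cross d' (p y - p x) = 0"
            using that(1) x0 by (simp add: cross_def algebra_simps)
          moreover have "cross (c *\<^sub>R d') z = c * cross d' z" for z
            by (simp add: cross_def algebra_simps)
          ultimately have "cross d (p y - p x) = 0" by (simp add: c)
          then have "cross d (p y - a) = 0" using uv(1) by (simp add: cross_def algebra_simps)
          then show ?thesis using that by simp
        qed
        then have "side i \<and> side j \<and> side k" using on' ijk by auto
        then show False using notall by blast
      qed
      have "orient (q t i) (q t j) (q t k) = 0" for t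
        using nomove zero by (simp add: q_def)
      then show ?thesis by simp
    qed
  qed
  then have "eventually (\<lambda>t. \<forall>x\<in>T. case x of (i, j, k) \<Rightarrow> 0 \<le> orient (q t i) (q t j) (q t k)) (at_right 0)"
    using finT by (intro eventually_ball_finite) (auto simp: T_def)
  then show ?thesis
    by (rule eventually_mono) (auto simp: T_def weakly_convex_def q_def)
qed

end

lemma edge_form_line:
  assumes G: "simple_graph {..<n} E" and e: "e \<in> E"
  shows "edge_form n e (\<lambda>i. p i + t *\<^sub>R \<delta> i) (\<lambda>i. p i + t *\<^sub>R \<delta> i) =
    edge_form n e p p + 2 * t * edge_form n e p \<delta> + t\<^sup>2 * edge_form n e \<delta> \<delta>"
proof -
  obtain a b where ab: "a < n" "b < n" "a \<noteq> b" "e = {a, b}" using edge_in_range[OF G e] by blast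
  have "(p a + t *\<^sub>R \<delta> a) - (p b + t *\<^sub>R \<delta> b) = (p a - p b) + t *\<^sub>R (\<delta> a - \<delta> b)"
    by (simp add: algebra_simps)
  moreover have "inner (x + t *\<^sub>R y) (x + t *\<^sub>R y) = inner x x + 2 * t * inner x y + t\<^sup>2 * inner y y" for x y :: "real^2"
    by (simp add: inner_plane power2_eq_square algebra_simps)
  ultimately show ?thesis unfolding ab(4) edge_form_pair[OF ab(1-3)] by (simp only:)
qed

text \<open>The energy is polynomial along a line of configurations.\<close>

lemma energy_derivative:
  assumes G: "minimal_braced n E"
  shows "((\<lambda>t. elastic_energy n E \<epsilon> (\<lambda>i. p i + t *\<^sub>R \<delta> i)) has_real_derivative
    \<epsilon> * (\<Sum>e\<in>braces n E. 2 * edge_form n e p \<delta>) -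
    (\<Sum>e\<in>boundary_edges n. 2 * (excess n p e) *
      (2 * edge_form n e p \<delta>))) (at 0)"
proof -
  note G' = minimal_bracedD[OF G]
  define L where "L e = target_sqlength n e" for e
  define g where "g e t = edge_form n e p p + 2 * t * edge_form n e p \<delta> + t\<^sup>2 * edge_form n e \<delta> \<delta>" for e t
  have eq: "elastic_energy n E \<epsilon> (\<lambda>i. p i + t *\<^sub>R \<delta> i) = \<epsilon> * (\<Sum>e\<in>braces n E. g e t) - (\<Sum>e\<in>boundary_edges n. (g e t - L e)\<^sup>2)" for t
  proof -
    have "edge_form n e (\<lambda>i. p i + t *\<^sub>R \<delta> i) (\<lambda>i. p i + t *\<^sub>R \<delta> i) = g e t" if "e \<in> E" for e
      unfolding g_def by (rule edge_form_line[OF G'(3) that])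
    then show ?thesis unfolding elastic_energy_def L_def[symmetric] using G'(4)
      by (intro arg_cong2[where f = "(-)"] arg_cong2[where f = "(*)"] sum.cong refl) (auto simp: braces_def)
  qed
  have dg: "(g e has_real_derivative 2 * edge_form n e p \<delta>) (at 0)" for e
    unfolding g_def[abs_def] by (auto intro!: derivative_eq_intros)
  have g0: "g e 0 = edge_form n e p p" for e by (simp add: g_def)
  have dsq: "((\<lambda>t. (g e t - L e)\<^sup>2) has_real_derivative 2 * (edge_form n e p p - L e) * (2 * edge_form n e p \<delta>)) (at 0)" for e
    by (rule derivative_eq_intros dg refl | simp add: g0)+
  show ?thesis
    unfolding eq L_def[symmetric]
    by (intro DERIV_diff DERIV_cmult DERIV_sum dg dsq)
qed

lemma eventually_near_lengths:
  assumes G: "minimal_braced n E" and strict: "\<And>e. e \<in> boundary_edges n \<Longrightarrow>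
    \<bar>excess n p e\<bar> < \<eta>"
  shows "eventually (\<lambda>t. \<forall>e\<in>boundary_edges n. \<bar>excess n (\<lambda>i. p i + t *\<^sub>R \<delta> i) e\<bar> \<le> \<eta>) (at 0)"
proof (rule eventually_ball_finite)
  note G' = minimal_bracedD[OF G]
  show "finite (boundary_edges n)" using simple_graph_finite[OF G'(3)] G'(4) finite_subset by blast
  show "\<forall>e\<in>boundary_edges n. eventually (\<lambda>t. \<bar>excess n (\<lambda>i. p i + t *\<^sub>R \<delta> i) e\<bar> \<le> \<eta>) (at 0)"
  proof
    fix e assume e: "e \<in> boundary_edges n"
    let ?L = "target_sqlength n e"
    have eE: "e \<in> E" using e G'(4) by blast
    have "((\<lambda>t. \<bar>edge_form n e p p + 2 * t * edge_form n e p \<delta> + t\<^sup>2 * edge_form n e \<delta> \<delta> - ?L\<bar>) \<longlongrightarrow>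
        \<bar>edge_form n e p p + 2 * 0 * edge_form n e p \<delta> + 0\<^sup>2 * edge_form n e \<delta> \<delta> - ?L\<bar>) (at 0)"
      by (intro tendsto_intros)
    then have "((\<lambda>t. \<bar>edge_form n e p p + 2 * t * edge_form n e p \<delta> + t\<^sup>2 * edge_form n e \<delta> \<delta> - ?L\<bar>) \<longlongrightarrow>
        \<bar>edge_form n e p p - ?L\<bar>) (at 0)" by simp
    then have "eventually (\<lambda>t. \<bar>edge_form n e p p + 2 * t * edge_form n e p \<delta> + t\<^sup>2 * edge_form n e \<delta> \<delta> - ?L\<bar> < \<eta>) (at 0)"
      using strict[OF e] by (rule order_tendstoD(2))
    then show "eventually (\<lambda>t. \<bar>edge_form n e (\<lambda>i. p i + t *\<^sub>R \<delta> i) (\<lambda>i. p i + t *\<^sub>R \<delta> i) - ?L\<bar> \<le> \<eta>) (at 0)"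
      unfolding edge_form_line[OF G'(3) eE] by (rule eventually_mono) simp
  qed
qed

text \<open>The energy of a maximiser is at least that of the reference polygon, which is nonnegative. So the penalty is at most
the total reward of the braces, which is small by the choice of \<open>\<epsilon>\<close>.\<close>

lemma maximiser_strict_lengths:
  assumes G: "minimal_braced n E" and near: "near_reference n \<eta> p" and \<eta>: "0 < \<eta>" "\<eta> \<le> 1"
    and max: "\<And>q. near_reference n \<eta> q \<Longrightarrow> elastic_energy n E \<epsilon> q \<le> elastic_energy n E \<epsilon> p"
    and \<epsilon>: "0 < \<epsilon>" "\<epsilon> * (card (braces n E) * (2 * diameter_bound n)\<^sup>2) < \<eta>\<^sup>2"
    and e: "e \<in> boundary_edges n"
  shows "\<bar>excess n p e\<bar> < \<eta>"
proof -
  note G' = minimal_bracedD[OF G]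
  let ?r = "reference_polygon n"
  have fin: "finite (boundary_edges n)" using simple_graph_finite[OF G'(3)] G'(4) finite_subset by blast
  have bound: "0 \<le> edge_form n f q q" if br: "f \<in> braces n E" for f q
  proof -
    obtain a b where ab: "a < n" "b < n" "a \<noteq> b" "f = {a, b}"
      using edge_in_range[OF G'(3)] br unfolding braces_def by blast
    then show ?thesis by (simp add: edge_form_pair)
  qed
  have upper: "edge_form n f p p \<le> (2 * diameter_bound n)\<^sup>2" if br: "f \<in> braces n E" for f
  proof -
    obtain a b where ab: "a < n" "b < n" "a \<noteq> b" "f = {a, b}"
      using edge_in_range[OF G'(3)] br unfolding braces_def by blast
    have "norm (p a - p b) \<le> norm (p a - p 0) + norm (p b - p 0)"
      using norm_triangle_ineq4[of "p a - p 0" "p b - p 0"] by simp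
    also have "\<dots> \<le> 2 * diameter_bound n"
      using near_reference_diameter[OF G'(1) near \<eta>(2) ab(1)]
        near_reference_diameter[OF G'(1) near \<eta>(2) ab(2)] by linarith
    finally have "(norm (p a - p b))\<^sup>2 \<le> (2 * diameter_bound n)\<^sup>2" by (intro power_mono) auto
    then show ?thesis unfolding ab(4) edge_form_pair[OF ab(1-3)] by (simp add: dot_square_norm)
  qed
  have "0 \<le> elastic_energy n E \<epsilon> ?r"
    unfolding elastic_energy_def using bound \<epsilon>(1) by (simp add: sum_nonneg)
  also have "\<dots> \<le> elastic_energy n E \<epsilon> p" using max reference_near[OF G'(1)] \<eta>(1) by simp
  finally have "(\<Sum>e\<in>boundary_edges n. (edge_form n e p p - edge_form n e ?r ?r)\<^sup>2) \<le> \<epsilon> * (\<Sum>e\<in>braces n E. edge_form n e p p)"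
    by (simp add: elastic_energy_def)
  also have "\<dots> \<le> \<epsilon> * (card (braces n E) * (2 * diameter_bound n)\<^sup>2)"
    using \<epsilon>(1) sum_bounded_above[of "braces n E" "\<lambda>e. edge_form n e p p"] upper by (intro mult_left_mono) auto
  finally have "(\<Sum>e\<in>boundary_edges n. (edge_form n e p p - edge_form n e ?r ?r)\<^sup>2) < \<eta>\<^sup>2" using \<epsilon>(2) by linarith
  moreover have "(edge_form n e p p - edge_form n e ?r ?r)\<^sup>2 \<le> (\<Sum>e\<in>boundary_edges n. (edge_form n e p p - edge_form n e ?r ?r)\<^sup>2)"
    using e fin by (intro member_le_sum) auto
  ultimately have "\<bar>edge_form n e p p - edge_form n e ?r ?r\<bar>\<^sup>2 < \<eta>\<^sup>2" by simp
  then show ?thesis by (rule power2_less_imp_less) (use \<eta>(1) in simp)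
qed

text \<open>Suppose that three vertices are collinear. All vertices lie on one side of their line, and bulging this side outwards is
an admissible displacement. It does no work on the boundary: a side within the line is displaced orthogonally, and
a side that leaves the line starts at an extreme vertex, which stays put. No brace is shortened to first order.
Removing the two extreme vertices of the line leaves the graph connected, so some brace joins a vertex strictly inside
to a vertex off the line, and this brace is lengthened to first order. So the energy increases.\<close>

lemma maximiser_convex_position:
  assumes G: "minimal_braced n E" and near: "near_reference n \<eta> p" and \<eta>: "0 < \<eta>" "\<eta> < 1" "real n * \<eta> < 1 / 2"
    and max: "\<And>q. near_reference n \<eta> q \<Longrightarrow> elastic_energy n E \<epsilon> q \<le> elastic_energy n E \<epsilon> p"
    and \<epsilon>: "0 < \<epsilon>" and strict: "\<And>e. e \<in> boundary_edges n \<Longrightarrow>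
      \<bar>excess n p e\<bar> < \<eta>"
  shows "convex_position 1 n p"
proof (rule ccontr)
  assume ncp: "\<not> convex_position 1 n p"
  note G' = minimal_bracedD[OF G]
  have wc: "weakly_convex n p" using near by (simp add: near_reference_def)
  have nf: "\<not> flat n p" using near_reference_not_flat[OF G'(1) near _ \<eta>(3)] \<eta>(1) by simp
  have inj: "inj_on p {..<n}"
    by (rule inj_on_weakly_convex[OF wc nf G'(2)]) (rule near_reference_adjacent[OF G'(1) near \<eta>(2)])
  obtain i j k where ijk: "i < j" "j < k" "k < n" "\<not> 0 < orient (p i) (p j) (p k)"
    using ncp unfolding convex_position_def by auto
  then have zero: "orient (p i) (p j) (p k) = 0" using wc unfolding weakly_convex_def by force
  define a where "a = p i"
  define d0 where "d0 = p j - p i"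
  have d0: "d0 \<noteq> 0" using inj_onD[OF inj, of j i] ijk by (auto simp: d0_def)
  have on0: "cross d0 (p i - a) = 0" "cross d0 (p j - a) = 0" "cross d0 (p k - a) = 0"
    using zero by (simp_all add: a_def d0_def orient_def cross_linear(3))
  have negc: "cross (- x) y = - cross x y" for x y by (simp add: cross_def)
  \<comment> \<open>Direct the line so that the polygon is on its left.\<close>
  obtain d where d: "d \<noteq> 0" "cross d (p i - a) = 0" "cross d (p j - a) = 0" "cross d (p k - a) = 0"
    and left: "\<And>l. l < n \<Longrightarrow> 0 \<le> cross d (p l - a)"
  proof (cases "\<forall>l<n. 0 \<le> cross d0 (p l - a)")
    case True
    then show ?thesis using that[of d0] d0 on0 by blast
  next
    case False
    then have "\<forall>l<n. cross d0 (p l - a) \<le> 0"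
      using weakly_convex_one_side[OF wc inj d0 ijk(1-3) on0] by blast
    then show ?thesis using that[of "- d0"] d0 on0 by (simp add: negc)
  qed
  have off: "\<exists>m<n. 0 < cross d (p m - a)"
    using nf d(1) left unfolding flat_def by (metis less_eq_real_def)
  define \<beta> where "\<beta> l = bulge n p a d l" for l
  define \<delta> where "\<delta> l = - (bulge n p a d l *\<^sub>R perp d)" for l
  note sctx = wc inj d(1) left off
  have bge: "0 \<le> \<beta> l" for l unfolding \<beta>_def by (rule bulge_nonneg)
  have work: "edge_form n {l, m} p \<delta> = \<beta> l * cross d (p m - a) + \<beta> m * cross d (p l - a)"
    if "l < n" "m < n" "l \<noteq> m" for l m
    unfolding edge_form_pair[OF that] \<delta>_def \<beta>_def by (rule push_work[OF sctx that(1,2)])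
  have boundary: "edge_form n e p \<delta> = 0" if e: "e \<in> boundary_edges n" for e
  proof -
    obtain l where l: "l < n" "e = {l, (l + 1) mod n}" using e unfolding boundary_edges_def by blast
    define m where "m = (l + 1) mod n"
    have m: "m < n" "l \<noteq> m" using successor_neq[OF l(1) G'(2)] by (auto simp: m_def)
    note nb = side_neighbour_extreme[OF sctx _ _ _ _ G'(2)]
    have ef: "edge_form n e p \<delta> = \<beta> l * cross d (p m - a) + \<beta> m * cross d (p l - a)"
      using work[OF l(1) m] l m_def by simp
    show ?thesis
    proof (cases "cross d (p l - a) = 0")
      case True
      have "\<beta> l * cross d (p m - a) = 0"
      proof (cases "cross d (p m - a) = 0")
        case False
        then have "\<beta> l = 0" unfolding \<beta>_def using nb[of l m] True l(1) m(1) m_def by blast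
        then show ?thesis by simp
      qed simp
      then show ?thesis using ef True by simp
    next
      case False
      have "\<beta> m * cross d (p l - a) = 0"
      proof (cases "cross d (p m - a) = 0")
        case True
        then have "\<beta> m = 0" unfolding \<beta>_def using nb[of m l] False l(1) m(1) m_def by blast
        then show ?thesis by simp
      next
        case False
        then show ?thesis by (simp add: \<beta>_def bulge_off)
      qed
      moreover have "\<beta> l = 0" using False by (simp add: \<beta>_def bulge_off)
      ultimately show ?thesis using ef by simp
    qed
  qed
  have brace_ge: "0 \<le> edge_form n e p \<delta>" if e: "e \<in> braces n E" for e
  proof -
    obtain l m where lm: "l < n" "m < n" "l \<noteq> m" "e = {l, m}"
      using edge_in_range[OF G'(3)] e unfolding braces_def by blast
    show ?thesis unfolding lm(4) work[OF lm(1-3)]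
      using bge left lm by (intro add_nonneg_nonneg mult_nonneg_nonneg) auto
  qed
  obtain e where e: "e \<in> braces n E" "0 < edge_form n e p \<delta>"
  proof -
    let ?S = "\<lambda>l. inner d (p l - a)"
    have distinct: "?S i \<noteq> ?S j" "?S j \<noteq> ?S k" "?S i \<noteq> ?S k"
      using on_line_inj[OF inj d(1,2,3)] on_line_inj[OF inj d(1,3,4)] on_line_inj[OF inj d(1,2,4)] ijk by auto
    have "\<exists>l. l < n \<and> 0 < \<beta> l"
    proof -
      have bp: "0 < \<beta> y" if "x \<in> {i, j, k}" "y \<in> {i, j, k}" "z \<in> {i, j, k}" "?S x < ?S y" "?S y < ?S z" for x y z
        unfolding \<beta>_def by (rule bulge_posI[of _ _ _ _ _ x z]) (use that d ijk in auto)
      consider "?S i < ?S j" "?S j < ?S k" | "?S i < ?S k" "?S k < ?S j" | "?S j < ?S i" "?S i < ?S k"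
        | "?S j < ?S k" "?S k < ?S i" | "?S k < ?S i" "?S i < ?S j" | "?S k < ?S j" "?S j < ?S i"
        using distinct by linarith
      then have "0 < \<beta> i \<or> 0 < \<beta> j \<or> 0 < \<beta> k" by cases (use bp in blast)+
      then show ?thesis using ijk by (metis order_less_trans)
    qed
    then obtain l where l: "l < n" "0 < \<beta> l" by blast
    define L where "L = {l. l < n \<and> cross d (p l - a) = 0}"
    have finL: "finite L" by (simp add: L_def)
    have lL: "l \<in> L" using l bulge_off[of d p l a n] by (auto simp: L_def \<beta>_def)
    have "Min (?S ` L) \<in> ?S ` L" "Max (?S ` L) \<in> ?S ` L" using finL lL by (auto intro!: Min_in Max_in)
    then obtain u v where uv: "u \<in> L" "Min (?S ` L) = ?S u" "v \<in> L" "Max (?S ` L) = ?S v" by auto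
    have uvn: "u < n" "v < n" using uv by (auto simp: L_def)
    have bu: "\<beta> x = (?S x - ?S u) * (?S v - ?S x)" if "x \<in> L" for x
      using that uv by (simp add: \<beta>_def bulge_def Let_def L_def)
    define X where "X = {x. x < n \<and> 0 < \<beta> x}"
    have XL: "x \<in> L" if "x \<in> X" for x
      using that bulge_off[of d p x a n] by (auto simp: X_def L_def \<beta>_def)
    have X: "X \<subseteq> {..<n} - {u, v}" using bu[OF uv(1)] bu[OF uv(3)] by (auto simp: X_def)
    \<comment> \<open>A vertex off the line exists since the polygon is not flat.\<close>
    obtain o' where o': "o' < n" "0 < cross d (p o' - a)" using off by blast
    have "o' \<in> {..<n} - {u, v} - X" using o' uv XL by (auto simp: L_def)
    moreover have "l \<in> X" using l by (simp add: X_def)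
    ultimately obtain x y where xy: "x \<in> X" "y \<in> {..<n} - {u, v} - X" "{x, y} \<in> E"
      using crossing_edge[OF G'(5) uvn _ _ X] by metis
    have "y \<notin> L"
    proof
      assume yL: "y \<in> L"
      then have "\<beta> y = 0" using xy(2) bge[of y] by (auto simp: X_def L_def)
      then have "?S y = ?S u \<or> ?S y = ?S v" using bu[OF yL] by auto
      then have "y = u \<or> y = v"
        using on_line_inj[OF inj d(1), of y a u] on_line_inj[OF inj d(1), of y a v] yL uv by (auto simp: L_def)
      then show False using xy(2) by auto
    qed
    then have ypos: "0 < cross d (p y - a)" using left[of y] xy(2) by (auto simp: L_def)
    have xyn: "x < n" "y < n" "x \<noteq> y" "0 < \<beta> x" using xy by (auto simp: X_def)
    have pos: "0 < edge_form n {x, y} p \<delta>"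
      unfolding work[OF xyn(1-3)] using ypos xyn(4) bge[of y] left[OF xyn(1)]
      by (intro add_pos_nonneg mult_pos_pos mult_nonneg_nonneg) auto
    then have "{x, y} \<notin> boundary_edges n" using boundary by force
    then show ?thesis using that[of "{x, y}"] pos xy(3) by (simp add: braces_def)
  qed
  have "0 < (\<Sum>e\<in>braces n E. 2 * edge_form n e p \<delta>)"
    using e brace_ge braces_nonempty[OF G] by (intro sum_pos2[of _ e]) auto
  then have deriv: "0 < \<epsilon> * (\<Sum>e\<in>braces n E. 2 * edge_form n e p \<delta>) -
    (\<Sum>e\<in>boundary_edges n. 2 * (excess n p e) *
      (2 * edge_form n e p \<delta>))"
    using boundary \<epsilon> by simp
  let ?f = "\<lambda>t. elastic_energy n E \<epsilon> (\<lambda>i. p i + t *\<^sub>R \<delta> i)"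
  obtain h where h: "0 < h" "\<And>t. \<lbrakk>0 < t; t < h\<rbrakk> \<Longrightarrow> ?f 0 < ?f (0 + t)"
    using DERIV_pos_inc_right[OF energy_derivative[OF G] deriv] by blast
  have "eventually (\<lambda>t. \<forall>e\<in>boundary_edges n. \<bar>excess n (\<lambda>i. p i + t *\<^sub>R \<delta> i) e\<bar> \<le> \<eta>) (at_right 0)"
    using eventually_near_lengths[OF G strict] by (simp add: eventually_at_split)
  moreover have "eventually (\<lambda>t. weakly_convex n (\<lambda>l. p l + t *\<^sub>R \<delta> l)) (at_right 0)"
    unfolding \<delta>_def by (rule push_weakly_convex[OF sctx])
  ultimately have "eventually (\<lambda>t. near_reference n \<eta> (\<lambda>l. p l + t *\<^sub>R \<delta> l)) (at_right 0)"
    by eventually_elim (simp add: near_reference_def)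
  then obtain h' where h': "0 < h'" "\<And>t. \<lbrakk>0 < t; t < h'\<rbrakk> \<Longrightarrow> near_reference n \<eta> (\<lambda>l. p l + t *\<^sub>R \<delta> l)"
    unfolding eventually_at_right_field by blast
  define t where "t = min h h' / 2"
  have t: "0 < t" "t < h" "t < h'" using h(1) h'(1) by (auto simp: t_def)
  have "?f t \<le> elastic_energy n E \<epsilon> p" by (rule max[OF h'(2)[OF t(1,3)]])
  then show False using h(2)[OF t(1,2)] by simp
qed

text \<open>A strictly convex maximiser is a critical point. The derivative of the energy with respect to the squared edge lengths
is, up to sign, an equilibrium stress, equal to \<open>- \<epsilon>\<close> on every brace.\<close>

theorem exists_properly_stressed:
  assumes G: "minimal_braced n E"
  obtains p \<omega> where "convex_position 1 n p" "proper_stress n E p \<omega>"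
proof -
  note G' = minimal_bracedD[OF G]
  \<comment> \<open>Small enough for the \<open>n\<close> errors in the lengths of the sides to add up to less than \<open>1/2\<close>.\<close>
  define \<eta> where "\<eta> = 1 / (4 * real n)"
  have \<eta>: "0 < \<eta>" "\<eta> < 1" "real n * \<eta> < 1 / 2" using G'(1) by (auto simp: \<eta>_def field_simps)
  define c where "c = card (braces n E) * (2 * diameter_bound n)\<^sup>2"
  define \<epsilon> where "\<epsilon> = \<eta>\<^sup>2 / (c + 1)"
  have c: "0 \<le> c" by (simp add: c_def)
  have \<epsilon>: "0 < \<epsilon>" using \<eta>(1) c by (simp add: \<epsilon>_def)
  have "\<epsilon> * c < \<eta>\<^sup>2"
  proof -
    have "\<epsilon> * c < \<epsilon> * (c + 1)" using \<epsilon> by simp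
    also have "\<dots> = \<eta>\<^sup>2" using c by (simp add: \<epsilon>_def)
    finally show ?thesis .
  qed
  then have \<epsilon>c: "\<epsilon> * (card (braces n E) * (2 * diameter_bound n)\<^sup>2) < \<eta>\<^sup>2" by (simp add: c_def)
  obtain p where near: "near_reference n \<eta> p"
    and max: "\<And>q. near_reference n \<eta> q \<Longrightarrow> elastic_energy n E \<epsilon> q \<le> elastic_energy n E \<epsilon> p"
    using energy_maximiser[OF G, of \<eta> \<epsilon>] \<eta> by (metis less_imp_le)
  have strict: "\<bar>excess n p e\<bar> < \<eta>"
    if "e \<in> boundary_edges n" for e
    by (rule maximiser_strict_lengths[OF G near \<eta>(1) less_imp_le[OF \<eta>(2)] max \<epsilon> \<epsilon>c that])
  have pos: "convex_position 1 n p"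
    by (rule maximiser_convex_position[OF G near \<eta> max \<epsilon> strict])
  define \<omega> where "\<omega> e = (if e \<in> braces n E then - \<epsilon> else
    2 * (excess n p e))" for e
  have work: "(\<Sum>e\<in>E. \<omega> e * edge_form n e p \<delta>) = 0" for \<delta>
  proof -
    let ?f = "\<lambda>t. elastic_energy n E \<epsilon> (\<lambda>i. p i + t *\<^sub>R \<delta> i)"
    have "eventually (\<lambda>t. near_reference n \<eta> (\<lambda>i. p i + t *\<^sub>R \<delta> i)) (at 0)"
    proof -
      have "eventually (\<lambda>t. \<forall>e\<in>boundary_edges n. \<bar>excess n (\<lambda>i. p i + t *\<^sub>R \<delta> i) e\<bar> \<le> \<eta>) (at 0)"
        by (rule eventually_near_lengths[OF G strict])
      then show ?thesis using convex_position_perturb[OF pos, of \<delta>]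
      by eventually_elim (auto simp: near_reference_def weakly_convex_def convex_position_def intro: less_imp_le)
    qed
    then obtain h where h: "0 < h" "\<And>t. \<lbrakk>t \<noteq> 0; dist t 0 < h\<rbrakk> \<Longrightarrow> near_reference n \<eta> (\<lambda>i. p i + t *\<^sub>R \<delta> i)"
      unfolding eventually_at by blast
    have "\<forall>t. \<bar>0 - t\<bar> < h \<longrightarrow> ?f t \<le> ?f 0"
    proof (intro allI impI)
      fix t assume t: "\<bar>0 - t\<bar> < h"
      show "?f t \<le> ?f 0"
      proof (cases "t = 0")
        case False
        then have "near_reference n \<eta> (\<lambda>i. p i + t *\<^sub>R \<delta> i)" using h(2) t by (simp add: dist_real_def)
        then show ?thesis using max by simp
      qed simp
    qed
    then have zero: "\<epsilon> * (\<Sum>e\<in>braces n E. 2 * edge_form n e p \<delta>) -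
      (\<Sum>e\<in>boundary_edges n. 2 * (excess n p e) *
      (2 * edge_form n e p \<delta>)) = 0"
      by (rule DERIV_local_max[OF energy_derivative[OF G] h(1)])
    define x where "x = (\<Sum>e\<in>braces n E. edge_form n e p \<delta>)"
    define y where "y = (\<Sum>e\<in>boundary_edges n.
        2 * (excess n p e) * edge_form n e p \<delta>)"
    have sum_E: "(\<Sum>e\<in>E. \<omega> e * edge_form n e p \<delta>) =
        (\<Sum>e\<in>braces n E. \<omega> e * edge_form n e p \<delta>) + (\<Sum>e\<in>boundary_edges n. \<omega> e * edge_form n e p \<delta>)"
      unfolding braces_def by (rule sum.subset_diff[OF G'(4) simple_graph_finite[OF G'(3)]])
    have sum_br: "(\<Sum>e\<in>braces n E. \<omega> e * edge_form n e p \<delta>) = - \<epsilon> * x"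
      by (simp add: \<omega>_def x_def sum_distrib_left sum_negf)
    have sum_bd: "(\<Sum>e\<in>boundary_edges n. \<omega> e * edge_form n e p \<delta>) = y"
      unfolding y_def by (intro sum.cong refl) (simp add: \<omega>_def braces_def)
    have "(\<Sum>e\<in>boundary_edges n. 2 * (excess n p e) *
      (2 * edge_form n e p \<delta>)) = 2 * y"
      unfolding y_def sum_distrib_left by (intro sum.cong refl) simp
    moreover have "(\<Sum>e\<in>braces n E. 2 * edge_form n e p \<delta>) = 2 * x"
      by (simp add: x_def sum_distrib_left)
    ultimately have "\<epsilon> * (2 * x) - 2 * y = 0" using zero by simp
    then show ?thesis unfolding sum_E sum_br sum_bd by simp
  qed
  have "(\<Sum>j<n. stress_coeff E \<omega> i j *\<^sub>R (p i - p j)) = 0" if i: "i < n" for i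
  proof -
    define F where "F = (\<Sum>j<n. stress_coeff E \<omega> i j *\<^sub>R (p i - p j))"
    have "0 = (\<Sum>k<n. inner (\<Sum>j<n. stress_coeff E \<omega> k j *\<^sub>R (p k - p j)) (if k = i then F else 0))"
      using work[of "\<lambda>k. if k = i then F else 0"] virtual_work[OF simple_graph_finite[OF G'(3)]] by simp
    also have "\<dots> = (\<Sum>k<n. if k = i then inner F F else 0)"
      by (intro sum.cong refl) (simp add: F_def)
    also have "\<dots> = inner F F" using i by simp
    finally show ?thesis by (simp add: F_def)
  qed
  then have "equilibrium_stress n E p \<omega>" by (simp add: equilibrium_stress_def)
  then have "proper_stress n E p \<omega>"
    by (rule proper_stressI[OF G pos]) (simp add: \<omega>_def \<epsilon>)
  then show ?thesis using that pos by blast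
qed

section \<open>Transport of proper stresses\<close>

lemma proper_stress_affine_image:
  assumes ps: "proper_stress n E r \<omega>"
    and aff: "affine_on n r (\<lambda>i. (p i)$1)" "affine_on n r (\<lambda>i. (p i)$2)"
  shows "proper_stress n E p \<omega>"
proof -
  have bal: "balanced n (stress_coeff E \<omega>) r"
    using ps by (simp add: proper_stress_def equilibrium_stress_balanced)
  have "(\<Sum>j<n. stress_coeff E \<omega> i j *\<^sub>R (p i - p j)) = 0" if "i < n" for i
    using affine_on_kernel[OF bal aff(1) that] affine_on_kernel[OF bal aff(2) that]
    by (simp add: plane_eq_iff)
  then have "equilibrium_stress n E p \<omega>" by (simp add: equilibrium_stress_def)
  then show ?thesis using ps by (simp add: proper_stress_def)
qed

text \<open>In homogeneous coordinates the points \<open>(D i, 1, S i)\<close> are linear images of \<open>(p i, 1)\<close>, so they satisfy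
the same equilibrium conditions. Rescaling them by the positive numbers \<open>1 / S i\<close> rescales the stress of \<open>ij\<close>
by \<open>S i * S j\<close> and keeps all signs.\<close>

lemma proper_stress_projective_image:
  assumes sg: "simple_graph {..<n} E" and bd: "boundary_edges n \<subseteq> E"
    and ps: "proper_stress n E p \<omega>" and aff: "affine_on n p D" "affine_on n p S"
    and S: "\<And>i. i < n \<Longrightarrow> 0 < S i"
  shows "\<exists>\<omega>'. proper_stress n E (\<lambda>i. vector [D i / S i, 1 / S i]) \<omega>'"
proof -
  define \<omega>' where "\<omega>' e = \<omega> e * (\<Prod>i\<in>e. S i)" for e
  have prod: "0 < (\<Prod>i\<in>e. S i)" if "e \<in> E" for e
    using sg that S unfolding simple_graph_def by (intro prod_pos) auto
  have bal: "balanced n (stress_coeff E \<omega>) p"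
    using ps by (simp add: proper_stress_def equilibrium_stress_balanced)
  let ?w = "stress_coeff E \<omega>"
  have coeff: "stress_coeff E \<omega>' i j = ?w i j * (S i * S j)" for i j
    using simple_graph_edgeD(3)[OF sg, of i j] by (auto simp: stress_coeff_def \<omega>'_def)
  have "(\<Sum>j<n. stress_coeff E \<omega>' i j *\<^sub>R (vector [D i / S i, 1 / S i] - vector [D j / S j, 1 / S j])) = (0 :: real^2)"
    if i: "i < n" for i
  proof -
    have zS: "(\<Sum>j<n. ?w i j * (S i - S j)) = 0" by (rule affine_on_kernel[OF bal aff(2) i])
    have zD: "(\<Sum>j<n. ?w i j * (D i - D j)) = 0" by (rule affine_on_kernel[OF bal aff(1) i])
    have "(\<Sum>j<n. stress_coeff E \<omega>' i j * (D i / S i - D j / S j)) =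
        (\<Sum>j<n. S i * (?w i j * (D i - D j)) - D i * (?w i j * (S i - S j)))"
    proof (intro sum.cong refl)
      fix j assume "j \<in> {..<n}"
      then have "S i \<noteq> 0" "S j \<noteq> 0" using S[OF i] S[of j] by auto
      then show "stress_coeff E \<omega>' i j * (D i / S i - D j / S j) = S i * (?w i j * (D i - D j)) - D i * (?w i j * (S i - S j))"
        unfolding coeff by (simp add: field_simps)
    qed
    also have "\<dots> = 0" using zS zD by (simp add: sum_subtractf flip: sum_distrib_left)
    finally have 1: "(\<Sum>j<n. stress_coeff E \<omega>' i j * (D i / S i - D j / S j)) = 0" .
    have "(\<Sum>j<n. stress_coeff E \<omega>' i j * (1 / S i - 1 / S j)) = (\<Sum>j<n. - (?w i j * (S i - S j)))"
    proof (intro sum.cong refl)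
      fix j assume "j \<in> {..<n}"
      then have "S i \<noteq> 0" "S j \<noteq> 0" using S[OF i] S[of j] by auto
      then show "stress_coeff E \<omega>' i j * (1 / S i - 1 / S j) = - (?w i j * (S i - S j))"
        unfolding coeff by (simp add: field_simps)
    qed
    also have "\<dots> = 0" using zS by (simp add: sum_negf)
    finally show ?thesis using 1 by (simp add: plane_eq_iff)
  qed
  then have "equilibrium_stress n E (\<lambda>i. vector [D i / S i, 1 / S i] :: real^2) \<omega>'"
    by (simp add: equilibrium_stress_def)
  moreover have "0 < \<omega>' e" if "e \<in> boundary_edges n" for e
    using ps that prod[of e] bd by (auto simp: \<omega>'_def proper_stress_def)
  moreover have "\<omega>' e < 0" if "e \<in> braces n E" for e
    using ps that prod[of e] by (simp add: \<omega>'_def proper_stress_def braces_def mult_neg_pos)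
  ultimately show ?thesis by (auto simp: proper_stress_def)
qed

definition convex_chain :: "nat \<Rightarrow> (nat \<Rightarrow> real^2) \<Rightarrow> bool" where
  "convex_chain n p \<longleftrightarrow> convex_position 1 n p \<and> (\<forall>i j. i < j \<and> j < n \<longrightarrow> (p i)$1 < (p j)$1)"

lemma orient_affine_combination:
  "orient ((1 - x - y) *\<^sub>R a + x *\<^sub>R b + y *\<^sub>R c) u v = (1 - x - y) * orient a u v + x * orient b u v + y * orient c u v"
  by (simp add: orient_def cross_def algebra_simps)

text \<open>From the midpoint of the side between \<open>n - 1\<close> and \<open>0\<close> all vertices are seen in the order of their indices,
except that the ends of the side are seen at an angle of \<open>\<pi>\<close>. Moving the viewpoint slightly away from vertex
\<open>1\<close> repairs this.\<close>

lemma external_viewpoint: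
  assumes pos: "convex_position 1 n p" and n: "3 \<le> n"
  obtains c where "\<And>i j. \<lbrakk>i < j; j < n\<rbrakk> \<Longrightarrow> 0 < orient c (p i) (p j)"
proof -
  \<comment> \<open>The point at parameter \<open>t\<close> is the midpoint of the side plus \<open>t\<close> times the vector to it from vertex \<open>1\<close>.\<close>
  define c where "c t = (1 - (1 + t) / 2 - (- t)) *\<^sub>R p 0 + ((1 + t) / 2) *\<^sub>R p (n - 1) + (- t) *\<^sub>R p 1" for t :: real
  have oc: "orient (c t) u v = (1 + t) / 2 * orient (p 0) u v + (1 + t) / 2 * orient (p (n - 1)) u v - t * orient (p 1) u v" for t u v
    unfolding c_def orient_affine_combination by (simp add: field_simps)
  have tri: "0 < orient (p i) (p j) (p k)" if "cyclic i j k" "i < n" "j < n" "k < n" for i j k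
    using convex_position_cyclic[OF pos that] by simp
  define T where "T = {(i, j). i < j \<and> j < n}"
  have "T \<subseteq> {..<n} \<times> {..<n}" by (auto simp: T_def)
  then have finT: "finite T" by (rule finite_subset) auto
  have "eventually (\<lambda>t. 0 < orient (c t) (p i) (p j)) (at_right 0)" if ij: "i < j" "j < n" for i j
  proof (cases "i = 0 \<and> j = n - 1")
    case True
    have "0 < orient (p 0) (p 1) (p (n - 1))" by (rule tri) (use n in \<open>auto simp: cyclic_def\<close>)
    then have o: "orient (p 1) (p 0) (p (n - 1)) < 0"
      by (simp add: orient_def cross_def algebra_simps)
    have "0 < orient (c t) (p i) (p j)" if "0 < t" for t
      unfolding oc using True o that by (simp add: mult_pos_neg)
    then show ?thesis unfolding eventually_at_right_field by (intro exI[of _ 1]) auto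
  next
    case False
    have ge: "0 \<le> orient (p 0) (p i) (p j)" "0 \<le> orient (p (n - 1)) (p i) (p j)"
    proof -
      show "0 \<le> orient (p 0) (p i) (p j)"
        using tri[of 0 i j] ij by (cases "i = 0") (auto simp: cyclic_def)
      show "0 \<le> orient (p (n - 1)) (p i) (p j)"
      proof (cases "j = n - 1")
        case False
        then have "j < n - 1" using ij by linarith
        then show ?thesis using tri[of "n - 1" i j] ij by (auto simp: cyclic_def)
      qed simp
    qed
    have "0 < orient (p 0) (p i) (p j) \<or> 0 < orient (p (n - 1)) (p i) (p j)"
    proof (cases "i = 0")
      case True
      then have "j < n - 1" using False ij by linarith
      then show ?thesis using tri[of "n - 1" i j] ij by (auto simp: cyclic_def)
    next
      case False
      then show ?thesis using tri[of 0 i j] ij by (auto simp: cyclic_def)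
    qed
    then have "0 < (1 + 0) / 2 * orient (p 0) (p i) (p j) + (1 + 0) / 2 * orient (p (n - 1)) (p i) (p j) - 0 * orient (p 1) (p i) (p j)"
      using ge by auto
    moreover have "((\<lambda>t. orient (c t) (p i) (p j)) \<longlongrightarrow>
        (1 + 0) / 2 * orient (p 0) (p i) (p j) + (1 + 0) / 2 * orient (p (n - 1)) (p i) (p j) - 0 * orient (p 1) (p i) (p j)) (at_right 0)"
      unfolding oc by (intro tendsto_intros) auto
    ultimately show ?thesis by (intro order_tendstoD(1))
  qed
  then have "eventually (\<lambda>t. \<forall>x\<in>T. case x of (i, j) \<Rightarrow> 0 < orient (c t) (p i) (p j)) (at_right 0)"
    using finT by (intro eventually_ball_finite) (auto simp: T_def)
  then obtain t where "\<forall>x\<in>T. case x of (i, j) \<Rightarrow> 0 < orient (c t) (p i) (p j)"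
    using eventually_happens'[OF trivial_limit_at_right_real] by blast
  then show ?thesis using that[of "c t"] by (auto simp: T_def)
qed

lemma orient_projective:
  assumes "s1 \<noteq> 0" "s2 \<noteq> 0" "s3 \<noteq> 0"
  shows "orient (vector [x1 / s1, 1 / s1]) (vector [x2 / s2, 1 / s2]) (vector [x3 / s3, 1 / s3]) * (s1 * s2 * s3) =
    x1 * (s3 - s2) + x2 * (s1 - s3) + x3 * (s2 - s1)"
  using assms by (simp add: orient_def cross_def field_simps)

text \<open>Send the viewpoint \<open>c\<close> to infinity in the vertical direction: \<open>D\<close> and \<open>S\<close> are
affine functions that vanish at \<open>c\<close>, and \<open>S\<close> is positive on the polygon. Then the order in which \<open>c\<close> sees the vertices becomes
the order of their first coordinates.\<close>

lemma projective_convex_chain: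
  assumes pos: "convex_position 1 n p" and n: "3 \<le> n"
  obtains D S where "affine_on n p D" "affine_on n p S" "\<And>i. i < n \<Longrightarrow> 0 < S i"
    "convex_chain n (\<lambda>i. vector [D i / S i, 1 / S i])"
    "affine_on n (\<lambda>i. vector [D i, S i]) (\<lambda>i. (p i)$1)" "affine_on n (\<lambda>i. vector [D i, S i]) (\<lambda>i. (p i)$2)"
proof -
  obtain c where c: "\<And>i j. \<lbrakk>i < j; j < n\<rbrakk> \<Longrightarrow> 0 < orient c (p i) (p j)"
    using external_viewpoint[OF pos n] by blast
  define a where "a = p 0 - c"
  define b where "b = p (n - 1) - c"
  define D where "D i = cross a (p i - c)" for i
  define N where "N i = cross (p i - c) b" for i
  define S where "S i = D i + N i" for i
  have ab: "0 < cross a b" using c[of 0 "n - 1"] n by (simp add: a_def b_def orient_def)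
  have D0: "0 < D i" if "0 < i" "i < n" for i using c[of 0 i] that by (simp add: D_def a_def orient_def)
  have Dz: "D 0 = 0" by (simp add: D_def a_def)
  have N0: "0 < N i" if "i < n - 1" for i using c[of i "n - 1"] that n by (simp add: N_def b_def orient_def)
  have Nz: "N (n - 1) = 0" by (simp add: N_def b_def)
  have Spos: "0 < S i" if "i < n" for i
  proof (cases "i = 0")
    case True
    then show ?thesis using N0[of 0] Dz n by (simp add: S_def)
  next
    case False
    then have "0 < D i" using D0 that by simp
    moreover have "0 \<le> N i"
    proof (cases "i = n - 1")
      case False
      then have "i < n - 1" using that by linarith
      then show ?thesis using N0[of i] by simp
    qed (use Nz in simp)
    ultimately show ?thesis by (simp add: S_def)
  qed
  have affD: "affine_on n p D" unfolding affine_on_def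
  proof (intro exI allI impI)
    fix j show "D j = - cross a c + inner (perp a) (p j)" by (simp add: D_def inner_perp cross_linear)
  qed
  have affS: "affine_on n p S" unfolding affine_on_def
  proof (intro exI allI impI)
    fix j show "S j = (cross b c - cross a c) + inner (perp (a - b)) (p j)"
      by (simp add: S_def D_def N_def inner_perp cross_def algebra_simps)
  qed
  define q where "q i = (vector [D i / S i, 1 / S i] :: real^2)" for i
  have "0 < orient (q i) (q j) (q k)" if ijk: "i < j" "j < k" "k < n" for i j k
  proof -
    have s: "0 < S i" "0 < S j" "0 < S k" using Spos ijk by auto
    have "orient (q i) (q j) (q k) * (S i * S j * S k) = D i * (S k - S j) + D j * (S i - S k) + D k * (S j - S i)"
      unfolding q_def using s by (intro orient_projective) auto
    also have "\<dots> = cross a b * orient (p i) (p j) (p k)"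
      by (simp add: D_def S_def N_def orient_def cross_def algebra_simps)
    also have "0 < \<dots>" using ab pos ijk by (simp add: convex_position_def)
    finally have "0 < orient (q i) (q j) (q k) * (S i * S j * S k)" .
    then show ?thesis by (rule zero_less_mult_pos2) (use s in simp)
  qed
  then have "convex_position 1 n q" by (simp add: convex_position_def)
  moreover have "(q i)$1 < (q j)$1" if ij: "i < j" "j < n" for i j
  proof -
    have s: "0 < S i" "0 < S j" using Spos ij by auto
    have "D j * S i - D i * S j = cross a b * orient c (p i) (p j)"
      by (simp add: D_def S_def N_def orient_def cross_def algebra_simps)
    also have "0 < \<dots>" using ab c ij by simp
    finally show ?thesis using s by (simp add: q_def divide_less_eq field_simps)
  qed
  ultimately have "convex_chain n q" by (simp add: convex_chain_def)
  have coord: "(p i)$m = c$m + inner (vector [(b$m - a$m) / cross a b, a$m / cross a b]) (vector [D i, S i] :: real^2)"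
    if m: "m = 1 \<or> m = 2" for i m
  proof -
    have "cross a b *\<^sub>R (p i - c) = N i *\<^sub>R a + D i *\<^sub>R b"
      by (simp add: plane_eq_iff D_def N_def cross_def algebra_simps)
    then have "(cross a b *\<^sub>R (p i - c))$m = (N i *\<^sub>R a + D i *\<^sub>R b)$m" by simp
    then have "cross a b * ((p i)$m - c$m) = (S i - D i) * a$m + D i * b$m" by (simp add: S_def)
    then have "(p i)$m - c$m = ((S i - D i) * a$m + D i * b$m) / cross a b"
      using ab by (simp add: nonzero_eq_divide_eq mult.commute)
    also have "\<dots> = inner (vector [(b$m - a$m) / cross a b, a$m / cross a b]) (vector [D i, S i] :: real^2)"
      using ab by (simp add: inner_plane field_simps)
    finally show ?thesis by linarith
  qed
  have "affine_on n (\<lambda>i. vector [D i, S i]) (\<lambda>i. (p i)$1)" "affine_on n (\<lambda>i. vector [D i, S i]) (\<lambda>i. (p i)$2)"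
    unfolding affine_on_def using coord[of 1] coord[of 2] by blast+
  then show ?thesis using that[OF affD affS Spos _] \<open>convex_chain n q\<close> unfolding q_def[abs_def] by blast
qed

text \<open>Apply the projective map to its own image: with the coordinates of the image in the roles of \<open>D\<close> and \<open>S\<close> it yields
the points \<open>(D i, S i)\<close>, which are an affine image of \<open>p\<close>.\<close>

lemma proper_stress_of_projective_image:
  assumes sg: "simple_graph {..<n} E" and bd: "boundary_edges n \<subseteq> E"
    and ps: "proper_stress n E (\<lambda>i. vector [D i / S i, 1 / S i]) \<omega>"
    and S: "\<And>i. i < n \<Longrightarrow> 0 < S i"
    and aff: "affine_on n (\<lambda>i. vector [D i, S i]) (\<lambda>i. (p i)$1)" "affine_on n (\<lambda>i. vector [D i, S i]) (\<lambda>i. (p i)$2)"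
  shows "\<exists>\<omega>. proper_stress n E p \<omega>"
proof -
  let ?q = "\<lambda>i. vector [D i / S i, 1 / S i] :: real^2"
  obtain \<omega>' where \<omega>': "proper_stress n E (\<lambda>i. vector [(?q i)$1 / (?q i)$2, 1 / (?q i)$2]) \<omega>'"
    using proper_stress_projective_image[OF sg bd ps affine_on_coordinate(1,2)] S by auto
  have "affine_on n (\<lambda>i. vector [(?q i)$1 / (?q i)$2, 1 / (?q i)$2]) f" if "affine_on n (\<lambda>i. vector [D i, S i]) f" for f
  proof -
    have "(vector [(?q i)$1 / (?q i)$2, 1 / (?q i)$2] :: real^2) = vector [D i, S i]" if "i < n" for i
      using S[OF that] by simp
    then show ?thesis using \<open>affine_on n (\<lambda>i. vector [D i, S i]) f\<close> unfolding affine_on_def by metis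
  qed
  then show ?thesis using proper_stress_affine_image[OF \<omega>'] aff by blast
qed

lemma convergent_subsequence_finite:
  fixes f :: "nat \<Rightarrow> 'e \<Rightarrow> real"
  assumes "finite A" and "\<And>m e. e \<in> A \<Longrightarrow> \<bar>f m e\<bar> \<le> 1"
  shows "\<exists>r l. strict_mono r \<and> (\<forall>e\<in>A. (\<lambda>m. f (r m) e) \<longlonglongrightarrow> l e)"
  using assms
proof (induction A rule: finite_induct)
  case empty
  show ?case by (intro exI[of _ id] exI[of _ "\<lambda>_. 0"]) (simp add: strict_mono_def)
next
  case (insert x A)
  have "\<exists>r l. strict_mono r \<and> (\<forall>e\<in>A. (\<lambda>m. f (r m) e) \<longlonglongrightarrow> l e)"
    using insert.prems by (intro insert.IH) auto
  then obtain r l where r: "strict_mono r" "\<And>e. e \<in> A \<Longrightarrow> (\<lambda>m. f (r m) e) \<longlonglongrightarrow> l e" by blast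
  have "\<forall>m. f (r m) x \<in> {-1..1}" using insert.prems[of x] by (auto simp: abs_le_iff)
  then obtain y r' where r': "strict_mono r'" "((\<lambda>m. f (r m) x) \<circ> r') \<longlonglongrightarrow> y"
    using compact_Icc[of "-1" "1 :: real"] unfolding compact_eq_seq_compact_metric seq_compact_def by metis
  have conv: "(\<lambda>m. f ((r \<circ> r') m) e) \<longlonglongrightarrow> (if e = x then y else l e)" if "e \<in> insert x A" for e
  proof (cases "e = x")
    case True
    then show ?thesis using r'(2) by (simp add: o_def)
  next
    case False
    then show ?thesis using LIMSEQ_subseq_LIMSEQ[OF r(2) r'(1), of e] that by (simp add: o_def)
  qed
  show ?case
    by (rule exI[of _ "r \<circ> r'"], rule exI[of _ "\<lambda>e. if e = x then y else l e"])
      (intro conjI ballI conv strict_mono_o r(1) r'(1))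
qed

lemma limit_of_stresses:
  assumes sg: "simple_graph {..<n} E" and P: "\<And>i. i < n \<Longrightarrow> (\<lambda>m. P m i) \<longlonglongrightarrow> p i"
    and eq: "\<And>m. equilibrium_stress n E (P m) (W m)" and norm: "\<And>m. (\<Sum>e\<in>E. \<bar>W m e\<bar>) = 1"
  obtains r \<omega> where "strict_mono r" "\<And>e. e \<in> E \<Longrightarrow> (\<lambda>m. W (r m) e) \<longlonglongrightarrow> \<omega> e"
    "equilibrium_stress n E p \<omega>" "\<exists>e\<in>E. \<omega> e \<noteq> 0"
proof -
  have fin: "finite E" using simple_graph_finite[OF sg] .
  have "\<bar>W m e\<bar> \<le> 1" if "e \<in> E" for m e
    using member_le_sum[of e E "\<lambda>e. \<bar>W m e\<bar>"] that fin norm[of m] by simp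
  then obtain r \<omega> where r: "strict_mono r" "\<And>e. e \<in> E \<Longrightarrow> (\<lambda>m. W (r m) e) \<longlonglongrightarrow> \<omega> e"
    using convergent_subsequence_finite[OF fin, of W] by blast
  have Pr: "(\<lambda>m. P (r m) i) \<longlonglongrightarrow> p i" if "i < n" for i
    using LIMSEQ_subseq_LIMSEQ[OF P[OF that] r(1)] by (simp add: o_def)
  have coeff: "(\<lambda>m. stress_coeff E (W (r m)) i j) \<longlonglongrightarrow> stress_coeff E \<omega> i j" for i j
    using r(2)[of "{i, j}"] by (simp add: stress_coeff_def)
  have "(\<Sum>j<n. stress_coeff E \<omega> i j *\<^sub>R (p i - p j)) = 0" if i: "i < n" for i
  proof -
    have "(\<lambda>m. \<Sum>j<n. stress_coeff E (W (r m)) i j *\<^sub>R (P (r m) i - P (r m) j)) \<longlonglongrightarrow>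
        (\<Sum>j<n. stress_coeff E \<omega> i j *\<^sub>R (p i - p j))"
      using Pr i by (intro tendsto_sum tendsto_scaleR tendsto_diff coeff) auto
    moreover have "(\<Sum>j<n. stress_coeff E (W (r m)) i j *\<^sub>R (P (r m) i - P (r m) j)) = 0" for m
      using eq[of "r m"] i by (simp add: equilibrium_stress_def)
    ultimately show ?thesis using LIMSEQ_unique[OF _ tendsto_const] by simp
  qed
  then have equi: "equilibrium_stress n E p \<omega>" by (simp add: equilibrium_stress_def)
  have "(\<lambda>m. \<Sum>e\<in>E. \<bar>W (r m) e\<bar>) \<longlonglongrightarrow> (\<Sum>e\<in>E. \<bar>\<omega> e\<bar>)"
    by (intro tendsto_sum tendsto_rabs r(2))
  then have "(\<lambda>m. 1) \<longlonglongrightarrow> (\<Sum>e\<in>E. \<bar>\<omega> e\<bar>)" unfolding norm .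
  then have "(\<Sum>e\<in>E. \<bar>\<omega> e\<bar>) = 1" by (rule LIMSEQ_unique[OF _ tendsto_const])
  then have "\<exists>e\<in>E. \<omega> e \<noteq> 0" by (metis abs_zero sum.neutral zero_neq_one)
  then show ?thesis using that r equi by blast
qed

lemma normalised_stress:
  assumes fin: "finite E" and eq: "equilibrium_stress n E p \<omega>" and nz: "\<exists>e\<in>E. \<omega> e \<noteq> 0"
  obtains k where "0 < k" "equilibrium_stress n E p (\<lambda>e. k * \<omega> e)" "(\<Sum>e\<in>E. \<bar>k * \<omega> e\<bar>) = 1"
proof -
  define N where "N = (\<Sum>e\<in>E. \<bar>\<omega> e\<bar>)"
  have "0 < N" using nz fin unfolding N_def by (auto intro: sum_pos2)
  have "equilibrium_stress n E p (\<lambda>e. (1 / N) * \<omega> e)"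
    using equilibrium_stress_combine[OF eq eq, of "1 / N" 0] by simp
  moreover have "(\<Sum>e\<in>E. \<bar>(1 / N) * \<omega> e\<bar>) = 1"
    using \<open>0 < N\<close> by (simp add: abs_mult N_def[symmetric] flip: sum_divide_distrib)
  ultimately show ?thesis using that[of "1 / N"] \<open>0 < N\<close> by simp
qed

lemma proper_stress_nonzero:
  assumes G: "minimal_braced n E" and ps: "proper_stress n E p \<omega>"
  shows "\<exists>e\<in>E. \<omega> e \<noteq> 0"
proof -
  obtain f where f: "f \<in> braces n E" using braces_nonempty[OF G] by blast
  then have "\<omega> f < 0" using ps by (simp add: proper_stress_def)
  then show ?thesis using f by (intro bexI[of _ f]) (auto simp: braces_def)
qed

text \<open>A normalised limit is nonpositive on the braces and not zero, so it is negative on every brace.\<close>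

lemma proper_stress_limit:
  assumes G: "minimal_braced n E" and P: "\<And>i. i < n \<Longrightarrow> (\<lambda>m. P m i) \<longlonglongrightarrow> p i"
    and pos: "convex_position s n p" and ps: "\<And>m. \<exists>\<omega>. proper_stress n E (P m) \<omega>"
  shows "\<exists>\<omega>. proper_stress n E p \<omega>"
proof -
  note G' = minimal_bracedD[OF G]
  have fin: "finite E" using simple_graph_finite[OF G'(3)] .
  have "\<exists>\<omega>. equilibrium_stress n E (P m) \<omega> \<and> (\<Sum>e\<in>E. \<bar>\<omega> e\<bar>) = 1 \<and> (\<forall>e\<in>braces n E. \<omega> e < 0)" for m
  proof -
    obtain \<omega> where \<omega>: "proper_stress n E (P m) \<omega>" using ps by blast
    then have "equilibrium_stress n E (P m) \<omega>" by (simp add: proper_stress_def)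
    then obtain k where k: "0 < k" "equilibrium_stress n E (P m) (\<lambda>e. k * \<omega> e)" "(\<Sum>e\<in>E. \<bar>k * \<omega> e\<bar>) = 1"
      using normalised_stress[OF fin _ proper_stress_nonzero[OF G \<omega>]] by blast
    moreover have "k * \<omega> e < 0" if "e \<in> braces n E" for e
      using \<omega> k(1) that by (simp add: proper_stress_def mult_pos_neg)
    ultimately show ?thesis by blast
  qed
  then obtain W where W: "\<And>m. equilibrium_stress n E (P m) (W m)" "\<And>m. (\<Sum>e\<in>E. \<bar>W m e\<bar>) = 1"
    "\<And>m e. e \<in> braces n E \<Longrightarrow> W m e < 0" by metis
  obtain r \<omega> where r: "strict_mono r" "\<And>e. e \<in> E \<Longrightarrow> (\<lambda>m. W (r m) e) \<longlonglongrightarrow> \<omega> e"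
    and \<omega>: "equilibrium_stress n E p \<omega>" "\<exists>e\<in>E. \<omega> e \<noteq> 0"
    using limit_of_stresses[OF G'(3) P W(1,2)] by blast
  have le: "\<omega> e \<le> 0" if "e \<in> braces n E" for e
  proof (rule LIMSEQ_le_const2)
    show "(\<lambda>m. W (r m) e) \<longlonglongrightarrow> \<omega> e" using r(2) that by (simp add: braces_def)
    show "\<exists>N. \<forall>m\<ge>N. W (r m) e \<le> 0" using W(3)[OF that] less_imp_le by blast
  qed
  have "\<omega> f < 0" if f: "f \<in> braces n E" for f
  proof (rule ccontr)
    assume "\<not> \<omega> f < 0"
    then have "\<omega> f = 0" using le[OF f] by simp
    then have "\<omega> e = 0" if "e \<in> E" for e
      using nonpos_stress_with_zero_brace[OF G pos \<omega>(1) le f _ that] by simp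
    then show False using \<omega>(2) by blast
  qed
  then show ?thesis using proper_stressI[OF G pos \<omega>(1)] by blast
qed

text \<open>With this many edges each \<open>P m\<close> has a normalised stress. A limit of these is a nonzero multiple \<open>c\<close> of \<open>\<omega>\<close>,
and so far along the sequence \<open>c\<close> times the stress has the signs of \<open>c^2 * \<omega>\<close>.\<close>

lemma proper_stress_open:
  assumes G: "minimal_braced n E" and card: "2 * n < card E + 3"
    and P: "\<And>i. i < n \<Longrightarrow> (\<lambda>m. P m i) \<longlonglongrightarrow> p i"
    and Ppos: "\<And>m. convex_position s n (P m)"
    and pos: "convex_position s n p" and ps: "proper_stress n E p \<omega>"
  shows "\<exists>m. \<exists>\<omega>. proper_stress n E (P m) \<omega>"
proof -
  note G' = minimal_bracedD[OF G]
  have fin: "finite E" using simple_graph_finite[OF G'(3)] .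
  have "\<exists>\<omega>. equilibrium_stress n E (P m) \<omega> \<and> (\<Sum>e\<in>E. \<bar>\<omega> e\<bar>) = 1" for m
  proof -
    obtain \<omega> where \<omega>: "equilibrium_stress n E (P m) \<omega>" "\<exists>e\<in>E. \<omega> e \<noteq> 0"
      by (rule exists_stress[OF _ inj_on_convex_position[OF Ppos[of m] G'(2)] _ G'(3)]) (use card G'(1) in auto)
    then show ?thesis using normalised_stress[OF fin \<omega>] by blast
  qed
  then obtain W where W: "\<And>m. equilibrium_stress n E (P m) (W m)" "\<And>m. (\<Sum>e\<in>E. \<bar>W m e\<bar>) = 1" by metis
  obtain r \<sigma> where r: "strict_mono r" "\<And>e. e \<in> E \<Longrightarrow> (\<lambda>m. W (r m) e) \<longlonglongrightarrow> \<sigma> e"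
    and \<sigma>: "equilibrium_stress n E p \<sigma>" "\<exists>e\<in>E. \<sigma> e \<noteq> 0"
    using limit_of_stresses[OF G'(3) P W(1,2)] by blast
  obtain c where c: "\<And>e. e \<in> E \<Longrightarrow> \<sigma> e = c * \<omega> e" using stress_unique[OF G pos ps \<sigma>(1)] by blast
  have c0: "c \<noteq> 0" using c \<sigma>(2) by auto
  have "eventually (\<lambda>m. c * W (r m) e < 0) sequentially" if e: "e \<in> braces n E" for e
  proof -
    have eE: "e \<in> E" using e by (simp add: braces_def)
    have "(\<lambda>m. c * W (r m) e) \<longlonglongrightarrow> c * \<sigma> e" by (intro tendsto_intros r(2) eE)
    moreover have "c * \<sigma> e < 0"
    proof -
      have "0 < c * c" using c0 by (metis not_real_square_gt_zero)
      moreover have "\<omega> e < 0" using ps e by (simp add: proper_stress_def)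
      ultimately have "(c * c) * \<omega> e < 0" by (rule mult_pos_neg)
      then show ?thesis by (simp add: c[OF eE] mult.assoc)
    qed
    ultimately show ?thesis by (rule order_tendstoD(2))
  qed
  then have "eventually (\<lambda>m. \<forall>e\<in>braces n E. c * W (r m) e < 0) sequentially"
    using braces_nonempty[OF G] by (intro eventually_ball_finite) auto
  then obtain m where m: "\<And>e. e \<in> braces n E \<Longrightarrow> c * W (r m) e < 0"
    unfolding eventually_sequentially by blast
  have "equilibrium_stress n E (P (r m)) (\<lambda>e. c * W (r m) e)"
    using equilibrium_stress_combine[OF W(1) W(1), of "r m" c 0] by simp
  then have "proper_stress n E (P (r m)) (\<lambda>e. c * W (r m) e)"
    using proper_stressI[OF G Ppos] m by blast
  then show ?thesis by blast
qed

lemma proper_stress_along_path: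
  assumes G: "minimal_braced n E" and card: "2 * n < card E + 3"
    and cont: "\<And>i. i < n \<Longrightarrow> continuous_on {0..1} (\<lambda>t. \<gamma> t i)"
    and pos: "\<And>t. t \<in> {0..1} \<Longrightarrow> convex_position s n (\<gamma> t)"
    and start: "\<exists>\<omega>. proper_stress n E (\<gamma> (0 :: real)) \<omega>"
  shows "\<exists>\<omega>. proper_stress n E (\<gamma> 1) \<omega>"
proof -
  define A where "A = {t \<in> {0..1}. \<exists>\<omega>. proper_stress n E (\<gamma> t) \<omega>}"
  define B where "B = {0..1} - A"
  have lim: "(\<lambda>m. \<gamma> (x m) i) \<longlonglongrightarrow> \<gamma> l i" if "\<And>m. x m \<in> {0..1}" "x \<longlonglongrightarrow> l" "l \<in> {0..1}" "i < n" for x l i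
    using continuous_on_tendsto_compose[OF cont[OF that(4)] that(2,3)] that(1) by simp
  have l01: "l \<in> {0..1}" if "\<And>m. x m \<in> {0..1}" "x \<longlonglongrightarrow> l" for x and l :: real
    using closed_sequentially[OF closed_atLeastAtMost, of x 0 1 l] that by blast
  have "closed A" unfolding closed_sequential_limits
  proof (intro allI impI)
    fix x l assume x: "(\<forall>m. x m \<in> A) \<and> x \<longlonglongrightarrow> l"
    then have xI: "\<And>m. x m \<in> {0..1}" "x \<longlonglongrightarrow> l" by (auto simp: A_def)
    note l = l01[OF xI]
    have "\<exists>\<omega>. proper_stress n E (\<gamma> l) \<omega>"
      by (rule proper_stress_limit[OF G lim[OF xI l] pos[OF l]]) (use x in \<open>auto simp: A_def\<close>)
    then show "l \<in> A" using l by (simp add: A_def)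
  qed
  moreover have "closed B" unfolding closed_sequential_limits
  proof (intro allI impI)
    fix x l assume x: "(\<forall>m. x m \<in> B) \<and> x \<longlonglongrightarrow> l"
    then have xI: "\<And>m. x m \<in> {0..1}" "x \<longlonglongrightarrow> l" by (auto simp: B_def)
    note l = l01[OF xI]
    have "l \<notin> A"
    proof
      assume "l \<in> A"
      then obtain \<omega> where "proper_stress n E (\<gamma> l) \<omega>" by (auto simp: A_def)
      then obtain m \<omega>' where "proper_stress n E (\<gamma> (x m)) \<omega>'"
        using proper_stress_open[OF G card lim[OF xI l] pos[OF xI(1)] pos[OF l]] by blast
      then show False using x xI(1) by (auto simp: A_def B_def)
    qed
    then show "l \<in> B" using l by (simp add: B_def)
  qed
  moreover have "{0..1} \<subseteq> A \<union> B" "A \<inter> B \<inter> {0..1} = {}" by (auto simp: B_def)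
  moreover have "A \<inter> {0..1} \<noteq> {}" using start by (auto simp: A_def intro!: exI[of _ 0])
  ultimately have "B \<inter> {0..1} = {}"
    using connected_Icc[of "0 :: real" 1] unfolding connected_closed by blast
  moreover have "1 \<in> {0..1 :: real}" by simp
  ultimately have "1 \<in> A" unfolding B_def by blast
  then show ?thesis by (simp add: A_def)
qed

lemma convex_chain_parabola:
  assumes "\<And>i j. \<lbrakk>i < j; j < n\<rbrakk> \<Longrightarrow> x i < x j"
  shows "convex_chain n (\<lambda>i. vector [x i, (x i)\<^sup>2])"
proof -
  have "0 < orient (vector [x i, (x i)\<^sup>2]) (vector [x j, (x j)\<^sup>2]) (vector [x k, (x k)\<^sup>2])" if "i < j" "j < k" "k < n" for i j k
  proof -
    have "orient (vector [x i, (x i)\<^sup>2]) (vector [x j, (x j)\<^sup>2]) (vector [x k, (x k)\<^sup>2]) =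
        (x j - x i) * (x k - x i) * (x k - x j)"
      by (simp add: orient_def cross_def power2_eq_square algebra_simps)
    moreover have "x i < x j" "x i < x k" "x j < x k" using assms that by auto
    ultimately show ?thesis by simp
  qed
  then show ?thesis using assms by (simp add: convex_chain_def convex_position_def)
qed

text \<open>With the first coordinates fixed, the orientation of a triple is linear in the second coordinates.\<close>

lemma proper_stress_vertical_path:
  assumes G: "minimal_braced n E" and card: "2 * n < card E + 3"
    and p: "convex_chain n p" and q: "convex_chain n q" and x: "\<And>i. i < n \<Longrightarrow> (p i)$1 = (q i)$1"
    and ps: "\<exists>\<omega>. proper_stress n E p \<omega>"
  shows "\<exists>\<omega>. proper_stress n E q \<omega>"
proof -
  define \<gamma> where "\<gamma> t i = (1 - t) *\<^sub>R p i + t *\<^sub>R q i" for t :: real and i :: nat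
  have "\<exists>\<omega>. proper_stress n E (\<gamma> 1) \<omega>"
  proof (rule proper_stress_along_path[OF G card, where s = 1])
    show "continuous_on {0..1} (\<lambda>t. \<gamma> t i)" for i
      unfolding \<gamma>_def by (intro continuous_intros)
    have [simp]: "\<gamma> 0 = p" by (auto simp: \<gamma>_def)
    show "\<exists>\<omega>. proper_stress n E (\<gamma> 0) \<omega>" using ps by simp
    show "convex_position 1 n (\<gamma> t)" if t: "t \<in> {0..1}" for t
      unfolding convex_position_def
    proof (intro allI impI)
      fix i j k assume ijk: "i < j \<and> j < k \<and> k < n"
      have c: "(q i)$1 = (p i)$1" "(q j)$1 = (p j)$1" "(q k)$1 = (p k)$1" using x ijk by auto
      have "orient (\<gamma> t i) (\<gamma> t j) (\<gamma> t k) = (1 - t) * orient (p i) (p j) (p k) + t * orient (q i) (q j) (q k)"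
        by (simp add: \<gamma>_def orient_def cross_def c algebra_simps)
      moreover have "0 < orient (p i) (p j) (p k)" "0 < orient (q i) (q j) (q k)"
        using p q ijk by (auto simp: convex_chain_def convex_position_def)
      ultimately show "0 < 1 * orient (\<gamma> t i) (\<gamma> t j) (\<gamma> t k)"
        using t by (cases "t = 0") (auto intro: add_nonneg_pos)
    qed
  qed
  moreover have "\<gamma> 1 = q" by (auto simp: \<gamma>_def)
  ultimately show ?thesis by simp
qed

text \<open>Move vertically onto the parabola, then along the parabola, and then vertically again.\<close>

lemma proper_stress_chain_transfer:
  assumes G: "minimal_braced n E" and card: "2 * n < card E + 3"
    and p: "convex_chain n p" and q: "convex_chain n q" and ps: "\<exists>\<omega>. proper_stress n E p \<omega>"
  shows "\<exists>\<omega>. proper_stress n E q \<omega>"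
proof -
  define \<gamma> where "\<gamma> t i = (vector [(1 - t) * (p i)$1 + t * (q i)$1, ((1 - t) * (p i)$1 + t * (q i)$1)\<^sup>2] :: real^2)"
    for t :: real and i :: nat
  have px: "(p i)$1 < (p j)$1" "(q i)$1 < (q j)$1" if "i < j" "j < n" for i j
    using p q that by (auto simp: convex_chain_def)
  have chain: "convex_chain n (\<gamma> t)" if t: "t \<in> {0..1}" for t
    unfolding \<gamma>_def
  proof (rule convex_chain_parabola)
    fix i j assume ij: "i < j" "j < n"
    show "(1 - t) * (p i)$1 + t * (q i)$1 < (1 - t) * (p j)$1 + t * (q j)$1"
    proof (cases "t = 0")
      case False
      then show ?thesis using px[OF ij] t by (intro add_le_less_mono mult_left_mono mult_strict_left_mono) auto
    qed (use px[OF ij] in simp)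
  qed
  have "\<exists>\<omega>. proper_stress n E (\<gamma> 0) \<omega>"
    by (rule proper_stress_vertical_path[OF G card p _ _ ps]) (use chain in \<open>auto simp: \<gamma>_def\<close>)
  then have "\<exists>\<omega>. proper_stress n E (\<gamma> 1) \<omega>"
  proof (rule proper_stress_along_path[OF G card, where s = 1, rotated -1])
    show "continuous_on {0..1} (\<lambda>t. \<gamma> t i)" for i
    proof -
      have "\<gamma> t i = ((1 - t) * (p i)$1 + t * (q i)$1) *\<^sub>R axis 1 1 + (((1 - t) * (p i)$1 + t * (q i)$1)\<^sup>2) *\<^sub>R axis 2 1" for t
        by (simp add: \<gamma>_def plane_eq_iff axis_def)
      then show ?thesis by (simp only:) (intro continuous_intros)
    qed
    show "convex_position 1 n (\<gamma> t)" if "t \<in> {0..1}" for t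
      using chain[OF that] by (simp add: convex_chain_def)
  qed
  then show ?thesis
    by (rule proper_stress_vertical_path[OF G card _ q, rotated -1]) (use chain in \<open>auto simp: \<gamma>_def\<close>)
qed

lemma proper_stress_transfer:
  assumes G: "minimal_braced n E" and card: "2 * n < card E + 3"
    and p: "convex_position 1 n p" and q: "convex_position 1 n q" and ps: "proper_stress n E p \<omega>"
  shows "\<exists>\<omega>. proper_stress n E q \<omega>"
proof -
  note G' = minimal_bracedD[OF G]
  obtain D S where DS: "affine_on n p D" "affine_on n p S" "\<And>i. i < n \<Longrightarrow> 0 < S i"
    "convex_chain n (\<lambda>i. vector [D i / S i, 1 / S i])"
    "affine_on n (\<lambda>i. vector [D i, S i]) (\<lambda>i. (p i)$1)" "affine_on n (\<lambda>i. vector [D i, S i]) (\<lambda>i. (p i)$2)"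
    by (rule projective_convex_chain[OF p G'(2)]) (rule that)
  obtain D' S' where DS': "affine_on n q D'" "affine_on n q S'" "\<And>i. i < n \<Longrightarrow> 0 < S' i" "convex_chain n (\<lambda>i. vector [D' i / S' i, 1 / S' i])"
    "affine_on n (\<lambda>i. vector [D' i, S' i]) (\<lambda>i. (q i)$1)" "affine_on n (\<lambda>i. vector [D' i, S' i]) (\<lambda>i. (q i)$2)"
    by (rule projective_convex_chain[OF q G'(2)]) (rule that)
  have "\<exists>\<omega>. proper_stress n E (\<lambda>i. vector [D i / S i, 1 / S i]) \<omega>"
    by (rule proper_stress_projective_image[OF G'(3,4) ps DS(1-3)])
  then have "\<exists>\<omega>. proper_stress n E (\<lambda>i. vector [D' i / S' i, 1 / S' i]) \<omega>"
    by (rule proper_stress_chain_transfer[OF G card DS(4) DS'(4)])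
  then show ?thesis
    using proper_stress_of_projective_image[OF G'(3,4) _ DS'(3) DS'(5,6)] by blast
qed

lemma properly_stressed_of_card:
  assumes G: "minimal_braced n E" and card: "2 * n < card E + 3" and s: "s = 1 \<or> s = -1"
    and q: "convex_position s n q"
  shows "properly_stressed n E q"
proof -
  obtain p \<omega> where p: "convex_position 1 n p" "proper_stress n E p \<omega>" using exists_properly_stressed[OF G] by blast
  \<comment> \<open>For \<open>s = - 1\<close> this is the mirror image.\<close>
  define r where "r i = (vector [(q i)$1, s * (q i)$2] :: real^2)" for i
  have "orient (r i) (r j) (r k) = s * orient (q i) (q j) (q k)" for i j k
    by (simp add: r_def orient_def cross_def algebra_simps)
  then have "convex_position 1 n r" using q by (simp add: convex_position_def)
  then obtain \<sigma> where \<sigma>: "proper_stress n E r \<sigma>" using proper_stress_transfer[OF G card p(1) _ p(2)] by blast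
  have "affine_on n r (\<lambda>i. (q i)$1)" unfolding affine_on_def
    by (rule exI[of _ 0], rule exI[of _ "vector [1, 0]"]) (simp add: r_def inner_plane)
  moreover have "affine_on n r (\<lambda>i. (q i)$2)" unfolding affine_on_def
    by (rule exI[of _ 0], rule exI[of _ "vector [0, s]"]) (use s in \<open>auto simp: r_def inner_plane\<close>)
  ultimately show ?thesis using proper_stress_affine_image[OF \<sigma>] by (auto simp: properly_stressed_def)
qed

section \<open>Counting edges\<close>

lemma card_boundary_edges:
  assumes "3 \<le> n" shows "card (boundary_edges n) = n"
proof -
  have "inj_on (\<lambda>i. {i, (i + 1) mod n}) {..<n}"
  proof (rule inj_onI)
    fix i j assume ij: "i \<in> {..<n}" "j \<in> {..<n}" "{i, (i + 1) mod n} = {j, (j + 1) mod n}"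
    show "i = j"
    proof (rule ccontr)
      assume "i \<noteq> j"
      then have "i = (j + 1) mod n" "j = (i + 1) mod n" using ij(3) by (auto simp: doubleton_eq_iff)
      then show False using ij(1,2) assms by (auto simp: mod_if split: if_splits)
    qed
  qed
  moreover have "boundary_edges n = (\<lambda>i. {i, (i + 1) mod n}) ` {..<n}"
    by (auto simp: boundary_edges_def)
  ultimately show ?thesis by (simp add: card_image)
qed

lemma card_edges:
  assumes G: "minimal_braced n E" shows "card E = n + card (braces n E)"
proof -
  note G' = minimal_bracedD[OF G]
  have "card (braces n E) = card E - card (boundary_edges n)"
    unfolding braces_def using G'(4) simple_graph_finite[OF simple_graph_boundary[OF G'(2)]] by (rule card_Diff_subset[rotated])
  moreover have "card (boundary_edges n) \<le> card E"
    using G'(4) simple_graph_finite[OF G'(3)] by (rule card_mono[rotated])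
  ultimately show ?thesis using card_boundary_edges[OF G'(2)] by simp
qed

text \<open>One edge length \<open>f\<close> in the support of the stress is redundant for flexes. With fewer than \<open>2 n - 2\<close>
edges, the other edges and three conditions that pin down vertex \<open>0\<close> and the direction from it to vertex \<open>1\<close>
are fewer than \<open>2 n\<close> equations, and leave a nontrivial flex.\<close>

lemma infinitesimally_rigid_card_ge:
  assumes G: "minimal_braced n E" and pos: "convex_position s n p" and ps: "proper_stress n E p \<omega>"
    and rigid: "infinitesimally_rigid n E p"
  shows "2 * n \<le> card E + 2"
proof (rule ccontr)
  assume "\<not> 2 * n \<le> card E + 2"
  note G' = minimal_bracedD[OF G]
  have finE: "finite E" using simple_graph_finite[OF G'(3)] .
  obtain f where f: "f \<in> E" "\<omega> f \<noteq> 0" using proper_stress_nonzero[OF G ps] by blast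
  define d where "d = p 1 - p 0"
  have d: "d \<noteq> 0" using inj_onD[OF inj_on_convex_position[OF pos G'(2)], of 1 0] G'(1) by (auto simp: d_def)
  define I where "I = {..<n} \<times> (UNIV :: bool set)"
  \<comment> \<open>Equations \<open>Inr 0\<close> and \<open>Inr 1\<close> fix vertex \<open>0\<close>; equation \<open>Inr 2\<close> excludes rotations.\<close>
  define J where "J = Inl ` (E - {f}) \<union> Inr ` {0, 1, 2 :: nat}"
  define co where "co b = (if b then 1 else 2 :: 2)" for b
  define a where "a k ib = (case k of
      Inl e \<Rightarrow> (\<Sum>j<n. if {fst ib, j} = e then (p (fst ib) - p j) $ co (snd ib) else 0)
    | Inr m \<Rightarrow> (if m = 2 then (if fst ib = 1 then perp d $ co (snd ib) else 0)
        else if fst ib = 0 \<and> (snd ib \<longleftrightarrow> m = 0) then 1 else 0))" for k :: "nat set + nat" and ib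
  have "card J = card (E - {f}) + 3"
    unfolding J_def using finE by (subst card_Un_disjoint) (auto simp: card_image)
  also have "card (E - {f}) = card E - 1" using f finE by simp
  also have "card E - 1 + 3 < card I"
  proof -
    have "card E \<noteq> 0" using f finE by auto
    then show ?thesis using \<open>\<not> 2 * n \<le> card E + 2\<close> by (simp add: I_def card_cartesian_product)
  qed
  finally have cJ: "card J < card I" .
  have fin: "finite J" "finite I" using finE by (auto simp: J_def I_def)
  obtain x where x: "\<exists>ib\<in>I. x ib \<noteq> 0" "\<And>ib. ib \<notin> I \<Longrightarrow> x ib = 0" "\<And>k. k \<in> J \<Longrightarrow> (\<Sum>ib\<in>I. a k ib * x ib) = 0"
    by (rule homogeneous_system_solution[OF fin cJ, where a = a]) (rule that)
  define p' where "p' i = (vector [x (i, True), x (i, False)] :: real^2)" for i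
  have sumI: "(\<Sum>ib\<in>I. g ib) = (\<Sum>i<n. g (i, True) + g (i, False))" for g :: "nat \<times> bool \<Rightarrow> real"
  proof -
    have "(\<Sum>ib\<in>I. g ib) = (\<Sum>i<n. \<Sum>b\<in>UNIV. g (i, b))"
      unfolding I_def by (simp add: sum.cartesian_product)
    then show ?thesis by (simp add: UNIV_bool add.commute)
  qed
  have ef: "edge_form n e p p' = (\<Sum>ib\<in>I. a (Inl e) ib * x ib)" for e
  proof -
    have "(\<Sum>j<n. if {i, j} = e then inner (p i - p j) (p' i) else 0) = a (Inl e) (i, True) * x (i, True) + a (Inl e) (i, False) * x (i, False)" for i
      unfolding a_def sum.case fst_conv snd_conv sum_distrib_right sum.distrib[symmetric]
      by (intro sum.cong refl) (simp add: inner_plane p'_def co_def)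
    then show ?thesis unfolding sumI edge_form_def by simp
  qed
  have e0: "edge_form n e p p' = 0" if e: "e \<in> E" "e \<noteq> f" for e
    unfolding ef using e by (intro x(3)) (simp add: J_def)
  have "(\<Sum>e\<in>E. \<omega> e * edge_form n e p p') = 0"
  proof -
    have "(\<Sum>e\<in>E. \<omega> e * edge_form n e p p') = (\<Sum>i<n. inner (\<Sum>j<n. stress_coeff E \<omega> i j *\<^sub>R (p i - p j)) (p' i))"
      by (rule virtual_work[OF finE])
    also have "\<dots> = 0" using ps by (simp add: proper_stress_def equilibrium_stress_def)
    finally show ?thesis .
  qed
  moreover have "(\<Sum>e\<in>E. \<omega> e * edge_form n e p p') = \<omega> f * edge_form n f p p'"
  proof -
    have "(\<Sum>e\<in>E. \<omega> e * edge_form n e p p') = (\<Sum>e\<in>{f}. \<omega> e * edge_form n e p p')"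
      using f finE e0 by (intro sum.mono_neutral_right) auto
    then show ?thesis by simp
  qed
  ultimately have "edge_form n f p p' = 0" using f(2) by simp
  then have all0: "edge_form n e p p' = 0" if "e \<in> E" for e using e0 that by blast
  have "infinitesimal_flex E p p'"
    unfolding infinitesimal_flex_def
  proof (intro allI impI)
    fix i j assume ij: "{i, j} \<in> E"
    show "inner (p i - p j) (p' i - p' j) = 0"
      using all0[OF ij] edge_form_pair[OF simple_graph_edgeD[OF G'(3) ij]] by simp
  qed
  then have tf: "trivial_flex n p p'" using rigid by (simp add: infinitesimally_rigid_def)
  have "inner (p i - p j) (p' i - p' j) = 0" if "i < n" "j < n" for i j
    by (rule trivial_flex_pairs[OF tf that])
  then obtain c b where cb: "\<And>i. i < n \<Longrightarrow> p' i = c *\<^sub>R perp (p i) + b"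
    using complete_flex_is_rotation[OF pos G'(2)] by metis
  have n1: "0 < n" "1 < n" using G'(1) by auto
  have pin: "(\<Sum>i<n. a (Inr m) (i, True) * x (i, True) + a (Inr m) (i, False) * x (i, False)) = 0" if "m \<in> {0, 1, 2}" for m
    using x(3)[of "Inr m"] that unfolding sumI by (auto simp: J_def)
  have "x (0, True) = 0"
  proof -
    have "(\<Sum>i<n. a (Inr 0) (i, True) * x (i, True) + a (Inr 0) (i, False) * x (i, False)) = (\<Sum>i<n. if i = 0 then x (0, True) else 0)"
      by (intro sum.cong refl) (simp add: a_def)
    then show ?thesis using pin[of 0] n1 by simp
  qed
  moreover have "x (0, False) = 0"
  proof -
    have "(\<Sum>i<n. a (Inr 1) (i, True) * x (i, True) + a (Inr 1) (i, False) * x (i, False)) = (\<Sum>i<n. if i = 0 then x (0, False) else 0)"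
      by (intro sum.cong refl) (simp add: a_def)
    then show ?thesis using pin[of 1] n1 by simp
  qed
  ultimately have p0: "p' 0 = 0" by (simp add: p'_def plane_eq_iff)
  have p1: "inner (perp d) (p' 1) = 0"
  proof -
    have "(\<Sum>i<n. a (Inr 2) (i, True) * x (i, True) + a (Inr 2) (i, False) * x (i, False)) = (\<Sum>i<n. if i = 1 then inner (perp d) (p' 1) else 0)"
      by (intro sum.cong refl) (simp add: a_def inner_plane p'_def co_def)
    then show ?thesis using pin[of 2] n1 by simp
  qed
  have "p' 1 = p' 1 - p' 0" using p0 by simp
  also have "\<dots> = c *\<^sub>R perp d" unfolding cb[OF n1(1)] cb[OF n1(2)] by (simp add: d_def perp_simps(2) scaleR_diff_right)
  finally have "c * inner (perp d) (perp d) = 0" using p1 by simp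
  then have "c = 0" using d by (simp add: perp_simps(7,8))
  moreover have "b = 0" using cb[OF n1(1)] p0 \<open>c = 0\<close> by simp
  ultimately have z: "p' i = 0" if "i < n" for i using cb[OF that] by simp
  have "x (i, b) = 0" if "i < n" for i b
    using z[OF that] by (cases b) (auto simp: p'_def plane_eq_iff)
  then show False using x(1) by (auto simp: I_def)
qed

text \<open>With more edges, there would be a stress that avoids a given brace.\<close>

lemma proper_stress_card_le:
  assumes G: "minimal_braced n E" and pos: "convex_position s n p" and ps: "proper_stress n E p \<omega>"
  shows "card E + 2 \<le> 2 * n"
proof (rule ccontr)
  assume many: "\<not> card E + 2 \<le> 2 * n"
  note G' = minimal_bracedD[OF G]
  have finE: "finite E" using simple_graph_finite[OF G'(3)] .
  obtain f where f: "f \<in> braces n E" using braces_nonempty[OF G] by blast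
  have fE: "f \<in> E" using f by (simp add: braces_def)
  have sg: "simple_graph {..<n} (E - {f})" using G'(3) by (auto simp: simple_graph_def)
  obtain \<sigma> where \<sigma>: "equilibrium_stress n (E - {f}) p \<sigma>" "\<exists>e\<in>E - {f}. \<sigma> e \<noteq> 0" "\<And>e. e \<notin> E - {f} \<Longrightarrow> \<sigma> e = 0"
  proof (rule exists_stress[OF subset_refl inj_on_convex_position[OF pos G'(2)] _ sg])
    show "2 \<le> card {..<n}" using G'(1) by simp
    show "2 * card {..<n} < card (E - {f}) + 3" using many fE finE by (simp add: card_Diff_singleton)
  qed blast
  have "stress_coeff E \<sigma> = stress_coeff (E - {f}) \<sigma>"
    using \<sigma>(3) by (intro ext) (auto simp: stress_coeff_def)
  then have "equilibrium_stress n E p \<sigma>" using \<sigma>(1) by (simp add: equilibrium_stress_balanced)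
  then obtain c where c: "\<And>e. e \<in> E \<Longrightarrow> \<sigma> e = c * \<omega> e" using stress_unique[OF G pos ps] by blast
  have "\<omega> f < 0" using ps f by (simp add: proper_stress_def)
  then have "c = 0" using c[OF fE] \<sigma>(3)[of f] by simp
  then show False using c \<sigma>(2) by auto
qed

text \<open>A subgraph that violates the count carries a stress. By uniqueness this is a multiple of the proper one, which has no
zeros, although a boundary edge at a vertex outside \<open>W\<close> carries no stress.\<close>

lemma rigidity_circuit_of_proper_stress:
  assumes G: "minimal_braced n E" and pos: "convex_position s n p" and ps: "proper_stress n E p \<omega>"
    and card: "card E + 2 = 2 * n"
  shows "generic_rigidity_circuit n E"
  unfolding generic_rigidity_circuit_def
proof (intro conjI allI impI card)
  note G' = minimal_bracedD[OF G]
  fix W F assume WF: "subgraph W F {..<n} E \<and> 2 \<le> card W \<and> card W < n"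
  show "card F + 3 \<le> 2 * card W"
  proof (rule ccontr)
    assume many: "\<not> card F + 3 \<le> 2 * card W"
    have W: "W \<subseteq> {..<n}" "simple_graph W F" "F \<subseteq> E" "2 \<le> card W" "card W < n"
      using WF by (auto simp: subgraph_def)
    have inj: "inj_on p W" using inj_on_convex_position[OF pos G'(2)] W(1) inj_on_subset by blast
    obtain \<sigma> where \<sigma>: "equilibrium_stress n F p \<sigma>" "\<exists>e\<in>F. \<sigma> e \<noteq> 0" "\<And>e. e \<notin> F \<Longrightarrow> \<sigma> e = 0"
      by (rule exists_stress[OF W(1) inj W(4,2)]) (use many in auto)
    have "stress_coeff E \<sigma> = stress_coeff F \<sigma>"
      using \<sigma>(3) W(3) by (intro ext) (auto simp: stress_coeff_def)
    then have "equilibrium_stress n E p \<sigma>" using \<sigma>(1) by (simp add: equilibrium_stress_balanced)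
    then obtain c where c: "\<And>e. e \<in> E \<Longrightarrow> \<sigma> e = c * \<omega> e" using stress_unique[OF G pos ps] by blast
    have "W \<noteq> {..<n}" using W(5) by auto
    then obtain i where i: "i < n" "i \<notin> W" using W(1) by auto
    let ?e = "{i, (i + 1) mod n}"
    have e: "?e \<in> boundary_edges n" using boundary_edge_memb[OF i(1)] .
    then have "0 < \<omega> ?e" using ps by (simp add: proper_stress_def)
    moreover have "?e \<notin> F" using W(2) i(2) by (auto simp: simple_graph_def doubleton_eq_iff)
    then have "c * \<omega> ?e = 0" using c[of ?e] \<sigma>(3)[of ?e] e G'(4) by auto
    ultimately have "c = 0" by simp
    then show False using c \<sigma>(2) W(3) by auto
  qed
qed

theorem theorem3p6:
  fixes n :: nat and E :: "nat set set"
  assumes "4 \<le> n"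
    and "minimally_3_connected_braced_polygon n E"
  shows "all_equivalent
    [\<forall>p :: nat \<Rightarrow> real^2. strictly_convex_polygon n p \<longrightarrow> infinitesimally_rigid n E p,
     \<forall>p :: nat \<Rightarrow> real^2. strictly_convex_polygon n p \<longrightarrow> convexly_rigid n E p,
     \<forall>p :: nat \<Rightarrow> real^2. strictly_convex_polygon n p \<longrightarrow> globally_rigid n E p,
     \<forall>p :: nat \<Rightarrow> real^2. strictly_convex_polygon n p \<longrightarrow> super_stable n E p,
     \<forall>p :: nat \<Rightarrow> real^2. strictly_convex_polygon n p \<longrightarrow> properly_stressed n E p,
     generic_rigidity_circuit n E,
     card (braces n E) = n - 2]"
    (is "all_equivalent [?a, ?b, ?c, ?d, ?e, ?g, ?h]")
proof -
  have G: "minimal_braced n E" using assms by (simp add: minimal_braced_def)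
  note G' = minimal_bracedD[OF G]
  note scp = convex_position_of_strictly_convex_polygon[OF _ G'(2)]
  obtain p \<omega> where p: "convex_position 1 n p" "proper_stress n E p \<omega>" using exists_properly_stressed[OF G] by blast
  have h_iff: "?h \<longleftrightarrow> card E + 2 = 2 * n" using card_edges[OF G] G'(1) by auto
  have he: ?e if ?h
  proof (intro allI impI)
    fix q :: "nat \<Rightarrow> real^2" assume "strictly_convex_polygon n q"
    then obtain s where s: "s = 1 \<or> s = - 1" "convex_position s n q" by (rule scp)
    show "properly_stressed n E q"
      by (rule properly_stressed_of_card[OF G _ s]) (use that h_iff in linarith)
  qed
  have ed: ?d if ?e
  proof (intro allI impI)
    fix q :: "nat \<Rightarrow> real^2" assume q: "strictly_convex_polygon n q"
    then obtain s where s: "convex_position s n q" by (rule scp)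
    obtain \<sigma> where "proper_stress n E q \<sigma>" using \<open>?e\<close> q unfolding properly_stressed_def by blast
    then show "super_stable n E q" by (rule super_stable_of_proper_stress[OF G s])
  qed
  have dc: ?c if ?d
  proof (intro allI impI)
    fix q :: "nat \<Rightarrow> real^2" assume q: "strictly_convex_polygon n q"
    then obtain s where s: "convex_position s n q" by (rule scp)
    show "globally_rigid n E q" using \<open>?d\<close> q by (intro globally_rigid_of_super_stable[OF G s]) blast
  qed
  have cb: ?b if ?c
    using that unfolding globally_rigid_def convexly_rigid_def by blast
  have ba: ?a if ?b
  proof (intro allI impI)
    fix q :: "nat \<Rightarrow> real^2" assume "strictly_convex_polygon n q"
    then obtain s where s: "convex_position s n q" by (rule scp)
    show "infinitesimally_rigid n E q"
      by (rule infinitesimally_rigid_of_convexly_rigid[OF G s]) (use \<open>?b\<close> in blast)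
  qed
  have ah: ?h if ?a
  proof -
    have "infinitesimally_rigid n E p"
      using that strictly_convex_polygon_of_convex_position[OF p(1) G'(2)] by blast
    then show ?thesis
      using infinitesimally_rigid_card_ge[OF G p] proper_stress_card_le[OF G p] h_iff by linarith
  qed
  have hg: ?g if ?h
    using rigidity_circuit_of_proper_stress[OF G p] that h_iff by blast
  have gh: ?h if ?g
    using that h_iff by (simp add: generic_rigidity_circuit_def)
  have "?a \<longleftrightarrow> ?h" "?b \<longleftrightarrow> ?h" "?c \<longleftrightarrow> ?h" "?d \<longleftrightarrow> ?h" "?e \<longleftrightarrow> ?h" "?g \<longleftrightarrow> ?h"
    using he ed dc cb ba ah hg gh by satx+
  then show ?thesis unfolding all_equivalent_def by simp
qed

end
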